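(* Assume the Riemann hypothesis and assume that $$ \liminf_{\gamma'\to\infty}(\beta'-\tfrac{1}{2})\log\gamma'=0 . $$ Then $$ \liminf_{\gamma'\to\infty}|\gamma_c-\gamma'|\log\gamma'=0 . $$
   Context: $\zeta(s)$ is the Riemann zeta-function and $\zeta'(s)$ its derivative. The non-real zeros of $\zeta'(s)$ are denoted $\rho'=\beta'+i\gamma'$ (with $\beta',\gamma'$ real), and $\liminf_{\gamma'\to\infty}$ is the lower limit taken over these zeros as $\gamma'\to\infty$. The non-trivial zeros of $\zeta(s)$ are those in the critical strip $0\le\Re s\le 1$; the Riemann hypothesis asserts that they all have real part $\frac12$. For a zero $\rho'=\beta'+i\gamma'$ of $\zeta'(s)$, $\gamma_c$ (which depends on $\rho'$) denotes the one among all ordinates (imaginary parts) of non-trivial zeros of $\zeta(s)$ for which $|\gamma_c-\gamma'|$ is smallest (if there is more than one such zero of $\zeta(s)$, $\gamma_c$ is the imaginary part of any one of them). *)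

theory Defs
  imports "HOL-Complex_Analysis.Complex_Analysis"
begin

section \<open>The Riemann zeta function\<close>

definition zeta_series :: "complex \<Rightarrow> complex" where
  "zeta_series s = (\<Sum>n. 1 / of_nat (Suc n) powr s)"

text \<open>
  The analytic continuation of the Dirichlet series to the complex plane without the pole
  at \<open>1\<close>. The value at \<open>1\<close> is set to \<open>0\<close> by convention; below, \<open>1\<close> is
  never counted as a zero. Existence and uniqueness are shown in \<open>is_zeta_ex1\<close>.
\<close>
definition is_zeta :: "(complex \<Rightarrow> complex) \<Rightarrow> bool" where
  "is_zeta f \<longleftrightarrow> f holomorphic_on (- {1}) \<and> (\<forall>s. Re s > 1 \<longrightarrow> f s = zeta_series s) \<and> f 1 = 0"

definition zeta :: "complex \<Rightarrow> complex" where
  "zeta = (THE f. is_zeta f)"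

definition zeta_nontrivial_zeros :: "complex set" where
  "zeta_nontrivial_zeros = {s. s \<noteq> 1 \<and> 0 \<le> Re s \<and> Re s \<le> 1 \<and> zeta s = 0}"

definition riemann_hypothesis :: bool where
  "riemann_hypothesis \<longleftrightarrow> (\<forall>s\<in>zeta_nontrivial_zeros. Re s = 1 / 2)"

definition zeta_deriv_nonreal_zeros :: "complex set" where
  "zeta_deriv_nonreal_zeros = {s. Im s \<noteq> 0 \<and> deriv zeta s = 0}"

text \<open>
  \<open>g\<close> is an ordinate of a nontrivial zero of zeta at minimal distance from \<open>t\<close>. There may be
  more than one such ordinate, hence a predicate.
\<close>
definition is_nearest_zeta_ordinate :: "real \<Rightarrow> real \<Rightarrow> bool" where
  "is_nearest_zeta_ordinate t g \<longleftrightarrow>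
     g \<in> Im ` zeta_nontrivial_zeros \<and> (\<forall>h\<in>Im ` zeta_nontrivial_zeros. \<bar>g - t\<bar> \<le> \<bar>h - t\<bar>)"

text \<open>The lower limit of \<open>f \<rho>\<close> over the nonreal zeros \<open>\<rho>\<close> of \<open>deriv zeta\<close> as \<open>Im \<rho> \<rightarrow> \<infinity>\<close>.\<close>
definition liminf_zeta_deriv_zeros :: "(complex \<Rightarrow> real) \<Rightarrow> ereal" where
  "liminf_zeta_deriv_zeros f =
     Liminf (inf (filtercomap Im at_top) (principal zeta_deriv_nonreal_zeros)) (\<lambda>\<rho>. ereal (f \<rho>))"


section \<open>Existence and uniqueness of the analytic continuation\<close>

text \<open>
  For \<open>Re s > 1\<close>, expand \<open>(n + 1) powr (1 - s)\<close> as \<open>n powr (1 - s)\<close> times a binomial polynomial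
  in \<open>1 / n\<close> of degree \<open>K\<close>, and sum the telescoping differences \<open>(n + 1) powr (1 - s) - n powr (1 - s)\<close>.
  This expresses \<open>(s - 1) * zeta_series s\<close> through \<open>zeta_series\<close> at \<open>s + 1, s + 2, \<dots>\<close> and a
  remainder series converging for \<open>Re s > 1 - K\<close>, so the domain grows by induction.
\<close>

definition falling :: "complex \<Rightarrow> nat \<Rightarrow> complex" where
  "falling a k = (\<Prod>i<k. a - of_nat i)"

lemma falling_0 [simp]: "falling a 0 = 1"
  and falling_Suc [simp]: "falling a (Suc k) = falling a k * (a - of_nat k)"
  by (simp_all add: falling_def mult.commute)

lemma holomorphic_falling [holomorphic_intros]:
  "f holomorphic_on A \<Longrightarrow> (\<lambda>s. falling (f s) k) holomorphic_on A"
  unfolding falling_def by (intro holomorphic_intros) auto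

lemma norm_falling_le:
  assumes "norm a \<le> R"
  shows "norm (falling a k) \<le> (R + real k) ^ k"
proof -
  have "norm (falling a k) = (\<Prod>i<k. norm (a - of_nat i))"
    by (simp add: falling_def prod_norm)
  also have "\<dots> \<le> (\<Prod>i<k. R + real k)"
  proof (intro prod_mono conjI)
    fix i assume "i \<in> {..<k}"
    have "norm (a - of_nat i) \<le> norm a + real i"
      using norm_triangle_ineq4[of a "of_nat i"] by simp
    thus "norm (a - of_nat i) \<le> R + real k" using assms \<open>i \<in> _\<close> by simp
  qed auto
  finally show ?thesis by simp
qed

lemma binomial_taylor_bound:
  fixes t :: real
  assumes t: "0 \<le> t" "t \<le> 1" and R: "norm a \<le> R"
  shows "norm ((1 + of_real t) powr a - (\<Sum>k\<le>K. falling a k / fact k * of_real t ^ k))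
           \<le> (R + real (Suc K)) ^ Suc K * 2 powr R * t ^ Suc K"
proof -
  have R0: "R \<ge> 0" using R norm_ge_zero[of a] by linarith
  define f where "f = (\<lambda>i x. falling a i * (1 + x) powr (a - of_nat i))"
  define S where "S = closed_segment 0 (1 :: complex)"
  have S: "\<exists>u. x = of_real u \<and> 0 \<le> u \<and> u \<le> 1" if "x \<in> S" for x
    using that by (auto simp: S_def closed_segment_def scaleR_conv_of_real)
  have B: "norm (f (Suc K) x) \<le> (R + real (Suc K)) ^ Suc K * 2 powr R" if "x \<in> S" for x
  proof -
    obtain u where u: "x = of_real u" "0 \<le> u" "u \<le> 1" using S[OF \<open>x \<in> S\<close>] by blast
    have "norm ((1 + x) powr (a - of_nat (Suc K))) = (1 + u) powr (Re a - real (Suc K))"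
      using u by (subst norm_powr_real_powr) auto
    also have "\<dots> \<le> (1 + u) powr R"
      using u R complex_Re_le_cmod[of a] by (intro powr_mono) auto
    also have "\<dots> \<le> 2 powr R"
      using u R0 by (intro powr_mono2) auto
    finally show ?thesis unfolding f_def norm_mult
      using R R0 by (intro mult_mono norm_falling_le) auto
  qed
  have "norm (f 0 (of_real t) - (\<Sum>i\<le>K. f i 0 * (of_real t - 0) ^ i / fact i))
          \<le> ((R + real (Suc K)) ^ Suc K * 2 powr R) * norm (of_real t - 0 :: complex) ^ Suc K / fact K"
  proof (rule complex_Taylor[where S = S])
    show "convex S" by (simp add: S_def)
    show "(0::complex) \<in> S" by (simp add: S_def)
    show "complex_of_real t \<in> S"
      using t by (auto simp: S_def closed_segment_def scaleR_conv_of_real)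
    fix i x assume "x \<in> S"
    then obtain u where u: "x = of_real u" "0 \<le> u" "u \<le> 1" using S by blast
    have *: "1 + x \<notin> \<real>\<^sub>\<le>\<^sub>0"
      using u by (auto simp: complex_nonpos_Reals_iff)
    show "(f i has_field_derivative f (Suc i) x) (at x within S)"
      unfolding f_def using *
      by (auto intro!: derivative_eq_intros simp: algebra_simps)
  qed (use B in auto)
  also have "\<dots> \<le> (R + real (Suc K)) ^ Suc K * 2 powr R * t ^ Suc K"
  proof -
    have "X / fact K \<le> X" if "X \<ge> 0" for X :: real
      using that fact_ge_1[of K, where 'a = real] by (simp add: divide_le_eq mult_le_cancel_left1)
    thus ?thesis using t R0 by simp
  qed
  finally show ?thesis by (simp add: f_def)
qed

definition remainder_term :: "nat \<Rightarrow> nat \<Rightarrow> complex \<Rightarrow> complex" where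
  "remainder_term K n s = of_nat (Suc n) powr (1 - s) *
     ((1 + of_real (1 / real (Suc n))) powr (1 - s) -
      (\<Sum>k\<le>K. falling (1 - s) k / fact k * of_real (1 / real (Suc n)) ^ k))"

definition remainder_sum :: "nat \<Rightarrow> complex \<Rightarrow> complex" where
  "remainder_sum K s = (\<Sum>n. remainder_term K n s)"

lemma norm_remainder_term_le:
  assumes "norm (1 - s) \<le> R" "\<sigma> \<le> Re s"
  shows "norm (remainder_term K n s)
           \<le> (R + real (Suc K)) ^ Suc K * 2 powr R * real (Suc n) powr (- \<sigma> - real K)"
proof -
  define C where "C = (R + real (Suc K)) ^ Suc K * 2 powr R"
  have R0: "R \<ge> 0" using assms(1) norm_ge_zero[of "1 - s"] by linarith
  have C: "C \<ge> 0" unfolding C_def using R0 by simp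
  have "norm (remainder_term K n s) \<le>
          real (Suc n) powr (1 - Re s) * (C * (1 / real (Suc n)) ^ Suc K)"
    unfolding remainder_term_def norm_mult C_def
  proof (intro mult_mono)
    show "norm (complex_of_nat (Suc n) powr (1 - s)) \<le> real (Suc n) powr (1 - Re s)"
      by (subst norm_powr_real_powr) auto
    show "norm ((1 + complex_of_real (1 / real (Suc n))) powr (1 - s) -
             (\<Sum>k\<le>K. falling (1 - s) k / fact k * of_real (1 / real (Suc n)) ^ k))
           \<le> (R + real (Suc K)) ^ Suc K * 2 powr R * (1 / real (Suc n)) ^ Suc K"
      by (rule binomial_taylor_bound) (use assms(1) in auto)
  qed auto
  also have "(1 / real (Suc n)) ^ Suc K = real (Suc n) powr (- real (Suc K))"
    by (subst powr_minus, subst powr_realpow) (auto simp: divide_simps power_one_over simp del: of_nat_Suc)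
  also have "real (Suc n) powr (1 - Re s) * (C * real (Suc n) powr (- real (Suc K)))
               = C * real (Suc n) powr (- Re s - real K)"
    by (simp add: powr_add[symmetric] mult_ac)
  also have "\<dots> \<le> C * real (Suc n) powr (- \<sigma> - real K)"
    using C assms(2) by (intro mult_left_mono powr_mono) auto
  finally show ?thesis by (simp add: C_def)
qed

lemma summable_Suc_powr:
  assumes "x < -1"
  shows "summable (\<lambda>n. c * real (Suc n) powr x)"
  using assms summable_real_powr_iff[of x] summable_Suc_iff[of "\<lambda>n. real n powr x"]
  by (intro summable_mult) auto

lemma summable_remainder_term:
  assumes "Re s > 1 - real K"
  shows "summable (\<lambda>n. remainder_term K n s)"
proof (rule summable_comparison_test')
  show "summable (\<lambda>n. (norm (1 - s) + real (Suc K)) ^ Suc K * 2 powr norm (1 - s) *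
                    real (Suc n) powr (- Re s - real K))"
    by (rule summable_Suc_powr) (use assms in auto)
  show "norm (remainder_term K n s) \<le> (norm (1 - s) + real (Suc K)) ^ Suc K * 2 powr norm (1 - s) *
                    real (Suc n) powr (- Re s - real K)" if "n \<ge> 0" for n
    by (rule norm_remainder_term_le) auto
qed

lemma holomorphic_remainder_sum:
  "remainder_sum K holomorphic_on {s. Re s > 1 - real K}"
proof (rule holomorphic_uniform_sequence)
  show op: "open {s. Re s > 1 - real K}"
    by (simp add: open_halfspace_Re_gt)
  show "(\<lambda>s. \<Sum>i<n. remainder_term K i s) holomorphic_on {s. Re s > 1 - real K}" for n
  proof -
    have "1 + complex_of_real (1 / real (Suc i)) \<noteq> 0" for i
    proof -
      have "Re (1 + complex_of_real (1 / real (Suc i))) > 0"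
        unfolding plus_complex.sel Re_complex_of_real by (simp add: add_pos_nonneg)
      thus ?thesis by (metis less_irrefl zero_complex.sel(1))
    qed
    thus ?thesis unfolding remainder_term_def
      by (intro holomorphic_intros) (auto simp del: of_nat_Suc)
  qed
  fix z assume "z \<in> {s. Re s > 1 - real K}"
  then obtain d where d: "d > 0" "cball z d \<subseteq> {s. Re s > 1 - real K}"
    using op open_contains_cball by blast
  define \<sigma> where "\<sigma> = Re z - d"
  define R where "R = norm (1 - z) + d"
  have "z - of_real d \<in> cball z d" using d by (auto simp: dist_norm)
  with d(2) have "z - of_real d \<in> {s. Re s > 1 - real K}" by (rule subsetD)
  hence \<sigma>: "\<sigma> > 1 - real K" by (simp add: \<sigma>_def)
  have "uniform_limit (cball z d) (\<lambda>n s. \<Sum>i<n. remainder_term K i s) (remainder_sum K) sequentially"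
    unfolding remainder_sum_def
  proof (rule Weierstrass_m_test)
    show "summable (\<lambda>n. (R + real (Suc K)) ^ Suc K * 2 powr R * real (Suc n) powr (- \<sigma> - real K))"
      by (rule summable_Suc_powr) (use \<sigma> in auto)
    fix n s assume s: "s \<in> cball z d"
    have "norm (1 - s) \<le> norm (1 - z) + norm (z - s)"
      using norm_triangle_ineq[of "1 - z" "z - s"] by simp
    moreover have "Re z - Re s \<le> norm (z - s)"
      using complex_Re_le_cmod[of "z - s"] by simp
    ultimately show "norm (remainder_term K n s)
        \<le> (R + real (Suc K)) ^ Suc K * 2 powr R * real (Suc n) powr (- \<sigma> - real K)"
      using s by (intro norm_remainder_term_le) (auto simp: R_def \<sigma>_def dist_norm)
  qed
  with d show "\<exists>d>0. cball z d \<subseteq> {s. Re s > 1 - real K} \<and>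
     uniform_limit (cball z d) (\<lambda>n s. \<Sum>i<n. remainder_term K i s) (remainder_sum K) sequentially"
    by blast
qed

lemma sums_zeta_series:
  assumes "Re s > 1"
  shows "(\<lambda>n. 1 / of_nat (Suc n) powr s) sums zeta_series s"
proof -
  have "summable (\<lambda>n. 1 / of_nat (Suc n) powr s)"
  proof (rule summable_comparison_test')
    show "summable (\<lambda>n. 1 * real (Suc n) powr (- Re s))"
      by (rule summable_Suc_powr) (use assms in auto)
    show "norm (1 / of_nat (Suc n) powr s) \<le> 1 * real (Suc n) powr (- Re s)" if "n \<ge> 0" for n
      unfolding norm_divide by (subst norm_powr_real_powr) (auto simp: powr_minus field_simps)
  qed
  thus ?thesis unfolding zeta_series_def by (rule summable_sums)
qed

lemma zeta_series_recurrence: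
  assumes s: "Re s > 1" and K: "K \<ge> 1"
  shows "(s - 1) * zeta_series s =
           1 + (\<Sum>k\<in>{2..K}. falling (1 - s) k / fact k * zeta_series (s + of_nat k - 1)) + remainder_sum K s"
proof -
  define c where "c = (\<lambda>k. falling (1 - s) k / fact k)"
  have "(\<lambda>n. of_nat n powr (1 - s)) \<longlonglongrightarrow> 0"
    by (rule tendsto_neg_powr_complex_of_nat) (use s in \<open>auto simp: filterlim_ident\<close>)
  hence "(\<lambda>n. of_nat (Suc n) powr (1 - s)) \<longlonglongrightarrow> 0"
    by (rule LIMSEQ_Suc)
  from telescope_sums[OF this]
  have 1: "(\<lambda>n. of_nat (Suc (Suc n)) powr (1 - s) - of_nat (Suc n) powr (1 - s)) sums (- 1)"
    by simp
  have 2: "(\<lambda>n. (\<Sum>k\<in>{1..K}. c k * (1 / of_nat (Suc n) powr (s + of_nat k - 1))) + remainder_term K n s) sums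
          ((\<Sum>k\<in>{1..K}. c k * zeta_series (s + of_nat k - 1)) + remainder_sum K s)"
    unfolding remainder_sum_def
    by (intro sums_add sums_sum sums_mult sums_zeta_series summable_sums summable_remainder_term)
       (use s K in auto)
  have eq: "of_nat (Suc (Suc n)) powr (1 - s) - of_nat (Suc n) powr (1 - s) =
         (\<Sum>k\<in>{1..K}. c k * (1 / of_nat (Suc n) powr (s + of_nat k - 1))) + remainder_term K n s" for n
  proof -
    define N where "N = real (Suc n)"
    have N: "N > 0" by (simp add: N_def)
    have Nc: "of_nat (Suc n) = complex_of_real N" unfolding N_def by simp
    have Nc': "of_nat (Suc (Suc n)) = complex_of_real (N * (1 + 1 / N))"
      using N unfolding N_def by (simp add: field_simps del: of_nat_Suc) (simp add: field_simps)
    have c_eq: "falling (1 - s) k / fact k = c k" for k by (simp add: c_def)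
    define P where "P = complex_of_real N powr (1 - s)"
    define B where "B = (1 + complex_of_real (1 / N)) powr (1 - s)"
    have 1: "complex_of_real (N * (1 + 1 / N)) powr (1 - s) = P * B"
      unfolding P_def B_def using N by (subst of_real_mult, subst powr_times_real) auto
    have "{..K} = insert 0 {1..K}" by auto
    hence 2: "(\<Sum>k\<le>K. c k * of_real (1 / N) ^ k) = 1 + (\<Sum>k\<in>{1..K}. c k * of_real (1 / N) ^ k)"
      by (simp add: c_def)
    have 3: "c k * (1 / of_real N powr (s + of_nat k - 1)) = P * (c k * of_real (1 / N) ^ k)" for k
    proof -
      have "of_real N powr (s + of_nat k - 1) = complex_of_real N powr (of_nat k - (1 - s))"
        by (simp add: algebra_simps)
      also have "\<dots> = of_real N ^ k / of_real N powr (1 - s)"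
        using N by (simp add: powr_diff)
      finally show ?thesis using N by (simp add: P_def field_simps)
    qed
    show ?thesis
      unfolding remainder_term_def Nc Nc' N_def[symmetric] c_eq 1 P_def[symmetric]
        B_def[symmetric] 2 3 by (simp add: algebra_simps sum_distrib_left)
  qed
  have "- 1 = (\<Sum>k\<in>{1..K}. c k * zeta_series (s + of_nat k - 1)) + remainder_sum K s"
    using 1 2 unfolding eq by (rule sums_unique2)
  also have "{1..K} = insert 1 {2..K}" using K by auto
  finally have "- 1 = (1 - s) * zeta_series s +
      (\<Sum>k\<in>{2..K}. c k * zeta_series (s + of_nat k - 1)) + remainder_sum K s"
    by (simp add: c_def)
  thus ?thesis by (simp add: c_def algebra_simps)
qed

lemma zeta_continuation_halfplane:
  "\<exists>F. F holomorphic_on {s. Re s > - real m} \<and> (\<forall>s. Re s > 1 \<longrightarrow> F s = (s - 1) * zeta_series s)"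
proof (induction m)
  case 0
  have "(\<lambda>s. 1 + remainder_sum 1 s) holomorphic_on {s. Re s > - real 0}"
    using holomorphic_remainder_sum[of 1] by (auto intro!: holomorphic_intros)
  moreover have "\<forall>s. Re s > 1 \<longrightarrow> 1 + remainder_sum 1 s = (s - 1) * zeta_series s"
    using zeta_series_recurrence[of _ 1] by simp
  ultimately show ?case by blast
next
  case (Suc m)
  then obtain F where F: "F holomorphic_on {s. Re s > - real m}"
      "\<And>s. Re s > 1 \<Longrightarrow> F s = (s - 1) * zeta_series s" by blast
  define K where "K = Suc (Suc m)"
  define G where "G = (\<lambda>s. 1 + (\<Sum>k\<in>{2..K}. - falling (1 - s) (k - 1) / fact k * F (s + of_nat k - 1))
                          + remainder_sum K s)"
  have "(\<lambda>s. F (s + of_nat k - 1)) holomorphic_on {s. Re s > - real (Suc m)}" if "k \<in> {2..K}" for k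
  proof -
    have "(F \<circ> (\<lambda>s. s + of_nat k - 1)) holomorphic_on {s. Re s > - real (Suc m)}"
      using that by (intro holomorphic_on_compose_gen[OF _ F(1)] holomorphic_intros) auto
    thus ?thesis by (simp add: o_def)
  qed
  moreover have "remainder_sum K holomorphic_on {s. Re s > - real (Suc m)}"
    by (rule holomorphic_on_subset[OF holomorphic_remainder_sum]) (auto simp: K_def)
  ultimately have "G holomorphic_on {s. Re s > - real (Suc m)}"
    unfolding G_def by (intro holomorphic_intros) auto
  moreover have "G s = (s - 1) * zeta_series s" if s: "Re s > 1" for s
  proof -
    have "- falling (1 - s) (k - 1) / fact k * F (s + of_nat k - 1) =
            falling (1 - s) k / fact k * zeta_series (s + of_nat k - 1)" if k: "k \<in> {2..K}" for k
    proof -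
      obtain j where j: "k = Suc j" using k by (cases k) auto
      have "F (s + of_nat j) = (s + of_nat j - 1) * zeta_series (s + of_nat j)"
        by (rule F(2)) (use s in auto)
      thus ?thesis by (simp add: j divide_simps) (simp add: algebra_simps)
    qed
    thus ?thesis unfolding G_def by (subst zeta_series_recurrence[OF s, of K]) (auto simp: K_def)
  qed
  ultimately show ?case by blast
qed

lemma zeta_continuation_entire:
  "\<exists>F. F holomorphic_on UNIV \<and> (\<forall>s. Re s > 1 \<longrightarrow> F s = (s - 1) * zeta_series s)"
proof -
  from zeta_continuation_halfplane obtain F where
    F: "\<And>m. F m holomorphic_on {s. Re s > - real m}"
       "\<And>m s. Re s > 1 \<Longrightarrow> F m s = (s - 1) * zeta_series s" by metis
  have agree: "F m s = F n s" if "m \<le> n" "Re s > - real m" for m n s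
  proof (rule analytic_continuation_open[where s = "{s. Re s > 1}" and s' = "{s. Re s > - real m}"
           and f = "F m" and g = "F n"])
    have "2 \<in> {s. Re s > 1}" by simp
    thus "{s. Re s > 1} \<noteq> {}" by blast
    show "connected {s. Re s > - real m}"
      by (intro convex_connected convex_halfspace_Re_gt)
    show "F n holomorphic_on {s. Re s > - real m}"
      by (rule holomorphic_on_subset[OF F(1)]) (use that in auto)
  qed (use F that in \<open>auto simp: open_halfspace_Re_gt\<close>)
  define \<mu> where "\<mu> = (\<lambda>s. nat \<lceil>1 - Re s\<rceil>)"
  have \<mu>: "Re s > - real (\<mu> s)" for s unfolding \<mu>_def by linarith
  define G where "G = (\<lambda>s. F (\<mu> s) s)"
  have G: "G s = F m s" if "Re s > - real m" for m s
  proof (cases "m \<le> \<mu> s")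
    case True
    show ?thesis unfolding G_def by (rule agree[OF True that, symmetric])
  next
    case False
    hence "\<mu> s \<le> m" by simp
    show ?thesis unfolding G_def by (rule agree[OF \<open>\<mu> s \<le> m\<close> \<mu>])
  qed
  have "G holomorphic_on (\<Union>m. {s. Re s > - real m})"
  proof (rule holomorphic_on_UN_open)
    fix m
    show "G holomorphic_on {s. Re s > - real m}"
      by (rule holomorphic_transform[OF F(1)]) (simp add: G)
  qed (auto simp: open_halfspace_Re_gt)
  also have "(\<Union>m. {s. Re s > - real m}) = UNIV" using \<mu> by auto
  finally show ?thesis using F(2) unfolding G_def by blast
qed

theorem is_zeta_ex1: "\<exists>!f. is_zeta f"
proof (rule ex_ex1I)
  obtain F where F: "F holomorphic_on UNIV" "\<And>s. Re s > 1 \<Longrightarrow> F s = (s - 1) * zeta_series s"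
    using zeta_continuation_entire by blast
  have "(\<lambda>s. F s / (s - 1)) holomorphic_on - {1}"
    using F(1) by (intro holomorphic_intros) (auto intro: holomorphic_on_subset)
  moreover have "F s / (s - 1) = zeta_series s" if "Re s > 1" for s
    using F(2)[OF that] that by auto
  ultimately have "is_zeta (\<lambda>s. F s / (s - 1))" by (simp add: is_zeta_def)
  thus "\<exists>f. is_zeta f" by blast
next
  fix f g assume f: "is_zeta f" and g: "is_zeta g"
  show "f = g"
  proof
    fix z show "f z = g z"
    proof (cases "z = 1")
      case False
      show ?thesis
      proof (rule analytic_continuation_open[where s = "{s. Re s > 1}" and s' = "- {1}" and f = f and g = g])
        have "2 \<in> {s. Re s > 1}" by simp
        thus "{s. Re s > 1} \<noteq> {}" by blast
        show "connected (- {1 :: complex})"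
          by (rule connected_punctured_universe) simp
      qed (use f g False in \<open>auto simp: is_zeta_def open_halfspace_Re_gt\<close>)
    qed (use f g in \<open>auto simp: is_zeta_def\<close>)
  qed
qed

corollary is_zeta_zeta: "is_zeta zeta"
  unfolding zeta_def by (rule theI'[OF is_zeta_ex1])

end

theory Submission
  imports Defs
begin

text \<open>
  Let \<open>\<ell> = - \<chi>'/\<chi>\<close>, where \<open>\<zeta>(s) = \<chi>(s) \<zeta>(1 - s)\<close>; at height \<open>t\<close> and in a bounded strip,
  \<open>\<ell> = log t + O(1)\<close>. The function \<open>N = \<zeta>'/\<zeta> + \<ell>/2\<close> is odd under \<open>s \<mapsto> 1 - s\<close>, so its real part
  vanishes on the critical line. The Riemann hypothesis makes \<open>Re N\<close> bounded below to the right of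
  that line (\<open>Re_odd_logderiv_lower_bound\<close>). The nonreal zeros of \<open>\<zeta>'\<close> with \<open>\<zeta> \<noteq> 0\<close> are the
  solutions of \<open>N = \<ell>/2\<close>.

  Suppose that the second lower limit is positive. Then there is \<open>c > 0\<close> such that, from some height
  on, every zero of \<open>\<zeta>'\<close> has an ordinate at distance at least \<open>c / log t\<close> from all ordinates of zeros
  of \<open>\<zeta>\<close>. Take a zero \<open>\<rho>' = 1/2 + \<sigma> + it\<close> of \<open>\<zeta>'\<close> with \<open>\<sigma> log t \<le> \<epsilon>\<close>, put \<open>L = log t\<close>, and let \<open>\<gamma>\<close> be
  the ordinate nearest to \<open>t\<close>, at distance \<open>d\<close>.

  \<^item> \<open>N\<close> is holomorphic in the disc of radius \<open>d\<close> around \<open>1/2 + it\<close>, imaginary on the vertical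
    diameter, essentially positive to the right of it, and of size \<open>L/2\<close> already at the tiny distance
    \<open>\<sigma>\<close> from the centre. Such a function grows at least linearly up to the scale \<open>d\<close>
    (\<open>odd_sign_growth\<close>), so \<open>Re N\<close> is at least a constant times \<open>d L / \<sigma>\<close> at distance \<open>d/2\<close>.

  \<^item> By Harnack's inequality \<open>Re N\<close> is then at least a constant times \<open>c L / \<epsilon>\<close> at distance of order
    \<open>c / L\<close> to the right of \<open>1/2 + i\<gamma>\<close> (\<open>N_harnack_chain\<close>).

  \<^item> The quotient \<open>B = (N - \<ell>/2) / (N + \<ell>/2)\<close> has modulus \<open>1\<close> on the critical line and at most about
    \<open>1\<close> to the right of it. At the zero \<open>1/2 + i\<gamma>\<close> of \<open>\<zeta>\<close>, which must be simple, \<open>B = 1\<close> and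
    \<open>B' = - \<ell>\<close>. There is no zero of \<open>\<zeta>'\<close> within \<open>c / (2 L)\<close> of this point, so \<open>- log B\<close> exists in that
    disc, and \<open>odd_sign_growth\<close> bounds its real part from below by a constant times \<open>c\<close> half way to the
    boundary. But \<open>N\<close> is so large there that \<open>B\<close> is within \<open>O(\<epsilon> / c)\<close> of \<open>1\<close>
    (\<open>N_bounded_above_simple_zero\<close>). For \<open>\<epsilon>\<close> small compared with \<open>c\<^sup>2\<close> this is a contradiction.

  The facts about \<open>\<zeta>\<close> used here are developed from its definition: the functional equation by a Mellin
  transform of \<open>1 / (e\<^sup>x - 1)\<close>, and the lower bound on \<open>Re N\<close> by a Phragmen-Lindelof argument for the
  quotients \<open>\<zeta>(s - h) / \<zeta>(s + h)\<close> as \<open>h \<rightarrow> 0\<close>.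
\<close>

section \<open>Mellin integrals\<close>

lemma nn_integral_powr_exp:
  fixes a u :: real
  assumes "a < 1" "u > 0"
  shows "(\<integral>\<^sup>+x\<in>{0<..}. ennreal (x powr (-a) * exp (-(u * x))) \<partial>lborel) = ennreal (Gamma (1-a) * u powr (a-1))"
proof -
  have "(\<integral>\<^sup>+x\<in>{0<..}. ennreal (x powr (-a) * exp (-(u * x))) \<partial>lborel)
      = (\<integral>\<^sup>+x. ennreal (x powr (-a) * exp (-(u * x)) * indicator {0<..} x) \<partial>lborel)"
    by (intro nn_integral_cong) (auto simp: indicator_def)
  also have "\<dots> = ennreal \<bar>1/u\<bar> * (\<integral>\<^sup>+x. ennreal ((0 + 1/u*x) powr (-a) * exp (-(u*(0 + 1/u*x))) * indicator {0<..} (0 + 1/u*x)) \<partial>lborel)"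
    by (rule nn_integral_real_affine) (use assms in auto)
  also have "\<dots> = ennreal \<bar>1/u\<bar> * (\<integral>\<^sup>+x. ennreal (u powr a) * ennreal (indicator {0..} x * x powr ((1-a)-1) / exp x) \<partial>lborel)"
  proof (intro arg_cong2[where f="(*)"] refl nn_integral_cong)
    fix x :: real
    show "ennreal ((0 + 1/u*x) powr (-a) * exp (-(u*(0 + 1/u*x))) * indicator {0<..} (0 + 1/u*x)) =
       ennreal (u powr a) * ennreal (indicator {0..} x * x powr ((1-a)-1) / exp x)"
    proof (cases "x > 0")
      case True
      then show ?thesis using assms
        by (simp add: powr_divide exp_minus powr_minus field_simps flip: ennreal_mult)
    next
      case False
      then show ?thesis using assms by (cases "x = 0") (auto simp: indicator_def zero_less_mult_iff zero_less_divide_iff)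
    qed
  qed
  also have "\<dots> = ennreal \<bar>1/u\<bar> * (ennreal (u powr a) * ennreal (Gamma (1-a)))"
    using assms by (subst nn_integral_cmult) (auto simp: Gamma_conv_nn_integral_real)
  also have "\<dots> = ennreal (Gamma (1-a) * u powr (a-1))"
    using assms by (simp add: powr_diff field_simps Gamma_real_nonneg flip: ennreal_mult)
  finally show ?thesis .
qed

lemma nn_integral_swap_Icc:
  fixes k :: "real \<Rightarrow> real \<Rightarrow> real"
  assumes [measurable]: "(\<lambda>(x,v). k x v) \<in> borel_measurable (borel \<Otimes>\<^sub>M borel)"
  shows "(\<integral>\<^sup>+x\<in>{0<..}. (\<integral>\<^sup>+v\<in>{0..u}. ennreal (k x v) \<partial>lborel) \<partial>lborel)
       = (\<integral>\<^sup>+v\<in>{0..u}. (\<integral>\<^sup>+x\<in>{0<..}. ennreal (k x v) \<partial>lborel) \<partial>lborel)"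
proof -
  have "(\<integral>\<^sup>+x\<in>{0<..}. (\<integral>\<^sup>+v\<in>{0..u}. ennreal (k x v) \<partial>lborel) \<partial>lborel)
     = (\<integral>\<^sup>+x. (\<integral>\<^sup>+v. ennreal (k x v) * indicator {0..u} v * indicator {0<..} x \<partial>lborel) \<partial>lborel)"
    by (subst nn_integral_multc) auto
  also have "\<dots> = (\<integral>\<^sup>+v. (\<integral>\<^sup>+x. ennreal (k x v) * indicator {0..u} v * indicator {0<..} x \<partial>lborel) \<partial>lborel)"
    by (rule lborel_pair.Fubini'[symmetric]) simp
  also have "\<dots> = (\<integral>\<^sup>+v. (\<integral>\<^sup>+x. ennreal (k x v) * indicator {0<..} x * indicator {0..u} v \<partial>lborel) \<partial>lborel)"
    by (intro nn_integral_cong) (simp add: mult_ac)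
  also have "\<dots> = (\<integral>\<^sup>+v\<in>{0..u}. (\<integral>\<^sup>+x\<in>{0<..}. ennreal (k x v) \<partial>lborel) \<partial>lborel)"
    by (subst nn_integral_multc) auto
  finally show ?thesis .
qed

text \<open>
  The Gamma integral at the exponent \<open>- a\<close>, which lies outside its half plane of convergence; the
  constant term of the exponential is subtracted to restore convergence at \<open>0\<close>. Integrating
  \<open>x powr (-a) * exp (- v x)\<close> over \<open>v\<close> reduces it to the convergent case.
\<close>
lemma nn_integral_powr_one_minus_exp:
  fixes a u :: real
  assumes a: "0 < a" "a < 1" and u: "u \<ge> 0"
  shows "(\<integral>\<^sup>+x\<in>{0<..}. ennreal (x powr (-a-1) * (1 - exp (-(u * x)))) \<partial>lborel) = ennreal (Gamma (1-a) / a * u powr a)"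
proof -
  have "(\<integral>\<^sup>+x\<in>{0<..}. ennreal (x powr (-a-1) * (1 - exp (-(u * x)))) \<partial>lborel)
     = (\<integral>\<^sup>+x\<in>{0<..}. (\<integral>\<^sup>+v\<in>{0..u}. ennreal (x powr (-a) * exp (-(v * x))) \<partial>lborel) \<partial>lborel)"
  proof (intro nn_integral_cong)
    fix x :: real
    have "(\<integral>\<^sup>+v. ennreal (x powr (-a) * exp (-(v * x))) * indicator {0..u} v \<partial>lborel)
        = ennreal (- (x powr (-a-1)) * exp (-(u * x)) - (- (x powr (-a-1)) * exp (-(0*x))))" if x: "x > 0"
    proof (rule nn_integral_FTC_Icc[where F = "\<lambda>v. - (x powr (-a-1)) * exp (-(v * x))"])
      fix v show "((\<lambda>v. - (x powr (-a-1)) * exp (-(v * x))) has_real_derivative x powr (-a) * exp (-(v * x))) (at v)"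
        using x by (auto intro!: derivative_eq_intros simp: powr_diff)
    qed (use u in auto)
    thus "ennreal (x powr (-a-1) * (1 - exp (-(u * x)))) * indicator {0<..} x =
       (\<integral>\<^sup>+v\<in>{0..u}. ennreal (x powr (-a) * exp (-(v * x))) \<partial>lborel) * indicator {0<..} x"
      by (cases "x > 0") (auto simp: algebra_simps)
  qed
  also have "\<dots> = (\<integral>\<^sup>+v\<in>{0..u}. (\<integral>\<^sup>+x\<in>{0<..}. ennreal (x powr (-a) * exp (-(v * x))) \<partial>lborel) \<partial>lborel)"
    by (rule nn_integral_swap_Icc) simp
  also have "\<dots> = (\<integral>\<^sup>+v\<in>{0..u}. ennreal (Gamma (1-a) * v powr (a-1)) \<partial>lborel)"
  proof (rule nn_integral_cong_AE, rule eventually_mono[OF AE_lborel_singleton[of 0]])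
    fix v :: real assume "v \<noteq> 0"
    thus "(\<integral>\<^sup>+x\<in>{0<..}. ennreal (x powr (-a) * exp (-(v * x))) \<partial>lborel) * indicator {0..u} v =
       ennreal (Gamma (1-a) * v powr (a-1)) * indicator {0..u} v"
      using nn_integral_powr_exp[of a v] a by (cases "v > 0") (auto simp: indicator_def)
  qed
  also have "\<dots> = ennreal (Gamma (1-a) * (u powr (a - 1 + 1) / (a - 1 + 1)))"
  proof (rule nn_integral_has_integral_lebesgue')
    show "((\<lambda>v. Gamma (1-a) * v powr (a-1)) has_integral Gamma (1-a) * (u powr (a - 1 + 1) / (a - 1 + 1))) {0..u}"
      by (intro has_integral_mult_right has_integral_powr_from_0) (use a u in auto)
  qed (use a in \<open>auto simp: Gamma_real_nonneg\<close>)
  finally show ?thesis by simp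
qed

text \<open>
  The same regularisation one step further, at the exponent \<open>- a - 1\<close>, where two terms of the
  exponential have to be subtracted.
\<close>
lemma nn_integral_powr_exp_remainder:
  fixes a u :: real
  assumes a: "0 < a" "a < 1" and u: "u \<ge> 0"
  shows "(\<integral>\<^sup>+x\<in>{0<..}. ennreal (x powr (-a-1) * ((exp (-(u * x)) - 1 + u*x) / x)) \<partial>lborel)
    = ennreal (Gamma (1-a) / a * (u powr (1+a) / (1+a)))"
proof -
  have "(\<integral>\<^sup>+x\<in>{0<..}. ennreal (x powr (-a-1) * ((exp (-(u * x)) - 1 + u*x) / x)) \<partial>lborel)
     = (\<integral>\<^sup>+x\<in>{0<..}. (\<integral>\<^sup>+v\<in>{0..u}. ennreal (x powr (-a-1) * (1 - exp (-(v * x)))) \<partial>lborel) \<partial>lborel)"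
  proof (intro nn_integral_cong)
    fix x :: real
    have A: "(\<integral>\<^sup>+v. ennreal (x powr (-a-1) * (1 - exp (-(v * x)))) * indicator {0..u} v \<partial>lborel)
        = ennreal (x powr (-a-1) * (u + exp (-(u * x)) / x) - x powr (-a-1) * (0 + exp (-(0*x)) / x))" if x: "x > 0"
    proof (rule nn_integral_FTC_Icc[where F = "\<lambda>v. x powr (-a-1) * (v + exp (-(v * x)) / x)"])
      fix v show "((\<lambda>v. x powr (-a-1) * (v + exp (-(v * x)) / x)) has_real_derivative x powr (-a-1) * (1 - exp (-(v * x)))) (at v)"
        using x by (auto intro!: derivative_eq_intros)
    qed (use u x in auto)
    have B: "x powr (-a-1) * (u + exp (-(u * x)) / x) - x powr (-a-1) * (0 + exp (-(0*x)) / x)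
        = x powr (-a-1) * ((exp (-(u * x)) - 1 + u * x) / x)" if x: "x > 0"
    proof -
      have "u + exp (-(u * x)) / x - (0 + exp (-(0*x)) / x) = (exp (-(u * x)) - 1 + u * x) / x"
        using x by (simp add: diff_divide_distrib add_divide_distrib)
      thus ?thesis by (simp only: right_diff_distrib[symmetric])
    qed
    show "ennreal (x powr (-a-1) * ((exp (-(u * x)) - 1 + u*x) / x)) * indicator {0<..} x =
       (\<integral>\<^sup>+v\<in>{0..u}. ennreal (x powr (-a-1) * (1 - exp (-(v * x)))) \<partial>lborel) * indicator {0<..} x"
    proof (cases "x > 0")
      case True
      show ?thesis unfolding A[OF True] B[OF True] ..
    qed auto
  qed
  also have "\<dots> = (\<integral>\<^sup>+v\<in>{0..u}. (\<integral>\<^sup>+x\<in>{0<..}. ennreal (x powr (-a-1) * (1 - exp (-(v * x)))) \<partial>lborel) \<partial>lborel)"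
    by (rule nn_integral_swap_Icc) simp
  also have "\<dots> = (\<integral>\<^sup>+v\<in>{0..u}. ennreal (Gamma (1-a) / a * v powr a) \<partial>lborel)"
    using nn_integral_powr_one_minus_exp[OF a] by (intro nn_integral_cong) (auto simp: indicator_def)
  also have "\<dots> = ennreal (Gamma (1-a) / a * (u powr (a + 1) / (a + 1)))"
  proof (rule nn_integral_has_integral_lebesgue')
    show "((\<lambda>v. Gamma (1-a) / a * v powr a) has_integral Gamma (1-a) / a * (u powr (a + 1) / (a + 1))) {0..u}"
      by (intro has_integral_mult_right has_integral_powr_from_0) (use a u in auto)
  qed (use a in \<open>auto simp: Gamma_real_nonneg\<close>)
  finally show ?thesis by (simp add: add.commute)
qed

text \<open>
  A Beta integral after the substitution \<open>t = 1 / (1 + x\<^sup>2)\<close>.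
\<close>
lemma nn_integral_powr_div_one_plus_square:
  fixes a :: real
  assumes a: "0 < a" "a < 1"
  shows "(\<integral>\<^sup>+x\<in>{0<..}. ennreal (2 * x powr (-a) / (1 + x\<^sup>2)) \<partial>lborel) = ennreal (Gamma ((1+a)/2) * Gamma ((1-a)/2))"
proof -
  define p q where "p = (1+a)/2" and "q = (1-a)/2"
  have pq: "p > 0" "q > 0" "p + q = 1" using a by (auto simp: p_def q_def field_simps)
  define f where "f = (\<lambda>t::real. t powr (p-1) * (1-t) powr (q-1))"
  define g where "g = (\<lambda>x::real. 1 / (1 + x\<^sup>2))"
  define g' where "g' = (\<lambda>x::real. - 2 * x / (1 + x\<^sup>2)\<^sup>2)"
  have pos: "1 + x\<^sup>2 > 0" for x :: real by (simp add: add_pos_nonneg)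
  have img: "g ` {0<..} = {0<..<1}"
  proof (intro equalityI subsetI)
    fix y assume "y \<in> {0<..<(1::real)}"
    hence "y = g (sqrt (1/y - 1))" "sqrt (1/y - 1) > 0" by (auto simp: g_def field_simps)
    thus "y \<in> g ` {0<..}" by blast
  qed (auto simp: g_def pos)
  have "(f has_integral Beta p q) {0<..<1}"
    using has_integral_Beta_real[OF pq(1,2)] unfolding f_def by (simp add: has_integral_Icc_iff_Ioo)
  hence "f absolutely_integrable_on {0<..<1} \<and> integral {0<..<1} f = Beta p q"
    by (auto intro!: nonnegative_absolutely_integrable_1 simp: f_def has_integral_iff)
  hence "(\<lambda>x. \<bar>g' x\<bar> * f (g x)) absolutely_integrable_on {0<..} \<and> integral {0<..} (\<lambda>x. \<bar>g' x\<bar> * f (g x)) = Beta p q"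
    unfolding img[symmetric]
  proof (rule has_absolute_integral_change_of_variables_1'[THEN iffD2, rotated 3])
    show "(g has_real_derivative g' x) (at x within {0<..})" if "x \<in> {0<..}" for x
      unfolding g_def g'_def using pos[of x] by (auto intro!: derivative_eq_intros simp: power2_eq_square)
    show "inj_on g {0<..}"
      by (auto simp: inj_on_def g_def dest!: power2_eq_imp_eq)
  qed auto
  hence I: "((\<lambda>x. \<bar>g' x\<bar> * f (g x)) has_integral Beta p q) {0<..}"
    by (auto simp: has_integral_iff set_lebesgue_integral_eq_integral(1))
  have eq: "\<bar>g' x\<bar> * f (g x) = 2 * x powr (-a) / (1 + x\<^sup>2)" if x: "x > 0" for x
  proof -
    define w where "w = 1 + x\<^sup>2"
    have w: "w > 0" "x\<^sup>2 > 0" using pos[of x] x by (auto simp: w_def)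
    have "1 - g x = x\<^sup>2 / w" using w pos[of x] by (simp add: g_def w_def field_simps add_divide_distrib[symmetric])
    moreover have "(1 / w) powr (p-1) = w powr (-(p-1))"
      unfolding powr_minus_divide using w by (simp add: powr_divide)
    moreover have "(x\<^sup>2 / w) powr (q-1) = (x\<^sup>2) powr (q-1) * w powr (-(q-1))"
      unfolding powr_minus_divide using w by (simp add: powr_divide)
    ultimately have "f (g x) = w powr (1-p) * ((x\<^sup>2) powr (q-1) * w powr (1 - q))"
      unfolding f_def by (simp add: g_def w_def[symmetric])
    also have "(x\<^sup>2) powr (q-1) = x powr (2*(q-1))"
      using x powr_powr[of x 2 "q-1"] by simp
    also have "2*(q-1) = -a-1" by (simp add: q_def field_simps)
    also have "w powr (1-p) * (x powr (-a-1) * w powr (1 - q)) = w powr ((1-p)+(1-q)) * x powr (-a-1)"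
      unfolding powr_add by (simp only: mult_ac)
    also have "(1-p)+(1-q) = 1" using pq by simp
    finally have 1: "f (g x) = w * x powr (-a-1)" using w by simp
    have 2: "\<bar>g' x\<bar> = 2 * x / (w * w)" using x pos[of x] by (simp add: g'_def w_def power2_eq_square)
    have 3: "x powr (-a) = x powr (-a-1) * x" using x by (simp add: powr_diff)
    show ?thesis unfolding 1 2 3 w_def[symmetric] using w by simp
  qed
  have "((\<lambda>x. 2 * x powr (-a) / (1 + x\<^sup>2)) has_integral Beta p q) {0<..}"
    by (rule has_integral_eq[OF _ I]) (use eq in auto)
  hence "(\<integral>\<^sup>+x\<in>{0<..}. ennreal (2 * x powr (-a) / (1 + x\<^sup>2)) \<partial>lborel) = ennreal (Beta p q)"
    by (intro nn_integral_has_integral_lebesgue') (use pos in \<open>auto intro!: divide_nonneg_pos\<close>)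
  thus ?thesis using pq by (simp add: Beta_def p_def q_def)
qed

lemma nn_integral_powr_div_square_plus:
  fixes a b :: real
  assumes a: "0 < a" "a < 1" and b: "b > 0"
  shows "(\<integral>\<^sup>+x\<in>{0<..}. ennreal (x powr (-a-1) * (2 * x / (x\<^sup>2 + b\<^sup>2))) \<partial>lborel)
     = ennreal (Gamma ((1+a)/2) * Gamma ((1-a)/2) * b powr (-a-1))"
proof -
  have "(\<integral>\<^sup>+x\<in>{0<..}. ennreal (x powr (-a-1) * (2 * x / (x\<^sup>2 + b\<^sup>2))) \<partial>lborel)
      = (\<integral>\<^sup>+x. ennreal (x powr (-a-1) * (2 * x / (x\<^sup>2 + b\<^sup>2)) * indicator {0<..} x) \<partial>lborel)"
    by (intro nn_integral_cong) (auto simp: indicator_def)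
  also have "\<dots> = ennreal \<bar>b\<bar> * (\<integral>\<^sup>+x. ennreal ((0+b*x) powr (-a-1) * (2 * (0+b*x) / ((0+b*x)\<^sup>2 + b\<^sup>2)) * indicator {0<..} (0+b*x)) \<partial>lborel)"
    by (rule nn_integral_real_affine) (use b in auto)
  also have "\<dots> = ennreal \<bar>b\<bar> * (\<integral>\<^sup>+x. ennreal (b powr (-a-2)) * (ennreal (2 * x powr (-a) / (1 + x\<^sup>2)) * indicator {0<..} x) \<partial>lborel)"
  proof (intro arg_cong2[where f="(*)"] refl nn_integral_cong)
    fix x :: real
    have "(0+b*x) powr (-a-1) * (2 * (0+b*x) / ((0+b*x)\<^sup>2 + b\<^sup>2)) = b powr (-a-2) * (2 * x powr (-a) / (1 + x\<^sup>2))" if "x > 0"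
    proof -
      have "1 + x\<^sup>2 > 0" by (simp add: add_pos_nonneg)
      moreover have "(0+b*x)\<^sup>2 + b\<^sup>2 = b^2 * (1+x^2)" by (simp add: power2_eq_square algebra_simps)
      moreover have "b powr (-a-1) = b powr (-a-2) * b" using b by (simp add: powr_diff power2_eq_square)
      moreover have "x powr (-a) = x powr (-a-1) * x" using that by (simp add: powr_diff)
      ultimately show ?thesis using b that by (simp add: powr_mult power2_eq_square)
    qed
    thus "ennreal ((0+b*x) powr (-a-1) * (2 * (0+b*x) / ((0+b*x)\<^sup>2 + b\<^sup>2)) * indicator {0<..} (0+b*x)) =
       ennreal (b powr (-a-2)) * (ennreal (2 * x powr (-a) / (1 + x\<^sup>2)) * indicator {0<..} x)"
      using b by (cases "x > 0") (auto simp: indicator_def zero_less_mult_iff simp flip: ennreal_mult')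
  qed
  also have "\<dots> = ennreal \<bar>b\<bar> * (ennreal (b powr (-a-2)) * ennreal (Gamma ((1+a)/2) * Gamma ((1-a)/2)))"
    using nn_integral_powr_div_one_plus_square[OF a] by (subst nn_integral_cmult) auto
  also have "\<dots> = ennreal (Gamma ((1+a)/2) * Gamma ((1-a)/2) * b powr (-a-1))"
    using b a by (simp add: powr_diff power2_eq_square Gamma_real_nonneg flip: ennreal_mult)
  finally show ?thesis .
qed

section \<open>The partial fractions of the cotangent\<close>

text \<open>
  Both sides are \<open>Digamma (1 + z) - Digamma (1 - z)\<close>: the left one by the series of the digamma
  function, the right one by logarithmic differentiation of the reflection formula.
\<close>
lemma sums_Digamma_diff:
  fixes z :: complex
  assumes "z \<notin> \<int>"
  shows "(\<lambda>k. 1 / (of_nat (Suc k) - z) - 1 / (of_nat (Suc k) + z)) sums (1 / z - of_real pi * cot (of_real pi * z))"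
proof -
  have nz: "1 + z \<noteq> 0" "1 - z \<noteq> 0" "z \<noteq> 0"
    using assms by (metis Ints_0 Ints_1 Ints_minus add.inverse_inverse add_eq_0_iff, metis Ints_1 eq_iff_diff_eq_0, metis Ints_0)
  have "(\<lambda>k. (inverse (of_nat (Suc k)) - inverse (1 + z + of_nat k)) - (inverse (of_nat (Suc k)) - inverse (1 - z + of_nat k)))
     sums ((Digamma (1 + z) + euler_mascheroni) - (Digamma (1 - z) + euler_mascheroni))"
    using summable_sums[OF summable_Digamma[OF nz(1)]] summable_sums[OF summable_Digamma[OF nz(2)]]
    by (intro sums_diff) (simp_all add: Digamma_def)
  hence "(\<lambda>k. 1 / (of_nat (Suc k) - z) - 1 / (of_nat (Suc k) + z)) sums (Digamma (1 + z) - Digamma (1 - z))"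
    by (simp add: field_simps)
  moreover have "Digamma (1 + z) - Digamma (1 - z) = 1 / z - of_real pi * cot (of_real pi * z)"
  proof -
    define f where "f = (\<lambda>w::complex. Gamma (1 + w) * Gamma (1 - w))"
    have int: "1 + w \<notin> \<int>\<^sub>\<le>\<^sub>0 \<and> 1 - w \<notin> \<int>\<^sub>\<le>\<^sub>0" if "w \<notin> \<int>" for w :: complex
      using that by (metis Ints_1 Ints_diff Ints_minus add_diff_cancel_left' diff_diff_eq2 diff_add_cancel nonpos_Ints_Int minus_diff_eq)
    have f: "f w = w * (of_real pi / sin (of_real pi * w))" if "w \<notin> \<int>" for w
    proof -
      have "w \<noteq> 0" "w \<notin> \<int>\<^sub>\<le>\<^sub>0" using that by (auto dest: nonpos_Ints_Int)
      thus ?thesis using Gamma_plus1[of w] Gamma_reflection_complex[of w]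
        by (simp add: f_def add.commute mult.assoc)
    qed
    have d1: "(f has_field_derivative f z * (Digamma (1 + z) - Digamma (1 - z))) (at z)"
      unfolding f_def using int[OF assms] by (auto intro!: derivative_eq_intros simp: algebra_simps)
    have s: "sin (of_real pi * z) \<noteq> 0"
    proof
      assume "sin (of_real pi * z) = 0"
      then obtain n where "of_real pi * z = of_real (of_int n * pi)"
        by (auto simp: sin_eq_0)
      hence "z = of_int n" by simp
      thus False using assms by simp
    qed
    have "((\<lambda>w. w * (of_real pi / sin (of_real pi * w))) has_field_derivative
        f z * (1 / z - of_real pi * cot (of_real pi * z))) (at z)"
      unfolding f[OF assms] using s nz by (auto intro!: derivative_eq_intros simp: cot_def field_simps power2_eq_square)
    moreover have "\<forall>\<^sub>F w in nhds z. w \<in> - \<int>"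
      using assms by (intro eventually_nhds_in_open) (auto simp: closed_Ints)
    ultimately have d2: "(f has_field_derivative f z * (1 / z - of_real pi * cot (of_real pi * z))) (at z)"
      using f by (subst DERIV_cong_ev[OF refl _ refl]) (auto elim!: eventually_mono)
    have "f z \<noteq> 0" using f[OF assms] s nz by simp
    thus ?thesis using DERIV_unique[OF d1 d2] by simp
  qed
  ultimately show ?thesis by simp
qed

lemma cot_conv_exp:
  "cot w = \<i> * ((exp (\<i> * w) + exp (- (\<i> * w))) / (exp (\<i> * w) - exp (- (\<i> * w))))"
proof -
  have "((A + B) / 2) / ((A - B) / (2 * \<i>)) = \<i> * ((A + B) / (A - B))" for A B :: complex
    by (cases "A = B") (simp_all add: divide_simps)
  thus ?thesis unfolding cot_def sin_exp_eq cos_exp_eq .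
qed

text \<open>
  The expansion of the cotangent at the purely imaginary point \<open>i x / (2 \<pi>)\<close>. All terms are
  positive, so Tonelli's theorem will apply without further estimates.
\<close>
lemma planck_partial_fractions:
  fixes x :: real
  assumes x: "x > 0"
  shows "(\<lambda>k. 2 * x / (x\<^sup>2 + (2 * pi * real (Suc k))\<^sup>2)) sums (1 / (exp x - 1) - 1 / x + 1 / 2)"
proof -
  define y where "y = x / (2 * pi)"
  define z where "z = \<i> * of_real y"
  have y: "y > 0" using x by (simp add: y_def)
  have "z \<notin> \<int>" using y by (auto simp: z_def Ints_def complex_eq_iff)
  note s = sums_Digamma_diff[OF this]
  have eq1: "(1 / (of_nat (Suc k) - z) - 1 / (of_nat (Suc k) + z)) / (2 * pi * \<i>)
     = of_real (2 * x / (x\<^sup>2 + (2 * pi * real (Suc k))\<^sup>2))" for k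
  proof -
    define n where "n = real (Suc k)"
    have n: "n > 0" "n^2 + y^2 > 0" using y by (auto simp: n_def add_pos_pos)
    have nz: "of_real n - z \<noteq> 0" "of_real n + z \<noteq> 0" using n by (auto simp: z_def complex_eq_iff)
    have "(of_real n - z) * (of_real n + z) = of_real (n^2 + y^2)"
      by (simp add: z_def algebra_simps power2_eq_square)
    hence "1 / (of_real n - z) - 1 / (of_real n + z) = 2 * z / of_real (n^2 + y^2)"
      using nz by (simp add: divide_simps) 
    also have "2 * z / of_real Q / (2 * pi * \<i>) = of_real (y / pi / Q)" for Q
      by (cases "Q = 0") (simp_all add: z_def field_simps)
    also have "y / pi / (n^2 + y^2) = 2 * x / (x\<^sup>2 + (2 * pi * n)\<^sup>2)"
    proof -
      have "x\<^sup>2 + (2 * pi * n)\<^sup>2 = (2*pi)^2 * (n^2+y^2)"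
        by (simp add: y_def power_mult_distrib power_divide field_simps)
      thus ?thesis using n by (simp add: y_def power2_eq_square)
    qed
    finally show ?thesis by (simp add: n_def)
  qed
  have eq2: "(1 / z - of_real pi * cot (of_real pi * z)) / (2 * pi * \<i>) = of_real (1 / (exp x - 1) - 1 / x + 1 / 2)"
  proof -
    have e: "exp (\<i> * (of_real pi * z)) = of_real (exp (-(x/2)))" "exp (- (\<i> * (of_real pi * z))) = of_real (exp (x/2))"
      by (simp_all add: z_def y_def exp_of_real[symmetric] flip: mult.assoc)
    define E where "E = exp (x/2)"
    have E: "E > 1" using x by (simp add: E_def)
    have E2: "exp x = E * E" by (simp add: E_def exp_add[symmetric])
    have E': "exp (-(x/2)) = 1 / E" by (simp add: E_def exp_minus inverse_eq_divide)
    have "cot (of_real pi * z) = \<i> * ((of_real (1/E) + of_real E) / (of_real (1/E) - of_real E))"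
      unfolding cot_conv_exp e E_def[symmetric] E' ..
    also have "(of_real (1/E) + of_real E) / (of_real (1/E) - of_real E) = complex_of_real ((1/E + E) / (1/E - E))"
      by simp
    also have "(1/E + E) / (1/E - E) = - (1 + 2 / (exp x - 1))"
    proof -
      have "E * E > 1" using E by (simp add: less_1_mult)
      thus ?thesis using E unfolding E2 by (simp add: divide_simps)  (simp add: algebra_simps)
    qed
    finally have "cot (of_real pi * z) = - \<i> * of_real (1 + 2 / (exp x - 1))" by (simp add: algebra_simps)
    moreover have "1 / z / (2 * pi * \<i>) = of_real (- 1 / x)"
    proof -
      have "\<i> * (w * \<i>) = - w" for w by (simp add: mult.commute[of w] flip: mult.assoc)
      thus ?thesis using x by (simp add: z_def y_def)
    qed
    moreover have "of_real pi * (- \<i> * W) / (2 * pi * \<i>) = - (W / 2)" for W :: complex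
      by simp
    moreover have "2 / (E * 2 - 2) = 1 / (E - 1)" for E :: complex
      by (cases "E = 1") (simp_all add: divide_simps)
    ultimately show ?thesis by (simp add: diff_divide_distrib add_divide_distrib)
  qed
  have "(\<lambda>k. complex_of_real (2 * x / (x\<^sup>2 + (2 * pi * real (Suc k))\<^sup>2))) sums
    complex_of_real (1 / (exp x - 1) - 1 / x + 1 / 2)"
    using sums_divide[OF s, of "2 * pi * \<i>"] unfolding eq1 eq2 .
  thus ?thesis by (simp only: sums_of_real_iff)
qed


section \<open>Values of zeta to the left of the imaginary axis\<close>

lemma zeta_holomorphic: "zeta holomorphic_on - {1}"
  and zeta_eq_series: "Re s > 1 \<Longrightarrow> zeta s = zeta_series s"
  using is_zeta_zeta by (auto simp: is_zeta_def)

lemma zeta_holomorphic_on [holomorphic_intros]: "1 \<notin> A \<Longrightarrow> zeta holomorphic_on A"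
  by (rule holomorphic_on_subset[OF zeta_holomorphic]) auto

lemma zeta_eq_remainder_sum_1:
  assumes "Re s > 0" "s \<noteq> 1"
  shows "(s - 1) * zeta s = 1 + remainder_sum 1 s"
proof (rule analytic_continuation_open[where s = "{s. Re s > 1}" and s' = "{s. Re s > 0} - {1}"
     and f = "\<lambda>s. (s - 1) * zeta s" and g = "\<lambda>s. 1 + remainder_sum 1 s"])
  have "2 \<in> {s. Re s > 1}" by simp
  thus "{s. Re s > 1} \<noteq> {}" by blast
  show "connected ({s. Re s > 0} - {1})"
    by (intro connected_open_delete convex_connected convex_halfspace_Re_gt open_halfspace_Re_gt) auto
  show "(\<lambda>s. (s - 1) * zeta s) holomorphic_on {s. Re s > 0} - {1}"
    by (intro holomorphic_intros) auto
  show "(\<lambda>s. 1 + remainder_sum 1 s) holomorphic_on {s. Re s > 0} - {1}"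
    using holomorphic_remainder_sum[of 1] by (intro holomorphic_intros) (auto intro: holomorphic_on_subset)
  show "(s - 1) * zeta s = 1 + remainder_sum 1 s" if "s \<in> {s. Re s > 1}" for s
    using zeta_series_recurrence[of s 1] that by (simp add: zeta_eq_series)
qed (use assms in \<open>auto simp: open_halfspace_Re_gt open_Diff\<close>)

text \<open>
  At \<open>s = - a\<close> the value \<open>zeta (s + 1)\<close> on the right is in turn given by
  \<open>zeta_eq_remainder_sum_1\<close>.
\<close>
lemma zeta_eq_remainder_sum_2:
  assumes "Re s > -1" "s \<noteq> 1" "s \<noteq> 0"
  shows "(s - 1) * zeta s = 1 + (1 - s) * (- s) / 2 * zeta (s + 1) + remainder_sum 2 s"
proof (rule analytic_continuation_open[where s = "{s. Re s > 1}" and s' = "{s. Re s > -1} - {1} - {0}"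
     and f = "\<lambda>s. (s - 1) * zeta s" and g = "\<lambda>s. 1 + (1 - s) * (- s) / 2 * zeta (s + 1) + remainder_sum 2 s"])
  have "2 \<in> {s. Re s > 1}" by simp
  thus "{s. Re s > 1} \<noteq> {}" by blast
  show "connected ({s. Re s > -1} - {1} - {0})"
    by (intro connected_open_delete convex_connected convex_halfspace_Re_gt open_halfspace_Re_gt open_Diff) auto
  show "(\<lambda>s. (s - 1) * zeta s) holomorphic_on {s. Re s > -1} - {1} - {0}"
    by (intro holomorphic_intros) auto
  have "(zeta \<circ> (\<lambda>s. s + 1)) holomorphic_on {s. Re s > -1} - {1} - {0}"
    by (intro holomorphic_on_compose holomorphic_intros) auto
  hence "(\<lambda>s. zeta (s + 1)) holomorphic_on {s. Re s > -1} - {1} - {0}" by (simp add: o_def)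
  moreover have "remainder_sum 2 holomorphic_on {s. Re s > -1} - {1} - {0}"
    by (rule holomorphic_on_subset[OF holomorphic_remainder_sum]) auto
  ultimately show "(\<lambda>s. 1 + (1 - s) * (- s) / 2 * zeta (s + 1) + remainder_sum 2 s) holomorphic_on {s. Re s > -1} - {1} - {0}"
    by (intro holomorphic_intros) auto
  show "(s - 1) * zeta s = 1 + (1 - s) * (- s) / 2 * zeta (s + 1) + remainder_sum 2 s" if "s \<in> {s. Re s > 1}" for s
    using zeta_series_recurrence[of s 2] that
    by (simp add: zeta_eq_series falling_def numeral_2_eq_2 lessThan_Suc add.commute)
qed (use assms in \<open>auto simp: open_halfspace_Re_gt open_Diff\<close>)

lemma remainder_term_of_real:
  fixes b :: real
  shows "remainder_term 1 n (1 - of_real b) =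
      of_real (real (Suc (Suc n)) powr b - real (Suc n) powr b - b * real (Suc n) powr (b - 1))" (is ?A)
    and "remainder_term 2 n (1 - of_real b) =
      of_real (real (Suc (Suc n)) powr b - real (Suc n) powr b - b * real (Suc n) powr (b - 1)
         - b * (b - 1) / 2 * real (Suc n) powr (b - 2))" (is ?B)
proof -
  define m where "m = real (Suc n)"
  have m: "m > 0" by (simp add: m_def)
  have S: "real (Suc (Suc n)) = m + 1" "of_nat (Suc n) = complex_of_real m" by (simp_all add: m_def)
  have p: "(m + 1) powr b = m powr b * (1 + 1/m) powr b"
  proof -
    have "m + 1 = m * (1 + 1/m)" using m by (simp add: field_simps)
    thus ?thesis using m by (simp only: powr_mult)
  qed
  have q: "m powr (b - 1) = m powr b / m" "m powr (b - 2) = m powr b / (m * m)"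
    using m by (simp_all add: powr_diff power2_eq_square)
  have r: "(1 + complex_of_real (1/m)) powr of_real b = of_real ((1 + 1/m) powr b)"
    using m by (simp add: powr_of_real[symmetric])
  have t: "complex_of_real m powr of_real b = of_real (m powr b)"
    using m by (simp add: powr_of_real)
  show ?A unfolding remainder_term_def m_def[symmetric] S p q using r t
    by (simp add: falling_def algebra_simps)
  show ?B unfolding remainder_term_def m_def[symmetric] S p q using r t
    using m by (simp add: falling_def numeral_2_eq_2 lessThan_Suc algebra_simps power2_eq_square)
      (simp add: field_simps)
qed

text \<open>
  Euler-Maclaurin summation with two correction terms. The partial sums of \<open>m powr (a - 1)\<close>, which
  occur in both remainder series, cancel.
\<close>
lemma zeta_neg_real_limit:
  fixes a :: real
  assumes a: "0 < a" "a < 1"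
  shows "(\<lambda>N. complex_of_real ((\<Sum>m<N. real m powr a) - real N powr (1 + a) / (1 + a) + real N powr a / 2))
     \<longlonglongrightarrow> zeta (- of_real a)"
proof -
  define s where "s = - complex_of_real a"
  define p where "p = (\<lambda>N e. \<Sum>n<N. real (Suc n) powr e)"
  have s: "Re s = -a" "s = 1 - of_real (1 + a)" "s + 1 = 1 - of_real a" by (simp_all add: s_def)
  have r1: "(\<lambda>n. remainder_term 1 n (s + 1)) sums remainder_sum 1 (s + 1)"
    unfolding remainder_sum_def by (intro summable_sums summable_remainder_term) (use a s in auto)
  have r2: "(\<lambda>n. remainder_term 2 n s) sums remainder_sum 2 s"
    unfolding remainder_sum_def by (intro summable_sums summable_remainder_term) (use a s in auto)
  have tel: "(\<Sum>n<N. real (Suc (Suc n)) powr e - real (Suc n) powr e) = real (Suc N) powr e - 1" for N e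
    using sum_lessThan_telescope[of "\<lambda>n. real (Suc n) powr e" N] by simp
  have p1: "(\<Sum>n<N. remainder_term 1 n (s + 1)) = of_real (real (Suc N) powr a - 1 - a * p N (a - 1))" for N
    unfolding s(3) remainder_term_of_real of_real_sum[symmetric]
    by (simp only: sum_subtractf[of "\<lambda>n. real (Suc (Suc n)) powr a - real (Suc n) powr a"] tel p_def sum_distrib_left)
  have p2: "(\<Sum>n<N. remainder_term 2 n s) = of_real (real (Suc N) powr (1+a) - 1 - (1+a) * p N a - (1+a) * a / 2 * p N (a - 1))" for N
  proof -
    have "(\<Sum>n<N. real (Suc (Suc n)) powr (1+a) - real (Suc n) powr (1+a) - (1+a) * real (Suc n) powr (1 + a - 1)
         - (1+a) * (1 + a - 1) / 2 * real (Suc n) powr (1 + a - 2))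
       = (\<Sum>n<N. real (Suc (Suc n)) powr (1+a) - real (Suc n) powr (1+a)) - (\<Sum>n<N. (1+a) * real (Suc n) powr (1 + a - 1))
         - (\<Sum>n<N. (1+a) * (1 + a - 1) / 2 * real (Suc n) powr (1 + a - 2))"
      by (simp only: sum_subtractf)
    also have "1 + a - 2 = a - 1" by simp
    finally show ?thesis
      unfolding s(2) remainder_term_of_real of_real_sum[symmetric] tel
      by (simp add: p_def sum_distrib_left)
  qed
  have nz: "s \<noteq> 0" "s \<noteq> 1" "s + 1 \<noteq> 1" using a by (auto simp: s_def complex_eq_iff)
  have z1: "s * zeta (s + 1) = 1 + remainder_sum 1 (s + 1)"
    using zeta_eq_remainder_sum_1[of "s+1"] a nz s by simp
  have "(1 - s) * (- s) / 2 * zeta (s + 1) = - ((1 - s) / 2 * (s * zeta (s + 1)))" by simp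
  hence "(s - 1) * zeta s = 1 - (1 - s) / 2 * (1 + remainder_sum 1 (s + 1)) + remainder_sum 2 s"
    unfolding z1 using zeta_eq_remainder_sum_2[of s] a nz s by simp
  moreover have "(\<lambda>N. 1 - (1 - s) / 2 * (1 + (\<Sum>n<N. remainder_term 1 n (s + 1))) + (\<Sum>n<N. remainder_term 2 n s))
     \<longlonglongrightarrow> 1 - (1 - s) / 2 * (1 + remainder_sum 1 (s + 1)) + remainder_sum 2 s"
    using r1 r2 unfolding sums_def by (intro tendsto_intros) auto
  ultimately have "(\<lambda>N. (1 - (1 - s) / 2 * (1 + (\<Sum>n<N. remainder_term 1 n (s + 1))) + (\<Sum>n<N. remainder_term 2 n s)) / (s - 1))
     \<longlonglongrightarrow> (s - 1) * zeta s / (s - 1)"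
    using nz by (intro tendsto_intros) auto
  also have "(s - 1) * zeta s / (s - 1) = zeta s" using nz by simp
  also have "(\<lambda>N. (1 - (1 - s) / 2 * (1 + (\<Sum>n<N. remainder_term 1 n (s + 1))) + (\<Sum>n<N. remainder_term 2 n s)) / (s - 1))
    = (\<lambda>N. complex_of_real ((\<Sum>m<Suc N. real m powr a) - real (Suc N) powr (1 + a) / (1 + a) + real (Suc N) powr a / 2))"
  proof
    fix N
    have "(\<Sum>m<Suc N. real m powr a) = p N a" unfolding p_def by (subst sum.lessThan_Suc_shift) simp
    moreover have "s - 1 = - of_real (1 + a)" "1 - s = of_real (1+a)" by (simp_all add: s_def)
    moreover have "1 - (1+a) / 2 * (1 + (real (Suc N) powr a - 1 - a * p N (a - 1))) + (real (Suc N) powr (1+a) - 1 - (1+a) * p N a - (1+a) * a / 2 * p N (a - 1))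
       = - (1 + a) * (p N a - real (Suc N) powr (1 + a) / (1 + a) + real (Suc N) powr a / 2)"
    proof -
      have "1 - (1+a) / 2 * (1 + (A - 1 - a * B)) + (P - 1 - (1+a) * C - (1+a) * a / 2 * B)
          = - (1+a) * (C - P / (1+a) + A / 2)" for A B C P
        using a by (simp add: field_simps)
      thus ?thesis .
    qed
    moreover have "(1 - of_real (1+a) / 2 * (1 + of_real X) + of_real Y) / (- of_real (1+a))
        = complex_of_real ((1 - (1+a) / 2 * (1 + X) + Y) / (- (1+a)))" for X Y by simp
    ultimately show "(1 - (1 - s) / 2 * (1 + (\<Sum>n<N. remainder_term 1 n (s + 1))) + (\<Sum>n<N. remainder_term 2 n s)) / (s - 1)
      = complex_of_real ((\<Sum>m<Suc N. real m powr a) - real (Suc N) powr (1 + a) / (1 + a) + real (Suc N) powr a / 2)"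
      using a unfolding p1 p2 by (simp del: sum.lessThan_Suc of_nat_Suc of_real_add of_real_diff of_real_mult of_real_divide)
  qed
  finally show ?thesis unfolding s_def by (rule LIMSEQ_imp_Suc)
qed

section \<open>The functional equation\<close>

text \<open>
  The sum \<open>1 / (exp x - 1)\<close> of the exponentials \<open>exp (- n x)\<close>, \<open>n \<ge> 1\<close>, without the first two
  terms of its Laurent expansion at \<open>0\<close>. Its Mellin transform at \<open>- a\<close>, for \<open>0 < a < 1\<close>, is
  \<open>Gamma (- a) * zeta (- a)\<close>.
\<close>
definition planck_kernel :: "real \<Rightarrow> real" where
  "planck_kernel x = 1 / (exp x - 1) - 1 / x + 1 / 2"

lemma planck_kernel_nonneg: "x > 0 \<Longrightarrow> planck_kernel x \<ge> 0"
  unfolding planck_kernel_def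
  by (rule sums_le[OF _ sums_zero planck_partial_fractions]) (auto intro!: divide_nonneg_nonneg)

lemma planck_kernel_measurable [measurable]: "planck_kernel \<in> borel_measurable borel"
  unfolding planck_kernel_def by measurable

text \<open>
  The partial fractions turn the Mellin transform at \<open>- a\<close> into a Dirichlet series at \<open>1 + a\<close>, where
  it converges absolutely. This is the reason for working on the interval \<open>- 1 < s < 0\<close>.
\<close>
lemma nn_integral_planck_sum:
  fixes a :: real
  assumes a: "0 < a" "a < 1"
  shows "(\<integral>\<^sup>+x\<in>{0<..}. ennreal (x powr (-a-1) * planck_kernel x) \<partial>lborel)
    = ennreal (Gamma ((1+a)/2) * Gamma ((1-a)/2) * (2 * pi) powr (-a-1) * (\<Sum>k. real (Suc k) powr (-a-1)))"
proof -
  define c where "c = Gamma ((1+a)/2) * Gamma ((1-a)/2)"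
  have c: "c \<ge> 0" using a by (simp add: c_def Gamma_real_nonneg)
  define f where "f = (\<lambda>k x. ennreal (x powr (-a-1) * (2 * x / (x\<^sup>2 + (2 * pi * real (Suc k))\<^sup>2))) * indicator {0<..} x)"
  have "(\<integral>\<^sup>+x\<in>{0<..}. ennreal (x powr (-a-1) * planck_kernel x) \<partial>lborel) = (\<integral>\<^sup>+x. (\<Sum>k. f k x) \<partial>lborel)"
  proof (rule nn_integral_cong)
    fix x :: real
    show "ennreal (x powr (-a-1) * planck_kernel x) * indicator {0<..} x = (\<Sum>k. f k x)"
    proof (cases "x > 0")
      case True
      have "(\<lambda>k. x powr (-a-1) * (2 * x / (x\<^sup>2 + (2 * pi * real (Suc k))\<^sup>2))) sums (x powr (-a-1) * planck_kernel x)"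
        unfolding planck_kernel_def by (intro sums_mult planck_partial_fractions True)
      hence "(\<Sum>k. ennreal (x powr (-a-1) * (2 * x / (x\<^sup>2 + (2 * pi * real (Suc k))\<^sup>2)))) = ennreal (x powr (-a-1) * planck_kernel x)"
        using True by (intro suminf_ennreal_eq) (auto intro!: mult_nonneg_nonneg divide_nonneg_nonneg)
      thus ?thesis using True by (simp add: f_def)
    qed (simp add: f_def)
  qed
  also have "\<dots> = (\<Sum>k. integral\<^sup>N lborel (f k))"
    by (rule nn_integral_suminf) (simp add: f_def)
  also have "\<dots> = (\<Sum>k. ennreal (c * (2 * pi) powr (-a-1) * real (Suc k) powr (-a-1)))"
  proof (rule suminf_cong)
    fix k
    have "integral\<^sup>N lborel (f k) = ennreal (c * (2 * pi * real (Suc k)) powr (-a-1))"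
      unfolding f_def c_def by (rule nn_integral_powr_div_square_plus) (use a in auto)
    thus "integral\<^sup>N lborel (f k) = ennreal (c * (2 * pi) powr (-a-1) * real (Suc k) powr (-a-1))"
      by (simp add: powr_mult mult.assoc)
  qed
  also have "\<dots> = ennreal (c * (2 * pi) powr (-a-1) * (\<Sum>k. real (Suc k) powr (-a-1)))"
  proof (rule suminf_ennreal_eq)
    have "summable (\<lambda>k. real (Suc k) powr (-a-1))"
      using summable_Suc_powr[of "-a-1" 1] a by simp
    thus "(\<lambda>k. c * (2 * pi) powr (-a-1) * real (Suc k) powr (-a-1)) sums (c * (2 * pi) powr (-a-1) * (\<Sum>k. real (Suc k) powr (-a-1)))"
      by (intro sums_mult summable_sums)
  qed (use c in auto)
  finally show ?thesis by (simp only: c_def)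
qed

text \<open>
  Every summand on the left is nonnegative, and the right-hand side has a known Mellin transform; so
  the Mellin transform of the truncated kernel follows by subtraction.
\<close>
lemma planck_kernel_geometric:
  fixes x :: real
  assumes x: "x > 0"
  shows "(1 - exp (-(real M * x))) * planck_kernel x + (\<Sum>m<M. 1 - exp (-(real m * x))) + (1 - exp (-(real M * x))) / 2
     = (exp (-(real M * x)) - 1 + real M * x) / x"
proof -
  define q where "q = exp (-x)"
  have q: "q < 1" "q > 0" using x by (auto simp: q_def)
  have e: "exp (-(real m * x)) = q ^ m" for m
    by (simp add: q_def exp_of_nat_mult[symmetric])
  define P where "P = 1 / (1 - q)"
  have S: "(\<Sum>m<M. 1 - q ^ m) = real M - (1 - q ^ M) * P"
    using q unfolding sum_subtractf P_def by (simp add: sum_gp_strict)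
  have pk: "planck_kernel x = P - 1 / x - 1 / 2"
  proof -
    have "exp x = 1 / q" by (simp add: q_def exp_minus field_simps)
    thus ?thesis using q x unfolding planck_kernel_def P_def by (simp add: divide_simps) (simp add: algebra_simps)
  qed
  show ?thesis using x unfolding e S pk
    by (simp add: algebra_simps diff_divide_distrib add_divide_distrib)
qed

text \<open>
  The value is, up to the factor \<open>- Gamma (1 - a) / a = Gamma (- a)\<close>, the Euler-Maclaurin
  approximation of \<open>zeta (- a)\<close> in \<open>zeta_neg_real_limit\<close>.
\<close>
lemma nn_integral_planck_truncated:
  fixes a :: real
  assumes a: "0 < a" "a < 1"
  shows "(\<integral>\<^sup>+x\<in>{0<..}. ennreal (x powr (-a-1) * ((1 - exp (-(real M * x))) * planck_kernel x)) \<partial>lborel)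
    = ennreal (Gamma (1-a) / a * (real M powr (1 + a) / (1 + a) - (\<Sum>m<M. real m powr a) - real M powr a / 2))"
proof -
  define A where "A = Gamma (1-a) / a"
  have A: "A \<ge> 0" using a by (simp add: A_def Gamma_real_nonneg)
  define e where "e = (\<lambda>(m::nat) x. 1 - exp (-(real m * x)))"
  have e0: "e m x \<ge> 0" if "x > 0" for m x using that by (simp add: e_def)
  have [measurable]: "e m \<in> borel_measurable borel" for m unfolding e_def by measurable
  define S where "S = (\<Sum>m<M. real m powr a) + real M powr a / 2"
  have E1: "(\<integral>\<^sup>+x\<in>{0<..}. ennreal (x powr (-a-1) * e m x) \<partial>lborel) = ennreal (A * real m powr a)" for m
    unfolding A_def e_def by (rule nn_integral_powr_one_minus_exp) (use a in auto)
  have E2: "(\<integral>\<^sup>+x\<in>{0<..}. ennreal (x powr (-a-1) * ((exp (-(real M * x)) - 1 + real M * x) / x)) \<partial>lborel)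
     = ennreal (A * (real M powr (1 + a) / (1 + a)))"
    unfolding A_def by (rule nn_integral_powr_exp_remainder) (use a in auto)
  define K where "K = (\<lambda>m x. ennreal (x powr (-a-1) * e m x) * indicator {0<..} x)"
  have [measurable]: "K m \<in> borel_measurable borel" for m unfolding K_def by measurable
  have E1: "integral\<^sup>N lborel (K m) = ennreal (A * real m powr a)" for m
    unfolding K_def by (rule E1)
  define I where "I = (\<integral>\<^sup>+x\<in>{0<..}. ennreal (x powr (-a-1) * (e M x * planck_kernel x)) \<partial>lborel)"
  have "ennreal (A * (real M powr (1 + a) / (1 + a))) =
     (\<integral>\<^sup>+x. ennreal (x powr (-a-1) * (e M x * planck_kernel x)) * indicator {0<..} x
        + (\<Sum>m<M. K m x) + ennreal (1/2) * K M x \<partial>lborel)"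
    unfolding E2[symmetric]
  proof (rule nn_integral_cong)
    fix x :: real
    show "ennreal (x powr (-a-1) * ((exp (-(real M * x)) - 1 + real M * x) / x)) * indicator {0<..} x
      = ennreal (x powr (-a-1) * (e M x * planck_kernel x)) * indicator {0<..} x
        + (\<Sum>m<M. K m x) + ennreal (1/2) * K M x"
    proof (cases "x > 0")
      case True
      note pos = e0[OF True] planck_kernel_nonneg[OF True]
      have e_app: "1 - exp (-(real m * x)) = e m x" for m by (simp add: e_def)
      have "x powr (-a-1) * ((exp (-(real M * x)) - 1 + real M * x) / x)
         = x powr (-a-1) * (e M x * planck_kernel x) + (\<Sum>m<M. x powr (-a-1) * e m x) + 1/2 * (x powr (-a-1) * e M x)"
        unfolding planck_kernel_geometric[OF True, symmetric] e_app sum_distrib_left[symmetric] by (simp add: algebra_simps)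
      thus ?thesis using True pos
        by (simp add: K_def sum_ennreal sum_nonneg flip: ennreal_plus ennreal_mult del: ennreal_half)
    qed (simp add: K_def)
  qed
  also have "\<dots> = I + (\<Sum>m<M. ennreal (A * real m powr a)) + ennreal (1/2) * ennreal (A * real M powr a)"
    unfolding I_def E1[symmetric]
    by (simp add: nn_integral_add nn_integral_sum nn_integral_cmult del: ennreal_half)
  also have "\<dots> = I + ennreal (A * S)"
  proof -
    have "(\<Sum>m<M. ennreal (A * real m powr a)) + ennreal (1/2) * ennreal (A * real M powr a) = ennreal (A * S)"
      using A by (simp add: S_def sum_ennreal sum_nonneg algebra_simps sum_distrib_left flip: ennreal_plus ennreal_mult del: ennreal_half)
    thus ?thesis by (simp add: add.assoc)
  qed
  finally have "I = ennreal (A * (real M powr (1 + a) / (1 + a))) - ennreal (A * S)"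
    by simp
  also have "\<dots> = ennreal (A * (real M powr (1 + a) / (1 + a)) - A * S)"
    using A by (intro ennreal_minus) (auto simp: S_def sum_nonneg)
  finally show ?thesis
    unfolding I_def e_def A_def S_def by (simp add: algebra_simps)
qed

text \<open>
  The Mellin transform of the kernel, evaluated in two ways: by monotone convergence from the
  truncated kernels, and by partial fractions.
\<close>
theorem zeta_functional_equation_real:
  fixes a :: real
  assumes a: "0 < a" "a < 1"
  shows "zeta (- of_real a) = of_real (- (a / Gamma (1-a) * Gamma ((1+a)/2) * Gamma ((1-a)/2) * (2 * pi) powr (-a-1))) * zeta (1 + of_real a)"
proof -
  define A where "A = Gamma (1-a) / a"
  have A: "A > 0" using a by (simp add: A_def)
  define d where "d = (\<lambda>M. (\<Sum>m<M. real m powr a) - real M powr (1 + a) / (1 + a) + real M powr a / 2)"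
  define Z where "Z = (\<Sum>k. real (Suc k) powr (-a-1))"
  define V where "V = Gamma ((1+a)/2) * Gamma ((1-a)/2) * (2 * pi) powr (-a-1) * Z"
  have summ: "summable (\<lambda>k. real (Suc k) powr (-a-1))"
    using summable_Suc_powr[of "-a-1" 1] a by simp
  have "Z > 0" unfolding Z_def by (rule suminf_pos[OF summ]) simp
  hence V: "V > 0" using a by (simp add: V_def)
  have lim: "(\<lambda>M. complex_of_real (d M)) \<longlonglongrightarrow> zeta (- of_real a)"
    unfolding d_def by (rule zeta_neg_real_limit[OF a])
  have "(\<lambda>M. \<integral>\<^sup>+x\<in>{0<..}. ennreal (x powr (-a-1) * ((1 - exp (-(real M * x))) * planck_kernel x)) \<partial>lborel)
     \<longlonglongrightarrow> (\<integral>\<^sup>+x\<in>{0<..}. ennreal (x powr (-a-1) * planck_kernel x) \<partial>lborel)"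
  proof (rule nn_integral_LIMSEQ)
    show "incseq (\<lambda>M x. ennreal (x powr (-a-1) * ((1 - exp (-(real M * x))) * planck_kernel x)) * indicator {0<..} x)"
      unfolding incseq_def le_fun_def
      by (auto simp: indicator_def intro!: ennreal_leI mult_left_mono mult_right_mono planck_kernel_nonneg)
    fix x :: real
    show "(\<lambda>M. ennreal (x powr (-a-1) * ((1 - exp (-(real M * x))) * planck_kernel x)) * indicator {0<..} x)
       \<longlonglongrightarrow> ennreal (x powr (-a-1) * planck_kernel x) * indicator {0<..} x"
    proof (cases "x > 0")
      case True
      have "(\<lambda>M. exp (-x) ^ M) \<longlonglongrightarrow> 0" by (rule LIMSEQ_power_zero) (use True in auto)
      hence "(\<lambda>M. exp (-(real M * x))) \<longlonglongrightarrow> 0" by (simp add: exp_of_nat_mult[symmetric])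
      hence "(\<lambda>M. x powr (-a-1) * ((1 - exp (-(real M * x))) * planck_kernel x)) \<longlonglongrightarrow> x powr (-a-1) * ((1 - 0) * planck_kernel x)"
        by (intro tendsto_intros)
      thus ?thesis using True by simp
    qed simp
  qed simp
  hence "(\<lambda>M. ennreal (A * (- d M))) \<longlonglongrightarrow> ennreal V"
    unfolding nn_integral_planck_truncated[OF a] nn_integral_planck_sum[OF a] A_def d_def V_def Z_def
    by (simp add: algebra_simps)
  moreover have "(\<lambda>M. ennreal (A * (- d M))) \<longlonglongrightarrow> ennreal (A * (- Re (zeta (- of_real a))))"
    using tendsto_Re[OF lim] by (intro tendsto_intros tendsto_ennrealI) simp
  ultimately have "ennreal V = ennreal (A * (- Re (zeta (- of_real a))))"
    by (rule LIMSEQ_unique)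
  hence VA: "V = A * (- Re (zeta (- of_real a)))"
    using V by (cases "A * (- Re (zeta (- of_real a))) \<ge> 0") (auto simp: ennreal_neg)
  have "(\<lambda>M. Im (complex_of_real (d M))) \<longlonglongrightarrow> Im (zeta (- of_real a))" by (rule tendsto_Im[OF lim])
  hence "Im (zeta (- of_real a)) = 0" by (simp add: LIMSEQ_const_iff)
  hence "zeta (- of_real a) = of_real (Re (zeta (- of_real a)))" by (simp add: complex_eq_iff)
  also have "Re (zeta (- of_real a)) = - (V / A)" using VA A by (simp add: field_simps)
  finally have "zeta (- of_real a) = of_real (- (V / A))" .
  moreover have "zeta (1 + of_real a) = of_real Z"
  proof -
    have "zeta (1 + of_real a) = zeta_series (1 + of_real a)" using a by (intro zeta_eq_series) simp
    also have "\<dots> = (\<Sum>k. complex_of_real (real (Suc k) powr (-a-1)))"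
      unfolding zeta_series_def
    proof (rule suminf_cong)
      fix n
      have "of_nat (Suc n) powr (1 + complex_of_real a) = complex_of_real (real (Suc n) powr (1 + a))"
        using powr_of_real[of "real (Suc n)" "1+a"] by simp
      moreover have "-a-1 = -(1 + a)" by simp
      hence "real (Suc n) powr (-a-1) = 1 / real (Suc n) powr (1 + a)"
        by (simp only: powr_minus_divide)
      ultimately show "1 / of_nat (Suc n) powr (1 + complex_of_real a) = complex_of_real (real (Suc n) powr (-a-1))"
        by simp
    qed
    also have "\<dots> = of_real Z" unfolding Z_def using summ by (rule suminf_of_real[symmetric])
    finally show ?thesis .
  qed
  ultimately show ?thesis by (simp add: V_def A_def)
qed


definition zeta_chi :: "complex \<Rightarrow> complex" where
  "zeta_chi s = 2 * of_real (2 * pi) powr (s - 1) * sin (of_real pi * s / 2) * Gamma (1 - s)"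

lemma zeta_chi_neg_real:
  fixes a :: real
  assumes a: "0 < a" "a < 1"
  shows "zeta_chi (- of_real a) = of_real (- (a / Gamma (1-a) * Gamma ((1+a)/2) * Gamma ((1-a)/2) * (2 * pi) powr (-a-1)))"
proof -
  define G where "G = Gamma (1 - a)"
  have G: "G > 0" using a by (simp add: G_def)
  have refl: "Gamma x * Gamma (1 - x) = pi / sin (pi * x)" for x :: real
  proof -
    have "complex_of_real (Gamma x * Gamma (1 - x)) = of_real (pi / sin (pi * x))"
      using Gamma_reflection_complex[of "of_real x"]
      by (simp add: Gamma_complex_of_real[symmetric] sin_of_real[symmetric])
    thus ?thesis by (simp only: of_real_eq_iff)
  qed
  have sc: "sin (pi * a / 2) > 0" "cos (pi * a / 2) > 0"
  proof -
    have "0 < pi * a / 2" "pi * a / 2 < pi / 2" using a by auto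
    thus "sin (pi * a / 2) > 0" "cos (pi * a / 2) > 0"
      by (auto intro!: sin_gt_zero cos_gt_zero)
  qed
  have "Gamma ((1+a)/2) * Gamma ((1-a)/2) = pi / sin (pi * ((1+a)/2))"
    using refl[of "(1+a)/2"] by (simp add: field_simps)
  also have "sin (pi * ((1+a)/2)) = cos (pi * a / 2)"
  proof -
    have *: "pi * ((1+a)/2) = pi * a / 2 + pi / 2" by (simp add: algebra_simps add_divide_distrib)
    show ?thesis unfolding * sin_add by simp
  qed
  finally have 1: "Gamma ((1+a)/2) * Gamma ((1-a)/2) = pi / cos (pi * a / 2)" .
  have "Gamma (1 + a) = a * Gamma a"
  proof -
    have "a \<notin> \<int>\<^sub>\<le>\<^sub>0" using a by (auto simp: nonpos_Ints_def)
    thus ?thesis using Gamma_plus1[of a] by (simp add: add.commute)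
  qed
  also have "Gamma a = pi / sin (pi * a) / G"
    using refl[of a] G unfolding G_def[symmetric] by (metis nonzero_mult_div_cancel_right less_irrefl)
  also have "sin (pi * a) = 2 * sin (pi * a / 2) * cos (pi * a / 2)"
    using sin_double[of "pi * a / 2"] by simp
  finally have 2: "sin (pi * a / 2) * Gamma (1 + a) = a / G * (pi / cos (pi * a / 2)) / 2"
    using sc by simp
  have "zeta_chi (- of_real a) = of_real (2 * (2 * pi) powr (-a-1) * sin (- (pi * a / 2)) * Gamma (1 + a))"
    using powr_of_real[of "2*pi" "-a-1"]
    by (simp add: zeta_chi_def Gamma_complex_of_real[symmetric] sin_of_real[symmetric])
  also have "2 * (2 * pi) powr (-a-1) * sin (- (pi * a / 2)) * Gamma (1 + a) = - (2 * (2 * pi) powr (-a-1)) * (sin (pi * a / 2) * Gamma (1 + a))"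
    by simp
  also have "\<dots> = - (a / G * (Gamma ((1+a)/2) * Gamma ((1-a)/2)) * (2 * pi) powr (-a-1))"
    unfolding 1 2 by simp
  finally show ?thesis by (simp add: G_def mult.assoc)
qed

text \<open>
  The conjugate function satisfies the same defining conditions, so uniqueness of the continuation
  applies.
\<close>
lemma zeta_cnj: "zeta (cnj s) = cnj (zeta s)"
proof -
  define f where "f = (\<lambda>s. cnj (zeta (cnj s)))"
  have "is_zeta f"
    unfolding is_zeta_def
  proof (intro conjI allI impI)
    have "(cnj \<circ> zeta \<circ> cnj) holomorphic_on - {1}"
      by (rule holomorphic_on_compose_cnj_cnj) (auto intro!: holomorphic_intros open_Compl)
    thus "f holomorphic_on - {1}" by (simp add: f_def o_def)
    show "f 1 = 0" using is_zeta_zeta by (simp add: f_def is_zeta_def)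
    fix s :: complex assume s: "Re s > 1"
    have "(\<lambda>n. cnj (1 / of_nat (Suc n) powr cnj s)) sums cnj (zeta_series (cnj s))"
      unfolding sums_cnj using s by (intro sums_zeta_series) simp
    also have "(\<lambda>n. cnj (1 / of_nat (Suc n) powr cnj s)) = (\<lambda>n. 1 / of_nat (Suc n) powr s)"
      by (intro ext) (simp add: cnj_powr)
    finally show "f s = zeta_series s" using sums_zeta_series[OF s] s
      unfolding f_def by (simp add: zeta_eq_series sums_unique2)
  qed
  hence "f = zeta" using is_zeta_zeta is_zeta_ex1 by blast
  thus ?thesis by (metis complex_cnj_cnj f_def)
qed

lemma zeta_chi_cnj: "zeta_chi (cnj s) = cnj (zeta_chi s)"
  by (simp add: zeta_chi_def cnj_Gamma cnj_powr cnj_sin)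

lemma zeta_chi_holomorphic [holomorphic_intros]:
  assumes "\<And>s. s \<in> A \<Longrightarrow> Im s \<noteq> 0 \<or> Re s < 1"
  shows "zeta_chi holomorphic_on A"
proof -
  have "1 - s \<notin> \<int>\<^sub>\<le>\<^sub>0" if "s \<in> A" for s
  proof
    assume "1 - s \<in> \<int>\<^sub>\<le>\<^sub>0"
    then obtain n where "1 - s = of_int n" "n \<le> 0" by (auto elim: nonpos_Ints_cases)
    hence "Im s = 0" "Re s = 1 - of_int n" by (auto simp: complex_eq_iff)
    thus False using assms[OF that] \<open>n \<le> 0\<close> by simp
  qed
  thus ?thesis unfolding zeta_chi_def by (intro holomorphic_intros) auto
qed

text \<open>
  In the upper half plane by the identity theorem, starting from the real interval \<open>- 1 < s < 0\<close>: the
  union of \<open>Re s < 0\<close> and \<open>Im s > 0\<close> is connected and contains no pole of the functions involved. The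
  lower half plane follows by conjugation.
\<close>
theorem zeta_functional_equation:
  assumes s: "Im s \<noteq> 0"
  shows "zeta s = zeta_chi s * zeta (1 - s)"
proof -
  have upper: "zeta s = zeta_chi s * zeta (1 - s)" if "Im s > 0" for s
  proof -
    define D where "D = {s. Re s < 0} \<union> {s. Im s > 0}"
    define U where "U = (\<lambda>a. - complex_of_real a) ` {0<..<1}"
    have "zeta s - zeta_chi s * zeta (1 - s) = 0"
    proof (rule analytic_continuation[where f = "\<lambda>s. zeta s - zeta_chi s * zeta (1 - s)" and S = D and U = U and \<xi> = "- of_real (1/2)"])
      have "(zeta \<circ> (\<lambda>s. 1 - s)) holomorphic_on D"
        by (intro holomorphic_on_compose holomorphic_intros) (auto simp: D_def complex_eq_iff)
      thus "(\<lambda>s. zeta s - zeta_chi s * zeta (1 - s)) holomorphic_on D"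
        by (intro holomorphic_intros) (auto simp: D_def o_def complex_eq_iff)
      show "open D" unfolding D_def
        by (intro open_Un open_halfspace_Re_lt open_halfspace_Im_gt)
      have "Complex (-1) 1 \<in> {s. Re s < 0} \<inter> {s. Im s > 0}" by simp
      hence "{s. Re s < 0} \<inter> {s. Im s > 0} \<noteq> {}" by blast
      thus "connected D" unfolding D_def
        by (intro connected_Un convex_connected convex_halfspace_Re_lt convex_halfspace_Im_gt)
      show "- complex_of_real (1/2) islimpt U"
        unfolding islimpt_approachable
      proof (intro allI impI)
        fix e :: real assume e: "e > 0"
        define a where "a = 1/2 + min e (1/2) / 2"
        have "a \<in> {0<..<1}" "a \<noteq> 1/2" "\<bar>a - 1/2\<bar> < e" using e by (auto simp: a_def min_def)
        moreover have "dist (- complex_of_real a) (- of_real (1/2)) = \<bar>a - 1/2\<bar>"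
          by (metis abs_minus_commute dist_minus dist_of_real dist_real_def)
        ultimately show "\<exists>x'\<in>U. x' \<noteq> - complex_of_real (1/2) \<and> dist x' (- of_real (1/2)) < e"
          unfolding U_def by (intro bexI[of _ "- complex_of_real a"]) (auto simp: complex_eq_iff)
      qed
      fix z assume "z \<in> U"
      then obtain a where a: "0 < a" "a < 1" "z = - of_real a" by (auto simp: U_def)
      show "zeta z - zeta_chi z * zeta (1 - z) = 0"
        unfolding a(3) zeta_functional_equation_real[OF a(1,2)] zeta_chi_neg_real[OF a(1,2)] by simp
    qed (use that in \<open>auto simp: D_def U_def\<close>)
    thus ?thesis by simp
  qed
  show ?thesis
  proof (cases "Im s > 0")
    case False
    hence "zeta (cnj s) = zeta_chi (cnj s) * zeta (1 - cnj s)" using s by (intro upper) auto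
    hence "cnj (zeta s) = cnj (zeta_chi s * zeta (1 - s))"
      using zeta_cnj[of "1 - s"] by (simp add: zeta_cnj zeta_chi_cnj)
    thus ?thesis using complex_cnj_cancel_iff by blast
  qed (rule upper)
qed

section \<open>The factor of the functional equation\<close>

lemma Ln_increment_bound:
  fixes w :: complex
  assumes w: "\<bar>Im w\<bar> \<ge> 1"
  shows "norm (Ln (w + 1) - Ln w - inverse w) \<le> 2 / (norm w)\<^sup>2"
proof -
  define g where "g = (\<lambda>u. Ln (w + u) - u / w)"
  define S where "S = closed_segment 0 (1::complex)"
  have w1: "norm v \<ge> 1" if "Im v = Im w" for v using that w abs_Im_le_cmod[of v] by simp
  have S: "Im u = 0 \<and> norm u \<le> 1" if "u \<in> S" for u
    using that by (auto simp: S_def closed_segment_def scaleR_conv_of_real)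
  have "norm (g 1 - g 0) \<le> 2 / (norm w)\<^sup>2 * norm (1 - 0 :: complex)"
  proof (rule field_differentiable_bound[where S = S])
    show "convex S" "0 \<in> S" "1 \<in> S" by (auto simp: S_def)
    fix u assume u: "u \<in> S"
    have im: "Im (w + u) = Im w" "norm u \<le> 1" using S[OF u] by simp_all
    have nz: "w \<noteq> 0" "w + u \<noteq> 0" using w1[of w] w1[OF im(1)] by auto
    have nR: "w + u \<notin> \<real>\<^sub>\<le>\<^sub>0" using im w by (auto simp: complex_nonpos_Reals_iff)
    show "(g has_field_derivative (1 / (w + u) - 1 / w)) (at u within S)"
      unfolding g_def using nR nz by (auto intro!: derivative_eq_intros simp: inverse_eq_divide)
    have "1 / (w + u) - 1 / w = - u / (w * (w + u))" using nz by (simp add: divide_simps)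
    hence "norm (1 / (w + u) - 1 / w) = norm u / (norm w * norm (w + u))" by (simp add: norm_divide norm_mult)
    also have "\<dots> \<le> 1 / (norm w * norm (w + u))" using im by (intro divide_right_mono) auto
    also have "\<dots> \<le> 1 / (norm w * (norm w / 2))"
    proof (rule divide_left_mono)
      have "norm w \<le> norm (w + u) + norm u" using norm_triangle_ineq4[of "w + u" u] by simp
      hence "norm w / 2 \<le> norm (w + u)" using im w1[OF im(1)] by simp
      thus "norm w * (norm w / 2) \<le> norm w * norm (w + u)" by (intro mult_left_mono) auto
    qed (use nz in auto)
    also have "\<dots> = 2 / (norm w)\<^sup>2" by (simp add: power2_eq_square)
    finally show "norm (1 / (w + u) - 1 / w) \<le> 2 / (norm w)\<^sup>2" .
  qed
  thus ?thesis by (simp add: g_def inverse_eq_divide algebra_simps)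
qed

lemma summable_inverse_Suc_square: "summable (\<lambda>n. 1 / (real (Suc n))\<^sup>2)"
  using inverse_power_summable[of 2, where 'a = real] by (subst summable_Suc_iff) (simp add: inverse_eq_divide)

text \<open>
  The defining series is compared with the telescoping sum of \<open>Ln (z + n + 1) - Ln (z + n)\<close>. The bound
  depends on \<open>z\<close> only through the width of the strip, which is what makes it uniform in the height.
\<close>
lemma norm_Digamma_minus_Ln_le:
  fixes z :: complex
  assumes im: "\<bar>Im z\<bar> \<ge> 1" and re: "\<bar>Re z\<bar> \<le> W"
  shows "norm (Digamma z - Ln z) \<le> 2 * (1 + (W + 1)\<^sup>2) * (\<Sum>n. 1 / (real (Suc n))\<^sup>2)"
proof -
  have z0: "z \<noteq> 0" using im by auto
  define A where "A = 2 * (1 + (W + 1)\<^sup>2)"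
  have A: "A > 0" unfolding A_def by (intro mult_pos_pos add_pos_nonneg) auto
  define g where "g = (\<lambda>n. Ln (z + of_nat n + 1) - Ln (z + of_nat n) - inverse (z + of_nat n))"
  have g: "norm (g n) \<le> A * (1 / (real (Suc n))\<^sup>2)" for n
  proof -
    define x where "x = Re z + real n"
    have "norm (g n) \<le> 2 / (norm (z + of_nat n))\<^sup>2"
      unfolding g_def by (rule Ln_increment_bound) (use im in simp)
    also have "\<dots> \<le> A / (real (Suc n))\<^sup>2"
    proof -
      have "(Im z)\<^sup>2 \<ge> 1" using im by (simp add: abs_le_square_iff[of 1, simplified])
      hence x1: "x\<^sup>2 + 1 \<le> (norm (z + of_nat n))\<^sup>2" by (simp add: cmod_power2 x_def)
      have "real (Suc n) \<le> \<bar>x\<bar> + (W + 1)" using re by (simp add: x_def)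
      hence "(real (Suc n))\<^sup>2 \<le> (\<bar>x\<bar> + (W + 1))\<^sup>2" by (intro power_mono) auto
      also have "\<dots> \<le> (x\<^sup>2 + 1) * (1 + (W + 1)\<^sup>2)"
      proof -
        have "(\<bar>x\<bar> * (W + 1) - 1)\<^sup>2 \<ge> 0" by simp
        thus ?thesis by (simp add: power2_eq_square algebra_simps)
      qed
      also have "\<dots> \<le> (norm (z + of_nat n))\<^sup>2 * (1 + (W + 1)\<^sup>2)"
        using x1 by (intro mult_right_mono) auto
      finally have le: "(real (Suc n))\<^sup>2 \<le> (norm (z + of_nat n))\<^sup>2 * (1 + (W + 1)\<^sup>2)" .
      have "x\<^sup>2 + 1 > 0" by (simp add: add_nonneg_pos)
      hence "(norm (z + of_nat n))\<^sup>2 > 0" using x1 by linarith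
      moreover have "2 * (real (Suc n))\<^sup>2 \<le> A * (norm (z + of_nat n))\<^sup>2"
        using mult_left_mono[OF le, of 2] by (simp only: A_def mult_ac)
      ultimately show ?thesis by (simp add: divide_simps mult_ac del: of_nat_Suc)
    qed
    finally show ?thesis by simp
  qed
  have part: "(\<Sum>n<m. g n) = Ln (z + of_nat m) - Ln z - (\<Sum>n<m. inverse (z + of_nat n))" for m
    by (induction m) (simp_all add: g_def algebra_simps)
  have "(\<lambda>m. of_real (ln (real m)) - (\<Sum>n<m. inverse (z + of_nat n)) - Ln z) \<longlonglongrightarrow> Digamma z - Ln z"
    by (intro tendsto_diff Digamma_LIMSEQ z0 tendsto_const)
  moreover have "(\<lambda>m. Ln (z + of_nat m) - of_real (ln (real m))) \<longlonglongrightarrow> 0"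
  proof -
    have "(\<lambda>m. z / of_nat m + 1) \<longlonglongrightarrow> 0 + 1"
      by (intro tendsto_add tendsto_const lim_const_over_n)
    hence "(\<lambda>m. Ln (z / of_nat m + 1)) \<longlonglongrightarrow> Ln (0 + 1)"
      by (rule tendsto_Ln) auto
    moreover have "\<forall>\<^sub>F m in sequentially. Ln (z / of_nat m + 1) = Ln (z + of_nat m) - of_real (ln (real m))"
      using eventually_gt_at_top[of 0]
    proof eventually_elim
      case (elim m)
      have nz: "z + of_nat m \<noteq> 0" using im by (auto simp: complex_eq_iff)
      have "Ln ((z + of_nat m) / of_nat m) = Ln (z + of_nat m) - of_real (ln (real m))"
        using Ln_divide_of_real[of "real m" "z + of_nat m"] nz elim by simp
      moreover have "(z + of_nat m) / of_nat m = z / of_nat m + 1" using elim by (simp add: add_divide_distrib)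
      ultimately show ?case by simp
    qed
    ultimately show ?thesis by (simp add: tendsto_cong)
  qed
  ultimately have "(\<lambda>m. (of_real (ln (real m)) - (\<Sum>n<m. inverse (z + of_nat n)) - Ln z) + (Ln (z + of_nat m) - of_real (ln (real m)))) \<longlonglongrightarrow> Digamma z - Ln z + 0"
    by (rule tendsto_add)
  hence lim: "(\<lambda>m. \<Sum>n<m. g n) \<longlonglongrightarrow> Digamma z - Ln z"
    unfolding part by (simp add: algebra_simps)
  have "norm (\<Sum>n<m. g n) \<le> A * (\<Sum>n. 1 / (real (Suc n))\<^sup>2)" for m
  proof -
    have "norm (\<Sum>n<m. g n) \<le> (\<Sum>n<m. A * (1 / (real (Suc n))\<^sup>2))"
      by (rule sum_norm_le) (rule g)
    also have "\<dots> = A * (\<Sum>n<m. 1 / (real (Suc n))\<^sup>2)" by (rule sum_distrib_left[symmetric])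
    also have "\<dots> \<le> A * (\<Sum>n. 1 / (real (Suc n))\<^sup>2)"
      using A by (intro mult_left_mono sum_le_suminf summable_inverse_Suc_square) auto
    finally show ?thesis .
  qed
  hence "norm (Digamma z - Ln z) \<le> A * (\<Sum>n. 1 / (real (Suc n))\<^sup>2)"
    by (intro tendsto_upperbound[OF tendsto_norm[OF lim]]) auto
  thus ?thesis by (simp only: A_def)
qed

text \<open>
  This is \<open>- \<chi>'/\<chi>\<close>, see \<open>has_field_derivative_zeta_chi\<close>. The sign is chosen so that it is
  approximately \<open>log t\<close> at height \<open>t > 0\<close>.
\<close>
definition neg_logderiv :: "complex \<Rightarrow> complex" where
  "neg_logderiv s = Digamma (1 - s) - of_real (ln (2 * pi)) - of_real (pi / 2) * cot (of_real pi * s / 2)"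

lemma sin_nonzero_of_Im: "Im z \<noteq> 0 \<Longrightarrow> sin z \<noteq> 0"
  by (auto simp: sin_eq_0)

lemma nonpos_Ints_of_Im: "Im z \<noteq> 0 \<Longrightarrow> z \<notin> \<int>\<^sub>\<le>\<^sub>0"
  by (auto elim!: nonpos_Ints_cases)

lemma has_field_derivative_zeta_chi:
  assumes s: "Im s \<noteq> 0"
  shows "(zeta_chi has_field_derivative - zeta_chi s * neg_logderiv s) (at s)"
proof -
  have sn: "sin (of_real pi * s / 2) \<noteq> 0" using s by (intro sin_nonzero_of_Im) simp
  have "1 - s \<notin> \<int>\<^sub>\<le>\<^sub>0" using s by (intro nonpos_Ints_of_Im) simp
  moreover have "((\<lambda>s. complex_of_real (2 * pi) powr (s - 1)) has_field_derivative
      of_real (ln (2 * pi)) * of_real (2 * pi) powr (s - 1)) (at s)"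
  proof -
    define c where "c = complex_of_real (2 * pi)"
    have "((\<lambda>s. c powr (s - 1)) has_field_derivative Ln c * c powr (s - 1) * 1) (at s)"
      by (rule DERIV_chain2[OF has_field_derivative_powr_right]) (auto simp: c_def intro!: derivative_eq_intros)
    moreover have "Ln c = of_real (ln (2 * pi))" unfolding c_def by (rule Ln_of_real) simp
    ultimately show ?thesis by (simp add: c_def)
  qed
  ultimately show ?thesis unfolding zeta_chi_def neg_logderiv_def using sn
    by (auto intro!: derivative_eq_intros simp: cot_def field_simps)
qed

lemma zeta_chi_mult_reflect:
  assumes s: "Im s \<noteq> 0"
  shows "zeta_chi s * zeta_chi (1 - s) = 1"
proof -
  define w where "w = of_real pi * s / 2"
  have sn: "sin w \<noteq> 0" "cos w \<noteq> 0"
    using s sin_nonzero_of_Im[of w] sin_nonzero_of_Im[of "of_real pi / 2 - w"]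
    by (auto simp: w_def sin_diff)
  have 1: "complex_of_real (2 * pi) powr (s - 1) * of_real (2 * pi) powr (1 - s - 1) = 1 / of_real (2 * pi)"
    by (subst powr_add[symmetric]) (simp add: powr_minus_divide)
  have 2: "sin (of_real pi * (1 - s) / 2) = cos w"
    by (simp add: w_def right_diff_distrib diff_divide_distrib sin_diff)
  have 3: "Gamma (1 - s) * Gamma s = of_real pi / (2 * sin w * cos w)"
    using Gamma_reflection_complex[of s] sin_double[of w] by (simp add: w_def mult.commute)
  have "zeta_chi s * zeta_chi (1 - s) = 4 * (complex_of_real (2 * pi) powr (s - 1) * of_real (2 * pi) powr (1 - s - 1))
      * (sin w * cos w) * (Gamma (1 - s) * Gamma s)"
    unfolding zeta_chi_def 2 w_def[symmetric] by (simp add: mult_ac)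
  also have "\<dots> = 1" unfolding 1 3 using sn by (simp add: field_simps)
  finally show ?thesis .
qed

lemma zeta_chi_nonzero: "Im s \<noteq> 0 \<Longrightarrow> zeta_chi s \<noteq> 0"
  using zeta_chi_mult_reflect[of s] by auto

lemma open_nonreal: "open (- {s. Im s = 0})"
proof -
  have "- {s. Im s = 0} = {s. Im s > 0} \<union> {s. Im s < 0}" by auto
  thus ?thesis by (simp add: open_Un open_halfspace_Im_gt open_halfspace_Im_lt)
qed

text \<open>
  The logarithmic derivative of \<open>zeta_chi_mult_reflect\<close>.
\<close>
lemma neg_logderiv_reflect:
  assumes s: "Im s \<noteq> 0"
  shows "neg_logderiv (1 - s) = neg_logderiv s"
proof -
  have "((\<lambda>s. zeta_chi s * zeta_chi (1 - s)) has_field_derivative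
     (- zeta_chi s * neg_logderiv s) * zeta_chi (1 - s) + (- zeta_chi (1 - s) * neg_logderiv (1 - s) * (-1)) * zeta_chi s) (at s)"
    using s
    by (intro DERIV_mult has_field_derivative_zeta_chi DERIV_chain2[where f = zeta_chi and g = "\<lambda>s. 1 - s"])
       (auto intro!: derivative_eq_intros)
  moreover have "((\<lambda>s. zeta_chi s * zeta_chi (1 - s)) has_field_derivative 0) (at s)"
  proof (rule has_field_derivative_transform_within_open[where f = "\<lambda>_. 1" and S = "- {s. Im s = 0}"])
    show "open (- {s. Im s = 0})" by (rule open_nonreal)
  qed (use s zeta_chi_mult_reflect in auto)
  ultimately have "(- zeta_chi s * neg_logderiv s) * zeta_chi (1 - s) + (- zeta_chi (1 - s) * neg_logderiv (1 - s) * (-1)) * zeta_chi s = 0"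
    by (rule DERIV_unique)
  hence "(zeta_chi s * zeta_chi (1 - s)) * (neg_logderiv (1 - s) - neg_logderiv s) = 0"
    by (simp add: algebra_simps)
  thus ?thesis using zeta_chi_mult_reflect[OF s] by simp
qed

lemma neg_logderiv_cnj:
  assumes s: "Im s \<noteq> 0"
  shows "neg_logderiv (cnj s) = cnj (neg_logderiv s)"
proof -
  have "(zeta_chi has_field_derivative cnj (- zeta_chi s * neg_logderiv s)) (at (cnj s))"
    using has_field_derivative_cnj_cnj[of zeta_chi "- zeta_chi s * neg_logderiv s" "cnj s"] has_field_derivative_zeta_chi[OF s]
    by (simp add: zeta_chi_cnj o_def)
  moreover have "(zeta_chi has_field_derivative - zeta_chi (cnj s) * neg_logderiv (cnj s)) (at (cnj s))"
    using s by (intro has_field_derivative_zeta_chi) simp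
  ultimately have "cnj (- zeta_chi s * neg_logderiv s) = - zeta_chi (cnj s) * neg_logderiv (cnj s)"
    by (rule DERIV_unique)
  thus ?thesis using zeta_chi_nonzero[OF s] by (simp add: zeta_chi_cnj)
qed

lemma norm_cot_le_2:
  assumes "Im w \<ge> 1"
  shows "norm (cot w) \<le> 2"
proof -
  define b where "b = Im w"
  have b: "exp (2 * b) \<ge> 3" using exp_ge_add_one_self[of "2 * b"] assms unfolding b_def by linarith
  hence b': "3 * exp (-b) \<le> exp b" using exp_add[of "-b" "2*b"] by simp
  have n: "norm (exp (\<i> * w)) = exp (-b)" "norm (exp (- (\<i> * w))) = exp b"
    by (simp_all add: norm_exp_eq_Re b_def)
  have "norm (exp (\<i> * w) + exp (- (\<i> * w))) \<le> exp (-b) + exp b"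
    using norm_triangle_ineq[of "exp (\<i> * w)" "exp (- (\<i> * w))"] n by simp
  moreover have "norm (exp (\<i> * w) - exp (- (\<i> * w))) \<ge> exp b - exp (-b)"
    using norm_triangle_ineq2[of "exp (- (\<i> * w))" "exp (\<i> * w)"] n by (simp add: norm_minus_commute)
  ultimately have "norm (exp (\<i> * w) + exp (- (\<i> * w))) \<le> 2 * norm (exp (\<i> * w) - exp (- (\<i> * w)))"
    using b' by linarith
  moreover have "norm (cot w) = norm (exp (\<i> * w) + exp (- (\<i> * w))) / norm (exp (\<i> * w) - exp (- (\<i> * w)))"
    unfolding cot_conv_exp by (simp add: norm_divide norm_mult)
  moreover have "norm (exp (\<i> * w) - exp (- (\<i> * w))) > 0"
    using \<open>norm (exp (\<i> * w) - exp (- (\<i> * w))) \<ge> exp b - exp (-b)\<close> b' by (smt (verit) exp_gt_zero)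
  ultimately show ?thesis by (simp add: pos_divide_le_eq)
qed

text \<open>
  The digamma term gives \<open>log t\<close>; the cotangent is bounded away from the real axis.
\<close>
lemma neg_logderiv_asymptotic:
  obtains C where "C \<ge> 0" "\<And>s. \<bar>Re s\<bar> \<le> W \<Longrightarrow> Im s \<ge> 1 \<Longrightarrow> norm (neg_logderiv s - of_real (ln (Im s))) \<le> C"
proof
  define D where "D = 2 * (1 + ((\<bar>W\<bar> + 1) + 1)\<^sup>2) * (\<Sum>n. 1 / (real (Suc n))\<^sup>2)"
  define C where "C = D + (ln (\<bar>W\<bar> + 2) + pi) + ln (2 * pi) + pi"
  show b: "norm (neg_logderiv s - of_real (ln (Im s))) \<le> C" if s: "\<bar>Re s\<bar> \<le> W" "Im s \<ge> 1" for s
  proof -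
    define t where "t = Im s"
    have t: "t \<ge> 1" using s by (simp add: t_def)
    have "norm (Digamma (1 - s) - Ln (1 - s)) \<le> D"
      unfolding D_def by (rule norm_Digamma_minus_Ln_le) (use s in auto)
    moreover have "norm (Ln (1 - s) - of_real (ln t)) \<le> ln (\<bar>W\<bar> + 2) + pi"
    proof -
      have nz: "1 - s \<noteq> 0" using s by (auto simp: complex_eq_iff)
      have le: "t \<le> norm (1 - s)" using abs_Im_le_cmod[of "1 - s"] t by (simp add: t_def)
      have "norm (1 - s) \<le> \<bar>Re (1 - s)\<bar> + \<bar>Im (1 - s)\<bar>" by (rule cmod_le)
      also have "\<dots> \<le> (\<bar>W\<bar> + 1) * 1 + t" using s t by (simp add: t_def)
      also have "\<dots> \<le> (\<bar>W\<bar> + 1) * t + t" using t by (intro add_mono mult_left_mono) auto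
      also have "\<dots> = (\<bar>W\<bar> + 2) * t" by (simp add: algebra_simps)
      finally have "ln (norm (1 - s)) \<le> ln ((\<bar>W\<bar> + 2) * t)"
        using le t by (intro ln_mono) auto
      also have "\<dots> = ln (\<bar>W\<bar> + 2) + ln t" using t by (intro ln_mult_pos) auto
      finally have "\<bar>ln (norm (1 - s)) - ln t\<bar> \<le> ln (\<bar>W\<bar> + 2)"
        using ln_mono[OF le] t by auto
      moreover have "\<bar>Im (Ln (1 - s))\<bar> \<le> pi" using nz mpi_less_Im_Ln[OF nz] Im_Ln_le_pi[OF nz] by linarith
      moreover have "norm (Ln (1 - s) - of_real (ln t)) \<le> \<bar>Re (Ln (1 - s) - of_real (ln t))\<bar> + \<bar>Im (Ln (1 - s) - of_real (ln t))\<bar>"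
        by (rule cmod_le)
      ultimately show ?thesis using nz by simp
    qed
    moreover have "norm (of_real (pi / 2) * cot (of_real pi * s / 2)) \<le> pi"
    proof -
      have "Im (of_real pi * s / 2) = pi * t / 2" by (simp add: t_def)
      moreover have "pi * t \<ge> pi" using t by simp
      ultimately have "norm (cot (of_real pi * s / 2)) \<le> 2" using pi_gt3 by (intro norm_cot_le_2) linarith
      thus ?thesis unfolding norm_mult by simp
    qed
    moreover have "norm (complex_of_real (ln (2 * pi))) = ln (2 * pi)" using pi_gt3 by simp
    moreover have "neg_logderiv s - of_real (ln t) = (Digamma (1 - s) - Ln (1 - s)) + (Ln (1 - s) - of_real (ln t))
         - of_real (ln (2 * pi)) - of_real (pi / 2) * cot (of_real pi * s / 2)"
      by (simp add: neg_logderiv_def)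
    ultimately show ?thesis unfolding t_def[symmetric] C_def
      by (smt (verit) norm_triangle_ineq norm_triangle_ineq4)
  qed
  show "C \<ge> 0"
  proof -
    have "D \<ge> 0" unfolding D_def
      by (intro mult_nonneg_nonneg suminf_nonneg summable_inverse_Suc_square) auto
    thus ?thesis unfolding C_def using pi_gt3 by (intro add_nonneg_nonneg) auto
  qed
qed

section \<open>Harnack inequalities and functions of fixed sign on half discs\<close>

text \<open>
  Schwarz's lemma for the Cayley transform \<open>(F - a) / (F + cnj a)\<close> with \<open>a = F z\<close>.
\<close>
lemma harnack_pos:
  fixes F :: "complex \<Rightarrow> complex"
  assumes F: "F holomorphic_on ball z R" and pos: "\<And>w. w \<in> ball z R \<Longrightarrow> Re (F w) > 0"
    and w: "w \<in> ball z R"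
  shows "(R + dist z w) * Re (F w) \<ge> (R - dist z w) * Re (F z)"
    and "(R - dist z w) * Re (F w) \<le> (R + dist z w) * Re (F z)"
proof -
  have R: "R > 0" using w zero_le_dist[of z w] unfolding mem_ball by linarith
  define a where "a = F z"
  have a: "Re a > 0" using pos R by (simp add: a_def)
  define \<phi> where "\<phi> = (\<lambda>u. (F (z + of_real R * u) - a) / (F (z + of_real R * u) + cnj a))"
  have b: "z + of_real R * u \<in> ball z R" if "norm u < 1" for u
    using that R by (simp add: dist_norm norm_mult)
  have nz: "F (z + of_real R * u) + cnj a \<noteq> 0" if "norm u < 1" for u
  proof
    assume "F (z + of_real R * u) + cnj a = 0"
    hence "Re (F (z + of_real R * u)) + Re a = 0" by (metis plus_complex.sel(1) cnj.sel(1) zero_complex.sel(1))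
    thus False using pos[OF b[OF that]] a by simp
  qed
  have "(F \<circ> (\<lambda>u. z + of_real R * u)) holomorphic_on ball 0 1"
    by (rule holomorphic_on_compose_gen[OF _ F]) (use b in \<open>auto intro!: holomorphic_intros\<close>)
  hence "\<phi> holomorphic_on ball 0 1"
    unfolding \<phi>_def o_def using nz by (intro holomorphic_intros) auto
  moreover have "norm (\<phi> u) < 1" if "norm u < 1" for u
  proof -
    have "Re (F (z + of_real R * u)) * Re a > 0" using a pos[OF b[OF that]] by simp
    hence "(norm (F (z + of_real R * u) - a))\<^sup>2 < (norm (F (z + of_real R * u) + cnj a))\<^sup>2"
      unfolding cmod_power2 by (simp add: algebra_simps power2_eq_square)
    hence "norm (F (z + of_real R * u) - a) < norm (F (z + of_real R * u) + cnj a)"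
      by (rule power2_less_imp_less) simp
    thus ?thesis using nz[OF that] by (simp add: \<phi>_def norm_divide)
  qed
  moreover have "\<phi> 0 = 0" by (simp add: \<phi>_def a_def)
  ultimately have S: "norm (\<phi> u) \<le> norm u" if "norm u < 1" for u
    using Schwarz_Lemma(1)[of \<phi> u] that by blast
  define u where "u = (w - z) / of_real R"
  define \<rho> where "\<rho> = norm u"
  have \<rho>: "\<rho> = dist z w / R" "0 \<le> \<rho>" "\<rho> < 1"
    using w R by (simp_all add: \<rho>_def u_def norm_divide dist_norm norm_minus_commute)
  have wu: "z + of_real R * u = w" using R by (simp add: u_def)
  define X where "X = Re (F w)"
  define Y where "Y = Im (F w) - Im a"
  have X: "X > 0" using pos[OF w] by (simp add: X_def)
  have "norm (F w - a) \<le> \<rho> * norm (F w + cnj a)"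
    using S[of u] nz[of u] \<rho> unfolding \<phi>_def wu by (simp add: norm_divide \<rho>_def[symmetric] field_simps)
  hence "(norm (F w - a))\<^sup>2 \<le> (\<rho> * norm (F w + cnj a))\<^sup>2"
    by (rule power_mono) simp
  hence "(X - Re a)\<^sup>2 + Y\<^sup>2 \<le> \<rho>\<^sup>2 * ((X + Re a)\<^sup>2 + Y\<^sup>2)"
    unfolding power_mult_distrib cmod_power2 by (simp add: X_def Y_def)
  moreover have "\<rho>\<^sup>2 * Y\<^sup>2 \<le> Y\<^sup>2"
    using \<rho> by (simp add: mult_left_le_one_le power_le_one)
  moreover have "\<rho>\<^sup>2 * ((X + Re a)\<^sup>2 + Y\<^sup>2) = \<rho>\<^sup>2 * (X + Re a)\<^sup>2 + \<rho>\<^sup>2 * Y\<^sup>2"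
    by (rule distrib_left)
  ultimately have "(X - Re a)\<^sup>2 \<le> \<rho>\<^sup>2 * (X + Re a)\<^sup>2" by linarith
  hence "\<bar>X - Re a\<bar> \<le> \<bar>\<rho> * (X + Re a)\<bar>"
    by (simp only: abs_le_square_iff power_mult_distrib)
  hence "\<bar>X - Re a\<bar> \<le> \<rho> * (X + Re a)"
    using X a \<rho>(2) by (simp only: abs_mult abs_of_nonneg add_pos_pos less_imp_le)
  hence "R * \<bar>X - Re a\<bar> \<le> R * (\<rho> * (X + Re a))"
    using R by simp
  also have "\<dots> = dist z w * (X + Re a)" using R \<rho>(1) by simp
  finally have *: "R * \<bar>X - Re a\<bar> \<le> dist z w * (X + Re a)" .
  have "R * (X - Re a) \<le> R * \<bar>X - Re a\<bar>" "R * (Re a - X) \<le> R * \<bar>X - Re a\<bar>"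
    using R by (auto intro!: mult_left_mono)
  with * have *: "R * (X - Re a) \<le> dist z w * (X + Re a)" "R * (Re a - X) \<le> dist z w * (X + Re a)"
    by linarith+
  show "(R + dist z w) * Re (F w) \<ge> (R - dist z w) * Re (F z)"
    using *(2) by (simp add: X_def a_def algebra_simps)
  show "(R - dist z w) * Re (F w) \<le> (R + dist z w) * Re (F z)"
    using *(1) by (simp add: X_def a_def algebra_simps)
qed

lemma harnack:
  fixes F :: "complex \<Rightarrow> complex"
  assumes F: "F holomorphic_on ball z R" and pos: "\<And>w. w \<in> ball z R \<Longrightarrow> Re (F w) \<ge> -c"
    and w: "w \<in> ball z R"
  shows "(R + dist z w) * (Re (F w) + c) \<ge> (R - dist z w) * (Re (F z) + c)" (is ?A)
    and "(R - dist z w) * (Re (F w) + c) \<le> (R + dist z w) * (Re (F z) + c)" (is ?B)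
proof -
  have h: "(R + dist z w) * (Re (F w) + (c + e)) \<ge> (R - dist z w) * (Re (F z) + (c + e)) \<and>
       (R - dist z w) * (Re (F w) + (c + e)) \<le> (R + dist z w) * (Re (F z) + (c + e))" if "e > 0" for e
  proof -
    have "(\<lambda>w. F w + of_real (c + e)) holomorphic_on ball z R"
      using F by (intro holomorphic_intros)
    moreover have "Re (F w + of_real (c + e)) > 0" if "w \<in> ball z R" for w
      using pos[OF that] \<open>e > 0\<close> by simp
    ultimately show ?thesis using harnack_pos[of "\<lambda>w. F w + of_real (c + e)" z R w] w by simp
  qed
  have lim: "((\<lambda>e. p * (q + (c + e))) \<longlongrightarrow> p * (q + (c + 0))) (at_right 0)" for p q :: real
    by (intro tendsto_intros)
  have ev: "\<forall>\<^sub>F e in at_right 0. e > (0::real)" by (rule eventually_at_right_less)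
  have "\<forall>\<^sub>F e in at_right 0. (R - dist z w) * (Re (F z) + (c + e)) \<le> (R + dist z w) * (Re (F w) + (c + e))"
    using ev by eventually_elim (use h in auto)
  from tendsto_le[OF trivial_limit_at_right_real lim lim this] show ?A by simp
  have "\<forall>\<^sub>F e in at_right 0. (R - dist z w) * (Re (F w) + (c + e)) \<le> (R + dist z w) * (Re (F z) + (c + e))"
    using ev by eventually_elim (use h in auto)
  from tendsto_le[OF trivial_limit_at_right_real lim lim this] show ?B by simp
qed

text \<open>
  On the circle \<open>|v| = R\<close> the factor \<open>(R\<^sup>2 + v\<^sup>2) / (R\<^sup>2 v)\<close> is the real number \<open>2 Re v / R\<^sup>2\<close>. It has the
  sign of \<open>Re v\<close>, hence, up to \<open>\<eta>\<close>, that of \<open>Re G\<close>, so the product has nonnegative real part on the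
  circle and therefore inside. This is Rogosinski's device for typically real functions. The simple
  zero of \<open>G\<close> at \<open>0\<close> cancels the pole.
\<close>
lemma odd_sign_transform:
  fixes G :: "complex \<Rightarrow> complex"
  assumes R: "R > 0" and G: "G holomorphic_on ball 0 R" "G 0 = 0" and \<eta>: "\<eta> \<ge> 0"
    and right: "\<And>v. v \<in> ball 0 R \<Longrightarrow> Re v > 0 \<Longrightarrow> Re (G v) \<ge> -\<eta>"
    and left: "\<And>v. v \<in> ball 0 R \<Longrightarrow> Re v < 0 \<Longrightarrow> Re (G v) \<le> \<eta>"
  shows "\<exists>H. H holomorphic_on ball 0 R \<and> H 0 = deriv G 0 \<and>
    (\<forall>v\<in>ball 0 R. v \<noteq> 0 \<longrightarrow> H v = (of_real (R\<^sup>2) + v\<^sup>2) / (of_real (R\<^sup>2) * v) * G v) \<and>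
    (\<forall>v\<in>ball 0 R. Re (H v) \<ge> - (2 * \<eta> / R))"
proof -
  define g where "g = (\<lambda>v. if v = 0 then deriv G 0 else G v / v)"
  have g: "g holomorphic_on ball 0 R"
    by (rule pole_theorem_0[OF G(1), of 0]) (use R G in \<open>auto simp: g_def\<close>)
  define h where "h = (\<lambda>r v. (of_real (r\<^sup>2) + v\<^sup>2) / of_real (r\<^sup>2) * g v)"
  have hol: "h r holomorphic_on ball 0 R" for r
    unfolding h_def using g by (cases "r = 0") (auto intro!: holomorphic_intros)
  have low: "Re (h r v) \<ge> - (2 * \<eta> / r)" if r: "0 < r" "r < R" and v: "norm v < r" for r v
  proof -
    have sub: "cball 0 r \<subseteq> ball (0::complex) R" using r by auto
    have "Re (- h r v) \<le> 2 * \<eta> / r"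
    proof (rule maximum_real_frontier[where S = "ball 0 r" and f = "\<lambda>v. - h r v"])
      show "(\<lambda>v. - h r v) holomorphic_on interior (ball 0 r)"
        by (intro holomorphic_intros holomorphic_on_subset[OF hol]) (use r in auto)
      have "(\<lambda>v. - h r v) holomorphic_on cball 0 r"
        by (intro holomorphic_intros holomorphic_on_subset[OF hol] sub)
      thus "continuous_on (closure (ball 0 r)) (\<lambda>v. - h r v)"
        using r by (auto dest: holomorphic_on_imp_continuous_on)
      fix z :: complex assume "z \<in> frontier (ball 0 r)"
      hence z: "norm z = r" using r by simp
      hence z0: "z \<noteq> 0" "z \<in> ball 0 R" using r by auto
      have "of_real (r\<^sup>2) = z * cnj z" using z by (metis complex_norm_square of_real_power)
      hence "(of_real (r\<^sup>2) + z\<^sup>2) / of_real (r\<^sup>2) * g z = (cnj z + z) / of_real (r\<^sup>2) * G z"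
        using z0 by (simp add: g_def power2_eq_square divide_simps) (simp add: algebra_simps)
      also have "cnj z + z = of_real (2 * Re z)" by (simp add: complex_eq_iff)
      finally have "h r z = of_real (2 * Re z / r\<^sup>2) * G z" by (simp add: h_def)
      hence "Re (h r z) = 2 * Re z / r\<^sup>2 * Re (G z)" by simp
      moreover have "\<bar>Re z\<bar> \<le> r" using abs_Re_le_cmod[of z] z by simp
      moreover have "Re z * Re (G z) \<ge> - (\<bar>Re z\<bar> * \<eta>)"
      proof (cases "Re z" "0 :: real" rule: linorder_cases)
        case greater
        thus ?thesis using right[OF z0(2)] mult_left_mono[of "-\<eta>" "Re (G z)" "Re z"] by simp
      next
        case less
        thus ?thesis using left[OF z0(2)] mult_left_mono_neg[of "Re (G z)" "\<eta>" "Re z"] by simp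
      qed simp
      ultimately have "Re z * Re (G z) \<ge> - (r * \<eta>)"
        using \<eta> mult_right_mono[of "\<bar>Re z\<bar>" r \<eta>] by linarith
      hence "2 / r\<^sup>2 * (Re z * Re (G z)) \<ge> 2 / r\<^sup>2 * (- (r * \<eta>))"
        by (rule mult_left_mono) simp
      moreover have "Re (h r z) = 2 / r\<^sup>2 * (Re z * Re (G z))" unfolding \<open>Re (h r z) = _\<close> by simp
      moreover have "2 / r\<^sup>2 * (- (r * \<eta>)) = - (2 * \<eta> / r)" using r by (simp add: power2_eq_square)
      ultimately show "Re (- h r z) \<le> 2 * \<eta> / r" by simp
    qed (use v in auto)
    thus ?thesis by simp
  qed
  have "Re (h R v) \<ge> - (2 * \<eta> / R)" if v: "v \<in> ball 0 R" for v
  proof -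
    have "((\<lambda>r. Re (h r v)) \<longlongrightarrow> Re (h R v)) (at_left R)"
      unfolding h_def using R by (intro tendsto_intros) auto
    moreover have "((\<lambda>r. - (2 * \<eta> / r)) \<longlongrightarrow> - (2 * \<eta> / R)) (at_left R)"
      using R by (intro tendsto_intros) auto
    moreover have "\<forall>\<^sub>F r in at_left R. norm v < r \<and> r < R"
      using v by (auto intro!: eventually_at_leftI[of "norm v"])
    hence "\<forall>\<^sub>F r in at_left R. - (2 * \<eta> / r) \<le> Re (h r v)"
    proof (rule eventually_mono)
      fix r assume r: "norm v < r \<and> r < R"
      have "0 < r" using r norm_ge_zero[of v] by linarith
      thus "- (2 * \<eta> / r) \<le> Re (h r v)" using r by (intro low) auto
    qed
    ultimately show "Re (h R v) \<ge> - (2 * \<eta> / R)"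
      by (rule tendsto_le[OF trivial_limit_at_left_real])
  qed
  moreover have "h R 0 = deriv G 0" using R by (simp add: h_def g_def)
  moreover have "h R v = (of_real (R\<^sup>2) + v\<^sup>2) / (of_real (R\<^sup>2) * v) * G v" if "v \<noteq> 0" for v
    using that by (simp add: h_def g_def)
  ultimately show ?thesis using hol[of R] by blast
qed

text \<open>
  Harnack's inequality for the transformed function: a function whose real part changes sign exactly
  along the vertical diameter cannot be flatter than linear. The first bound starts from the derivative
  at the centre, the second one from the value at a point \<open>x\<close> close to the centre.
\<close>
lemma odd_sign_growth:
  fixes G :: "complex \<Rightarrow> complex"
  assumes R: "R > 0" and G: "G holomorphic_on ball 0 R" "G 0 = 0" and \<eta>: "\<eta> \<ge> 0"
    and right: "\<And>v. v \<in> ball 0 R \<Longrightarrow> Re v > 0 \<Longrightarrow> Re (G v) \<ge> -\<eta>"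
    and left: "\<And>v. v \<in> ball 0 R \<Longrightarrow> Re v < 0 \<Longrightarrow> Re (G v) \<le> \<eta>"
  shows "Re (G (of_real (R/2))) \<ge> 2 * R / 15 * Re (deriv G 0) - \<eta>"
    and "0 < x \<Longrightarrow> x \<le> R/2 \<Longrightarrow> Re (G (of_real x)) \<ge> 0 \<Longrightarrow>
       Re (G (of_real (R/2))) \<ge> 2 * R / (45 * x) * Re (G (of_real x)) - \<eta>"
proof -
  obtain H where H: "H holomorphic_on ball 0 R" "H 0 = deriv G 0"
    "\<And>v. v \<in> ball 0 R \<Longrightarrow> v \<noteq> 0 \<Longrightarrow> H v = (of_real (R\<^sup>2) + v\<^sup>2) / (of_real (R\<^sup>2) * v) * G v"
    "\<And>v. v \<in> ball 0 R \<Longrightarrow> Re (H v) \<ge> - (2 * \<eta> / R)"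
    using odd_sign_transform[OF R G \<eta> right left] by blast
  have HG: "Re (H (of_real x)) = (R\<^sup>2 + x\<^sup>2) / (R\<^sup>2 * x) * Re (G (of_real x))" if "0 < x" "x < R" for x
    using H(3)[of "of_real x"] that
    by (simp flip: of_real_power of_real_add of_real_mult of_real_divide)
  have half: "Re (H (of_real (R/2))) = 5 / (2 * R) * Re (G (of_real (R/2)))"
    using R by (subst HG) (auto simp: power2_eq_square divide_simps)
  define e where "e = 2 * \<eta> / R"
  have e: "R * e = 2 * \<eta>" using R by (simp add: e_def)
  define h0 hR gR where "h0 = Re (H 0)" and "hR = Re (H (of_real (R/2)))" and "gR = Re (G (of_real (R/2)))"
  have gR: "gR = 2 * R / 5 * hR" unfolding hR_def half gR_def using R by simp
  have "(R + dist 0 (complex_of_real (R/2))) * (hR + e) \<ge> (R - dist 0 (complex_of_real (R/2))) * (h0 + e)"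
    unfolding hR_def h0_def by (rule harnack(1)[OF H(1)]) (use R H(4) in \<open>auto simp: e_def\<close>)
  moreover have "R + dist 0 (complex_of_real (R/2)) = R / 2 * 3" "R - dist 0 (complex_of_real (R/2)) = R / 2"
    using R by simp_all
  ultimately have "R / 2 * (h0 + e) \<le> R / 2 * (3 * (hR + e))" by (simp only: mult.assoc)
  hence 1: "h0 + e \<le> 3 * (hR + e)" using R by simp
  have "2 * R / 5 * (h0 / 3 - 2 * e / 3) \<le> gR"
    unfolding gR by (rule mult_left_mono) (use 1 R in auto)
  moreover have "2 * R / 5 * (h0 / 3 - 2 * e / 3) = 2 * R / 15 * h0 - 4 / 15 * (R * e)"
    by (simp add: algebra_simps)
  ultimately have "gR \<ge> 2 * R / 15 * h0 - \<eta>" using e \<eta> by linarith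
  thus "Re (G (of_real (R/2))) \<ge> 2 * R / 15 * Re (deriv G 0) - \<eta>"
    by (simp only: gR_def h0_def H(2))
  assume x: "0 < x" "x \<le> R/2" and Gx: "Re (G (of_real x)) \<ge> 0"
  define hx gx where "hx = Re (H (of_real x))" and "gx = Re (G (of_real x))"
  have "(R - dist 0 (complex_of_real x)) * (hx + e) \<le> (R + dist 0 (complex_of_real x)) * (h0 + e)"
    unfolding hx_def h0_def by (rule harnack(2)[OF H(1)]) (use x H(4) in \<open>auto simp: e_def\<close>)
  hence le: "(R - x) * (hx + e) \<le> (R + x) * (h0 + e)"
    using x by simp
  have p: "hx + e \<ge> 0" "h0 + e \<ge> 0"
    using H(4)[of "of_real x"] H(4)[of 0] x R by (auto simp: hx_def h0_def e_def)
  have "(R/2) * (hx + e) \<le> (R - x) * (hx + e)"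
    using x p by (intro mult_right_mono) auto
  also note le
  also have "(R + x) * (h0 + e) \<le> (3*R/2) * (h0 + e)"
    using x p by (intro mult_right_mono) auto
  also have "3 * R / 2 * (h0 + e) = R / 2 * (3 * (h0 + e))" by simp
  finally have "R / 2 * (hx + e) \<le> R / 2 * (3 * (h0 + e))" .
  hence 2: "hx + e \<le> 3 * (h0 + e)" using R by simp
  have 3: "1 / x * gx \<le> hx"
    unfolding hx_def gx_def
  proof (subst HG)
    have "1 / x \<le> (R\<^sup>2 + x\<^sup>2) / (R\<^sup>2 * x)" using x R by (simp add: divide_simps)
    thus "1 / x * Re (G (of_real x)) \<le> (R\<^sup>2 + x\<^sup>2) / (R\<^sup>2 * x) * Re (G (of_real x))"
      using Gx by (rule mult_right_mono)
  qed (use x in auto)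
  have "hx - 8 * e \<le> 9 * hR" using 1 2 by (simp add: algebra_simps)
  hence 4: "hx / 9 - 8 * e / 9 \<le> hR" by (simp add: field_simps)
  have "2 * R / 5 * (hx / 9 - 8 * e / 9) \<le> gR"
    unfolding gR by (rule mult_left_mono[OF 4]) (use R in simp)
  moreover have "2 * R / 45 * (1 / x * gx) \<le> 2 * R / 45 * hx"
    by (rule mult_left_mono[OF 3]) (use R in simp)
  moreover have "2 * R / 5 * (hx / 9 - 8 * e / 9) = 2 * R / 45 * hx - 16 / 45 * (R * e)"
    by (simp add: algebra_simps)
  moreover have "2 * R / 45 * (1 / x * gx) = 2 * R / (45 * x) * gx" by simp
  ultimately have "gR \<ge> 2 * R / (45 * x) * gx - \<eta>" using e \<eta> by linarith
  thus "Re (G (of_real (R/2))) \<ge> 2 * R / (45 * x) * Re (G (of_real x)) - \<eta>"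
    by (simp only: gR_def gx_def)
qed

section \<open>Elementary bounds for zeta\<close>

text \<open>
  The terms of the series from \<open>n = 2\<close> on are dominated by half of the telescoping series of
  \<open>1 / (n (n - 1))\<close>.
\<close>
lemma norm_zeta_minus_1_le:
  assumes s: "Re s \<ge> 3"
  shows "norm (zeta s - 1) \<le> 1 / 2"
proof -
  define f where "f = (\<lambda>n. 1 / of_nat (Suc n) powr s)"
  have "f sums zeta s" unfolding f_def using sums_zeta_series[of s] s by (simp add: zeta_eq_series)
  hence "(\<lambda>n. f (Suc n)) sums (zeta s - f 0)" by (simp add: sums_Suc_iff)
  hence "(\<lambda>n. f (Suc n)) sums (zeta s - 1)" by (simp add: f_def)
  moreover have "(\<lambda>n. 1 / 2 * (1 / real (Suc n) - 1 / real (Suc (Suc n)))) sums (1 / 2 * (1 / real (Suc 0) - 0))"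
    by (intro sums_mult telescope_sums') (use LIMSEQ_Suc[OF lim_1_over_n] in simp)
  moreover have "norm (f (Suc n)) \<le> 1 / 2 * (1 / real (Suc n) - 1 / real (Suc (Suc n)))" for n
  proof -
    define m where "m = real (Suc n)"
    have m: "m \<ge> 1" "real (Suc (Suc n)) = m + 1" by (simp_all add: m_def)
    have "norm (f (Suc n)) = 1 / (m + 1) powr Re s"
      unfolding f_def norm_divide m(2)[symmetric] by (subst norm_powr_real_powr) auto
    also have "\<dots> \<le> 1 / (m + 1) powr 3"
      using s m by (intro divide_left_mono powr_mono mult_pos_pos) auto
    also have "(m + 1) powr 3 = (m + 1) ^ 3" using m by (simp add: powr_numeral)
    also have "1 / (m + 1) ^ 3 \<le> 1 / (2 * (m * (m + 1)))"
    proof (rule divide_left_mono)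
      have "2 * m \<le> (m + 1)\<^sup>2" by (simp add: power2_eq_square algebra_simps)
      hence "2 * m * (m + 1) \<le> (m + 1)\<^sup>2 * (m + 1)" using m by (intro mult_right_mono) auto
      thus "2 * (m * (m + 1)) \<le> (m + 1) ^ 3" by (simp add: power2_eq_square power3_eq_cube mult_ac)
    qed (use m in auto)
    also have "\<dots> = 1 / 2 * (1 / m - 1 / (m + 1))" using m by (simp add: field_simps)
    finally show ?thesis unfolding m(2) m_def[symmetric] .
  qed
  ultimately have "norm (zeta s - 1) \<le> 1 / 2 * (1 / real (Suc 0) - 0)" by (rule norm_sums_le)
  thus ?thesis by simp
qed

lemma norm_zeta_bounds:
  assumes "Re s \<ge> 3"
  shows "norm (zeta s) \<ge> 1 / 2" "norm (zeta s) \<le> 3 / 2"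
  using norm_zeta_minus_1_le[OF assms] norm_triangle_ineq2[of 1 "zeta s"] norm_triangle_ineq2[of "zeta s" 1]
  by (simp_all add: norm_minus_commute)

lemma norm_deriv_zeta_le:
  assumes s: "Re s \<ge> 4"
  shows "norm (deriv zeta s) \<le> 3 / 2"
proof -
  have re: "Re x \<ge> 3" if "x \<in> cball s 1" for x
    using that s abs_Re_le_cmod[of "s - x"] by (auto simp: dist_norm)
  have "1 \<notin> cball s 1" using re[of 1] by auto
  hence hol: "zeta holomorphic_on cball s 1" by (rule zeta_holomorphic_on)
  have "norm ((deriv ^^ 1) zeta s) \<le> fact 1 * (3/2) / 1 ^ 1"
  proof (rule Cauchy_inequality)
    show "zeta holomorphic_on ball s 1" by (rule holomorphic_on_subset[OF hol]) auto
    show "continuous_on (cball s 1) zeta" using hol by (rule holomorphic_on_imp_continuous_on)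
    show "norm (zeta x) \<le> 3/2" if "norm (s - x) = 1" for x
      using re[of x] that by (intro norm_zeta_bounds) (auto simp: dist_norm)
  qed auto
  thus ?thesis by simp
qed

lemma norm_zeta_logderiv_le:
  assumes s: "Re s \<ge> 4"
  shows "norm (deriv zeta s / zeta s) \<le> 3"
proof -
  have "norm (deriv zeta s / zeta s) = norm (deriv zeta s) / norm (zeta s)" by (rule norm_divide)
  also have "\<dots> \<le> (3/2) / (1/2)"
    using norm_deriv_zeta_le[OF s] norm_zeta_bounds(1)[of s] s by (intro frac_le) auto
  finally show ?thesis by simp
qed

text \<open>
  A sieve in place of the Euler product. Removing the multiples of a prime \<open>k\<close> from the summation range
  multiplies the sum by \<open>1 - f k\<close>; so if the full sum is \<open>0\<close>, all sifted sums are \<open>0\<close>. But the sum over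
  the numbers without prime factors below \<open>k\<close> tends to the term at \<open>n = 1\<close>, which is \<open>1\<close>.
\<close>
lemma zeta_nonzero_Re_gt_1:
  assumes s: "Re s > 1"
  shows "zeta s \<noteq> 0"
proof
  assume z: "zeta s = 0"
  define f where "f = (\<lambda>n::nat. 1 / of_nat n powr s)"
  have f_mult: "f (m * n) = f m * f n" for m n
    unfolding f_def by (cases "m = 0 \<or> n = 0") (auto simp: powr_times_real)
  have nf: "norm (f n) = real n powr (- Re s)" for n
    unfolding f_def norm_divide by (cases "n = 0") (auto simp: norm_powr_real_powr powr_minus_divide)
  have summ: "summable (\<lambda>n. norm (f n))"
    unfolding nf using s by (simp add: summable_real_powr_iff)
  hence "(\<lambda>n. norm (f n)) summable_on UNIV"
    by (intro norm_summable_imp_summable_on) simp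
  hence abs: "(\<lambda>n. norm (f n)) summable_on A" for A
    by (rule summable_on_subset_banach) auto
  hence sf: "f summable_on A" for A by (rule abs_summable_summable)
  have "f sums zeta_series s"
    using sums_zeta_series[OF s] sums_Suc_iff[of f "zeta_series s"] by (simp add: f_def)
  hence total: "infsum f UNIV = 0"
    using norm_summable_imp_has_sum[OF summ] z zeta_eq_series[OF s] by (simp add: infsumI)
  \<comment> \<open>The numbers without prime factors below \<open>k\<close>.\<close>
  define A where "A = (\<lambda>k. {n::nat. n > 0 \<and> (\<forall>p<k. prime p \<longrightarrow> \<not> p dvd n)})"
  have A0: "infsum f (A k) = 0" for k
  proof (induction k)
    case 0
    have "infsum f (A 0) = infsum f UNIV"
      by (rule infsum_cong_neutral) (auto simp: A_def f_def)
    thus ?case using total by simp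
  next
    case (Suc k)
    show ?case
    proof (cases "prime k")
      case False
      hence "A (Suc k) = A k" by (auto simp: A_def less_Suc_eq)
      thus ?thesis using Suc by simp
    next
      case True
      have k0: "k > 0" using True by (simp add: prime_gt_0_nat)
      have "A k = A (Suc k) \<union> (\<lambda>n. k * n) ` A k"
      proof (intro equalityI subsetI)
        fix n assume n: "n \<in> A k"
        show "n \<in> A (Suc k) \<union> (\<lambda>n. k * n) ` A k"
        proof (cases "k dvd n")
          case True
          then obtain m where m: "n = k * m" by (elim dvdE)
          hence "m \<in> A k" using n by (auto simp: A_def)
          thus ?thesis using m by blast
        qed (use n in \<open>auto simp: A_def less_Suc_eq\<close>)
      next
        fix n assume "n \<in> A (Suc k) \<union> (\<lambda>n. k * n) ` A k"
        thus "n \<in> A k"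
        proof
          assume "n \<in> (\<lambda>n. k * n) ` A k"
          then obtain m where m: "n = k * m" "m \<in> A k" by blast
          have "\<not> p dvd k" if "prime p" "p < k" for p
            using that True by (metis primes_dvd_imp_eq less_irrefl)
          thus "n \<in> A k" using m k0 by (auto simp: A_def prime_dvd_mult_iff)
        qed (auto simp: A_def)
      qed
      hence "infsum f (A k) = infsum f (A (Suc k) \<union> (\<lambda>n. k * n) ` A k)" by simp
      also have "\<dots> = infsum f (A (Suc k)) + infsum f ((\<lambda>n. k * n) ` A k)"
        by (intro infsum_Un_disjoint sf) (use True in \<open>auto simp: A_def\<close>)
      also have "infsum f ((\<lambda>n. k * n) ` A k) = infsum (f \<circ> (\<lambda>n. k * n)) (A k)"
        by (rule infsum_reindex) (use k0 in \<open>auto simp: inj_on_def\<close>)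
      also have "f \<circ> (\<lambda>n. k * n) = (\<lambda>n. f k * f n)" by (auto simp: f_mult)
      also have "infsum (\<lambda>n. f k * f n) (A k) = f k * infsum f (A k)"
        by (intro infsum_cmult_right sf)
      finally show ?thesis using Suc by simp
    qed
  qed
  obtain N where N: "\<And>n. n \<ge> N \<Longrightarrow> norm (\<Sum>i. norm (f (i + n))) < 1"
    using suminf_exist_split[OF _ summ, of 1] by auto
  define k where "k = N + 2"
  have dec: "A k = {1} \<union> (A k \<inter> {k..})"
  proof (intro equalityI subsetI)
    fix n assume n: "n \<in> A k"
    show "n \<in> {1} \<union> (A k \<inter> {k..})"
    proof (cases "n = 1")
      case False
      then obtain p where p: "prime p" "p dvd n" using prime_factor_nat by blast
      moreover have "n > 0" using n by (simp add: A_def)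
      ultimately have "p \<le> n" "p \<ge> k" using n by (auto simp: A_def dvd_imp_le not_less)
      thus ?thesis using n by simp
    qed simp
  qed (auto simp: A_def k_def)
  have "infsum f (A k) = infsum f {1} + infsum f (A k \<inter> {k..})"
    by (subst dec) (intro infsum_Un_disjoint sf, auto simp: k_def)
  also have "infsum f {1} = 1" by (simp add: f_def)
  finally have "infsum f (A k \<inter> {k..}) = - 1"
    using A0[of k] by (simp add: add_eq_0_iff)
  hence n1: "norm (infsum f (A k \<inter> {k..})) = 1" by simp
  have "norm (infsum f (A k \<inter> {k..})) \<le> infsum (\<lambda>n. norm (f n)) (A k \<inter> {k..})"
    by (rule norm_infsum_bound[OF abs])
  also have "\<dots> \<le> infsum (\<lambda>n. norm (f n)) {k..}"
    by (rule infsum_mono2) (use abs in auto)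
  also have "infsum (\<lambda>n. norm (f n)) {k..} = infsum (\<lambda>n. norm (f n)) ((\<lambda>i. i + k) ` UNIV)"
    by (rule arg_cong[where f = "infsum (\<lambda>n. norm (f n))"])
       (auto simp: image_iff add.commute dest: le_Suc_ex)
  also have "infsum (\<lambda>n. norm (f n)) ((\<lambda>i. i + k) ` UNIV) = infsum (\<lambda>i. norm (f (i + k))) UNIV"
    by (subst infsum_reindex) (auto simp: o_def)
  also have "\<dots> = (\<Sum>i. norm (f (i + k)))"
  proof (rule infsumI, rule norm_summable_imp_has_sum)
    show "summable (\<lambda>i. norm (norm (f (i + k))))" using summable_ignore_initial_segment[OF summ, of k] by simp
    thus "(\<lambda>i. norm (f (i + k))) sums (\<Sum>i. norm (f (i + k)))" by (simp add: summable_sums)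
  qed
  also have "\<dots> < 1" using N[of k] by (simp add: k_def)
  finally show False using n1 by simp
qed

text \<open>
  A crude bound; it is sufficient because the Gaussian factor in \<open>zeta_ratio_bound\<close> absorbs any
  exponential.
\<close>
lemma zeta_exponential_growth:
  fixes \<sigma> W :: real
  assumes \<sigma>: "\<sigma> > 0" and W: "W \<ge> 0"
  obtains K where "K > 0" "\<And>s. \<sigma> \<le> Re s \<Longrightarrow> Re s \<le> W \<Longrightarrow> Im s \<ge> 1 \<Longrightarrow> norm (zeta s) \<le> exp (K * Im s)"
proof -
  define S where "S = (\<Sum>n. real (Suc n) powr (- \<sigma> - 1))"
  have summ: "summable (\<lambda>n. real (Suc n) powr (- \<sigma> - 1))"
    using summable_Suc_powr[of "- \<sigma> - 1" 1] \<sigma> by simp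
  have S: "S \<ge> 0" unfolding S_def by (intro suminf_nonneg summ) auto
  define K where "K = S + (3 * (W + 2) + 4)"
  have bound: "norm (zeta s) \<le> exp (K * Im s)" if s: "\<sigma> \<le> Re s" "Re s \<le> W" "Im s \<ge> 1" for s
  proof -
    define t where "t = Im s"
    have t: "t \<ge> 1" using s by (simp add: t_def)
    define R where "R = norm (1 - s)"
    define C where "C = (R + real (Suc 1)) ^ Suc 1 * 2 powr R"
    have R: "R \<ge> 1" using abs_Im_le_cmod[of "1 - s"] s by (simp add: R_def)
    have C0: "C \<ge> 0" using R by (simp add: C_def)
    have "R \<le> \<bar>Re (1 - s)\<bar> + \<bar>Im (1 - s)\<bar>" unfolding R_def by (rule cmod_le)
    also have "\<dots> \<le> (W + 1) * 1 + t" using s t \<sigma> W by (simp add: t_def)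
    also have "\<dots> \<le> (W + 1) * t + t" using t W by (intro add_mono mult_left_mono) auto
    finally have Rt: "R \<le> (W + 2) * t" by (simp add: algebra_simps)
    have "norm (remainder_sum 1 s) \<le> C * S"
      unfolding remainder_sum_def S_def
    proof (rule norm_sums_le)
      show "(\<lambda>n. remainder_term 1 n s) sums (\<Sum>n. remainder_term 1 n s)"
        by (intro summable_sums summable_remainder_term) (use s \<sigma> in auto)
      show "(\<lambda>n. C * real (Suc n) powr (- \<sigma> - 1)) sums (C * (\<Sum>n. real (Suc n) powr (- \<sigma> - 1)))"
        by (intro sums_mult summable_sums summ)
      show "norm (remainder_term 1 n s) \<le> C * real (Suc n) powr (- \<sigma> - 1)" for n
        using norm_remainder_term_le[of s R \<sigma> 1 n] s by (simp add: C_def R_def)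
    qed
    hence "norm (1 + remainder_sum 1 s) \<le> 1 + C * S"
      using norm_triangle_ineq[of 1 "remainder_sum 1 s"] by simp
    moreover have "(s - 1) * zeta s = 1 + remainder_sum 1 s"
      by (rule zeta_eq_remainder_sum_1) (use s \<sigma> in auto)
    hence "norm (1 + remainder_sum 1 s) = R * norm (zeta s)"
      by (metis norm_mult R_def norm_minus_commute)
    moreover have "norm (zeta s) * 1 \<le> norm (zeta s) * R" by (intro mult_left_mono R) auto
    ultimately have "norm (zeta s) \<le> 1 + C * S" by (simp add: mult.commute)
    also have "\<dots> \<le> exp (3 * R + 4) * (1 + S)"
    proof -
      have "R + 2 \<le> exp (R + 2)" using exp_ge_add_one_self[of "R + 2"] by linarith
      hence "(R + 2) ^ 2 \<le> exp (R + 2) ^ 2" using R by (intro power_mono) auto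
      moreover have "2 powr R \<le> exp R"
        using R exp_ge_add_one_self[of 1] by (simp add: powr_def ln_2_less_1 less_imp_le mult_left_le)
      ultimately have "C \<le> exp (R + 2) ^ 2 * exp R"
        unfolding C_def by (intro mult_mono) (use R in \<open>auto simp: numeral_2_eq_2\<close>)
      also have "\<dots> = exp (3 * R + 4)" by (simp add: power2_eq_square exp_add[symmetric])
      finally have "C * S \<le> exp (3 * R + 4) * S" using S by (rule mult_right_mono)
      moreover have "1 \<le> exp (3 * R + 4)" using R by simp
      ultimately have "1 + C * S \<le> exp (3 * R + 4) + exp (3 * R + 4) * S" by linarith
      thus ?thesis by (simp add: distrib_left)
    qed
    also have "\<dots> \<le> exp (3 * R + 4) * exp S" by (intro mult_left_mono) auto
    also have "\<dots> = exp (3 * R + 4 + S)" by (simp add: exp_add)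
    also have "\<dots> \<le> exp (K * t)"
    proof -
      have "4 + S \<le> (4 + S) * t" using mult_left_mono[of 1 t "4 + S"] t S by simp
      moreover have "3 * R \<le> 3 * ((W + 2) * t)" using Rt by simp
      ultimately show ?thesis by (simp add: K_def algebra_simps)
    qed
    finally show ?thesis by (simp add: t_def)
  qed
  have "K > 0" using S W by (simp add: K_def)
  thus ?thesis using bound that by blast
qed

section \<open>The logarithmic derivative to the right of the critical line\<close>

lemma zeta_has_field_derivative:
  "s \<noteq> 1 \<Longrightarrow> (zeta has_field_derivative deriv zeta s) (at s)"
  using zeta_holomorphic by (intro holomorphic_derivI[where S = "- {1}"]) auto

text \<open>
  The hypothesis speaks of the strip \<open>0 \<le> Re s \<le> 1\<close>; outside of it the series and the functional
  equation exclude nonreal zeros.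
\<close>
lemma riemann_hypothesis_zero_Re:
  assumes RH: "riemann_hypothesis" and s: "Im s \<noteq> 0" "zeta s = 0"
  shows "Re s = 1 / 2"
proof -
  have "Re s \<le> 1" using zeta_nonzero_Re_gt_1[of s] s by force
  moreover have "Re s \<ge> 0"
  proof (rule ccontr)
    assume "\<not> Re s \<ge> 0"
    hence "zeta (1 - s) \<noteq> 0" by (intro zeta_nonzero_Re_gt_1) auto
    thus False using zeta_functional_equation[OF s(1)] zeta_chi_nonzero[OF s(1)] s by simp
  qed
  moreover have "s \<noteq> 1" using s by auto
  ultimately show ?thesis using RH s unfolding riemann_hypothesis_def zeta_nontrivial_zeros_def by blast
qed

text \<open>
  Under the Riemann hypothesis \<open>zeta\<close> has a holomorphic logarithm in a disc that reaches almost to the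
  critical line. As \<open>log |zeta|\<close> is bounded above there and bounded below at the centre, Harnack's
  inequality bounds it below.
\<close>
lemma zeta_lower_bound:
  assumes RH: "riemann_hypothesis" and h: "h > 0" and W: "W \<ge> 0"
  obtains K where "K > 0" "\<And>s. 1 / 2 + h \<le> Re s \<Longrightarrow> Re s \<le> W \<Longrightarrow> Im s \<ge> W + 4 \<Longrightarrow> norm (zeta s) \<ge> exp (- (K * Im s))"
proof -
  define r where "r = W + 5 / 2 - h / 2"
  obtain K1 where K1: "K1 > 0" "\<And>s. 1 / 2 \<le> Re s \<Longrightarrow> Re s \<le> 2 * W + 6 \<Longrightarrow> Im s \<ge> 1 \<Longrightarrow> norm (zeta s) \<le> exp (K1 * Im s)"
  proof -
    have "(1/2::real) > 0" "2 * W + 6 \<ge> 0" using W by auto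
    from zeta_exponential_growth[OF this] that show ?thesis by blast
  qed
  define K where "K = 2 * (W + 3) / (h / 2) * (2 * K1 + 1)"
  have bound: "norm (zeta s) \<ge> exp (- (K * Im s))" if s: "1 / 2 + h \<le> Re s" "Re s \<le> W" "Im s \<ge> W + 4" for s
  proof -
    define t where "t = Im s"
    have t: "t \<ge> W + 4" "t \<ge> 1" using s W by (auto simp: t_def)
    have hr: "h / 2 < r" "r \<le> W + 3" using s h by (auto simp: r_def)
    \<comment> \<open>The centre lies where \<open>|zeta| \<ge> 1/2\<close>; the disc of radius \<open>r\<close> ends at distance \<open>h / 2\<close> from the critical line.\<close>
    define s0 where "s0 = Complex (W + 3) t"
    have ball: "1 / 2 < Re w \<and> Re w \<le> 2 * W + 6 \<and> 1 \<le> Im w \<and> Im w \<le> 2 * t" if "w \<in> ball s0 r" for w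
    proof -
      have "\<bar>Re w - (W + 3)\<bar> < r" "\<bar>Im w - t\<bar> < r"
        using that abs_Re_le_cmod[of "w - s0"] abs_Im_le_cmod[of "w - s0"]
        by (auto simp: s0_def dist_norm norm_minus_commute)
      thus ?thesis using t h by (auto simp: r_def)
    qed
    have nz: "zeta w \<noteq> 0" if "w \<in> ball s0 r" for w
      using riemann_hypothesis_zero_Re[OF RH, of w] ball[OF that] by force
    have "1 \<notin> ball s0 r" using ball[of 1] by auto
    hence "zeta holomorphic_on ball s0 r" by (rule zeta_holomorphic_on)
    then obtain g where g: "g holomorphic_on ball s0 r" "\<And>w. w \<in> ball s0 r \<Longrightarrow> exp (g w) = zeta w"
      using holomorphic_logarithm_exists[of "ball s0 r" zeta s0] nz hr h by auto
    have Reg: "Re (g w) = ln (norm (zeta w))" if "w \<in> ball s0 r" for w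
      using g(2)[OF that, symmetric] by (simp add: norm_exp_eq_Re)
    define F where "F = (\<lambda>w. of_real (2 * K1 * t) - g w)"
    have F: "F holomorphic_on ball s0 r" unfolding F_def by (intro holomorphic_intros g)
    have pos: "Re (F w) \<ge> - 0" if w: "w \<in> ball s0 r" for w
    proof -
      have "norm (zeta w) \<le> exp (K1 * Im w)" using ball[OF w] by (intro K1) auto
      also have "\<dots> \<le> exp (2 * K1 * t)" using ball[OF w] K1(1) mult_left_mono[of "Im w" "2 * t" K1] by simp
      finally have "ln (norm (zeta w)) \<le> ln (exp (2 * K1 * t))"
        using nz[OF w] by (intro ln_mono) auto
      thus ?thesis using Reg[OF w] by (simp add: F_def)
    qed
    define d where "d = dist s0 s"
    have "s0 - s = of_real (W + 3 - Re s)" by (simp add: s0_def t_def complex_eq_iff)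
    hence d: "d = W + 3 - Re s" using s unfolding d_def dist_norm by (simp only: norm_of_real)
    have dr: "d + h / 2 \<le> r" using s d h by (simp add: r_def)
    have sb: "s \<in> ball s0 r" using dr h by (simp add: d_def)
    have s0b: "s0 \<in> ball s0 r" using hr h by auto
    have F0: "Re (F s0) \<le> (2 * K1 + 1) * t"
    proof -
      have "norm (zeta s0) \<ge> 1 / 2" by (rule norm_zeta_bounds) (use W in \<open>simp add: s0_def\<close>)
      hence "ln (1/2) \<le> ln (norm (zeta s0))" by (intro ln_mono) auto
      moreover have "ln (1/2) \<ge> - (1::real)" using ln_2_less_1 by (simp add: ln_div)
      ultimately show ?thesis using Reg[OF s0b] t by (simp add: F_def algebra_simps)
    qed
    have "h / 2 * Re (F s) \<le> (r - d) * Re (F s)"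
      using dr pos[OF sb] by (intro mult_right_mono) auto
    also have "\<dots> \<le> (r + d) * Re (F s0)"
      using harnack(2)[OF F pos sb] by (simp add: d_def)
    also have "\<dots> \<le> 2 * (W + 3) * ((2 * K1 + 1) * t)"
      using F0 pos[OF s0b] dr hr h W d s by (intro mult_mono) auto
    finally have "Re (F s) \<le> K * t" using h by (simp add: K_def field_simps)
    moreover have "2 * K1 * t \<ge> 0" using K1(1) t by simp
    ultimately have "ln (norm (zeta s)) \<ge> - (K * t)"
      using Reg[OF sb] by (simp add: F_def)
    thus ?thesis using nz[OF sb] by (simp add: t_def ln_ge_iff)
  qed
  have "K > 0" unfolding K_def using W h K1 by (intro mult_pos_pos divide_pos_pos) auto
  thus ?thesis using bound that by blast
qed

lemma norm_zeta_chi_critical: 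
  assumes "Re s = 1/2" "Im s \<noteq> 0" 
  shows "norm (zeta_chi s) = 1"
proof -
  have "1 - s = cnj s" using assms by (simp add: complex_eq_iff)
  hence "zeta_chi s * cnj (zeta_chi s) = 1"
    using zeta_chi_mult_reflect[OF assms(2)] by (simp add: zeta_chi_cnj)
  hence "(norm (zeta_chi s))\<^sup>2 = 1"
    by (metis complex_norm_square of_real_eq_1_iff)
  thus ?thesis by (simp add: power2_eq_1_iff) (use norm_ge_zero[of "zeta_chi s"] in linarith)
qed

text \<open>
  Since \<open>|\<chi>| = 1\<close> on the critical line, the bound follows by integrating
  \<open>(log \<chi>)' = - log t + O(1)\<close> over a segment of length \<open>h\<close>.
\<close>
lemma norm_zeta_chi_left_of_critical_line:
  obtains C where "C \<ge> 0" "\<And>h y. 0 \<le> h \<Longrightarrow> h \<le> 1 / 2 \<Longrightarrow> y \<ge> 1 \<Longrightarrow> norm (zeta_chi (Complex (1/2 - h) y)) \<le> exp (h * (ln y + C))"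
proof -
  obtain C where C: "C \<ge> 0" "\<And>s. \<bar>Re s\<bar> \<le> 1 \<Longrightarrow> Im s \<ge> 1 \<Longrightarrow> norm (neg_logderiv s - of_real (ln (Im s))) \<le> C"
    using neg_logderiv_asymptotic[of 1] by blast
  have "norm (zeta_chi (Complex (1/2 - h) y)) \<le> exp (h * (ln y + C))" if h: "0 \<le> h" "h \<le> 1/2" and y: "y \<ge> 1" for h y
  proof -
    define U where "U = {s. Im s > 0}"
    have U: "convex U" "open U" by (simp_all add: U_def convex_halfspace_Im_gt open_halfspace_Im_gt)
    have nz: "zeta_chi s \<noteq> 0" if "s \<in> U" for s using that by (intro zeta_chi_nonzero) (auto simp: U_def)
    have yU: "Complex x y \<in> U" for x using y by (simp add: U_def)
    have "zeta_chi holomorphic_on U" by (intro zeta_chi_holomorphic) (auto simp: U_def)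
    then obtain g where g: "g holomorphic_on U" "\<And>s. s \<in> U \<Longrightarrow> exp (g s) = zeta_chi s"
      using holomorphic_logarithm_exists[of U zeta_chi "Complex 0 y"] U nz yU by auto
    have ng: "norm (zeta_chi s) = exp (Re (g s))" if "s \<in> U" for s
      using g(2)[OF that] norm_exp_eq_Re[of "g s"] by simp
    \<comment> \<open>Adding \<open>s ln y\<close> removes the main term of the derivative of \<open>g\<close>.\<close>
    define k where "k = (\<lambda>s. g s + of_real (ln y) * s)"
    define a b where "a = Complex (1/2 - h) y" and "b = Complex (1/2) y"
    have seg: "Im s = y \<and> \<bar>Re s\<bar> \<le> 1" if "s \<in> closed_segment a b" for s
    proof -
      obtain u where u: "0 \<le> u" "u \<le> 1" "s = (1 - u) *\<^sub>R a + u *\<^sub>R b" using \<open>s \<in> _\<close> by (auto simp: closed_segment_def)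
      have "Re s = 1/2 - (1 - u) * h" "Im s = y" unfolding u(3) by (simp_all add: a_def b_def algebra_simps)
      moreover have "(1 - u) * h \<le> 1 * (1/2)" by (rule mult_mono) (use u h in auto)
      moreover have "0 \<le> (1 - u) * h" using u h by simp
      ultimately show ?thesis by auto
    qed
    have "norm (k a - k b) \<le> C * norm (a - b)"
    proof (rule field_differentiable_bound[where S = "closed_segment a b"])
      fix s assume "s \<in> closed_segment a b"
      note s = seg[OF this]
      have sU: "s \<in> U" using s y by (simp add: U_def)
      have dg: "(g has_field_derivative deriv g s) (at s)" by (rule holomorphic_derivI[OF g(1) U(2) sU])
      hence "((\<lambda>s. exp (g s)) has_field_derivative exp (g s) * deriv g s) (at s)"
        by (auto intro!: derivative_eq_intros)
      moreover have "((\<lambda>s. exp (g s)) has_field_derivative - zeta_chi s * neg_logderiv s) (at s)"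
      proof (rule has_field_derivative_transform_within_open[where f = zeta_chi])
        show "(zeta_chi has_field_derivative - zeta_chi s * neg_logderiv s) (at s)"
          using sU by (intro has_field_derivative_zeta_chi) (auto simp: U_def)
      qed (use U sU g in auto)
      ultimately have "exp (g s) * deriv g s = - zeta_chi s * neg_logderiv s" by (rule DERIV_unique)
      hence "zeta_chi s * deriv g s = zeta_chi s * (- neg_logderiv s)" using g(2)[OF sU] by simp
      hence "deriv g s = - neg_logderiv s" using nz[OF sU] mult_left_cancel by blast
      hence "(k has_field_derivative - neg_logderiv s + of_real (ln y)) (at s)"
        unfolding k_def using dg by (auto intro!: derivative_eq_intros)
      thus "(k has_field_derivative - neg_logderiv s + of_real (ln y)) (at s within closed_segment a b)"
        by (rule has_field_derivative_at_within)
      show "norm (- neg_logderiv s + of_real (ln y)) \<le> C"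
        using C(2)[of s] s y by (simp add: norm_minus_commute)
    qed auto
    moreover have "norm (a - b) = h"
    proof -
      have "a - b = of_real (- h)" by (simp add: a_def b_def complex_eq_iff)
      thus ?thesis using h by (simp only: norm_of_real)
    qed
    ultimately have "Re (k a - k b) \<le> C * h" using complex_Re_le_cmod[of "k a - k b"] by simp
    moreover have "Re (k a - k b) = Re (g a) - Re (g b) - h * ln y"
      by (simp add: k_def a_def b_def algebra_simps)
    moreover have "Re (g b) = 0"
      using norm_zeta_chi_critical[of b] ng[of b] yU[of "1/2"] y by (simp add: b_def)
    ultimately have "Re (g a) \<le> h * (ln y + C)" by (simp add: algebra_simps)
    moreover have "norm (zeta_chi a) = exp (Re (g a))" using ng[of a] yU by (simp add: a_def)
    ultimately show ?thesis by (simp add: a_def)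
  qed
  thus ?thesis using C(1) that by blast
qed


text \<open>
  Otherwise \<open>zeta\<close> would vanish on a segment. Such a height serves as the lower edge of the half strip
  in \<open>zeta_ratio_bound\<close>, where a zero of \<open>zeta (s + h)\<close> has to be avoided uniformly in \<open>h\<close>.
\<close>
lemma zeta_nonzero_height:
  obtains t0 where "1 \<le> t0" "t0 \<le> 2" "zeta (Complex (1 / 2) t0) \<noteq> 0"
proof (rule ccontr)
  assume "\<not> thesis"
  hence z: "zeta (Complex (1/2) t) = 0" if "1 \<le> t" "t \<le> 2" for t using that \<open>\<And>t0. 1 \<le> t0 \<Longrightarrow> t0 \<le> 2 \<Longrightarrow> zeta (Complex (1/2) t0) \<noteq> 0 \<Longrightarrow> thesis\<close> by blast
  define U where "U = (\<lambda>t. Complex (1/2) t) ` {1..2}"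
  have "zeta 3 = 0"
  proof (rule analytic_continuation[where S = "- {1}" and U = U and \<xi> = "Complex (1/2) 1" and f = zeta])
    show "connected (- {1 :: complex})" by (rule connected_punctured_universe) simp
    show "Complex (1/2) 1 islimpt U"
      unfolding islimpt_approachable
    proof (intro allI impI)
      fix e :: real assume e: "e > 0"
      define a where "a = 1 + min e 1 / 2"
      have a: "a \<in> {1..2}" "a \<noteq> 1" "\<bar>a - 1\<bar> < e" using e by (auto simp: a_def min_def)
      have "Complex (1/2) a - Complex (1/2) 1 = \<i> * of_real (a - 1)" by (simp add: complex_eq_iff)
      hence "dist (Complex (1/2) a) (Complex (1/2) 1) = \<bar>a - 1\<bar>"
        unfolding dist_norm by (simp only: norm_mult norm_of_real) simp
      thus "\<exists>x'\<in>U. x' \<noteq> Complex (1/2) 1 \<and> dist x' (Complex (1/2) 1) < e"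
        using a unfolding U_def by (intro bexI[of _ "Complex (1/2) a"]) auto
    qed
  qed (use z zeta_holomorphic in \<open>auto simp: U_def complex_eq_iff\<close>)
  thus False using norm_zeta_bounds(1)[of 3] by simp
qed

text \<open>
  The Phragmen-Lindelof principle in a half strip, for \<open>\<zeta>(s - h) / \<zeta>(s + h)\<close> divided by
  \<open>exp (h (Ln (- i s) + C))\<close>. On the critical line the functional equation gives the factor
  \<open>|\<chi>(s - h)|\<close>, of size \<open>t powr h\<close>; on the lower and the right edge the quotient is
  \<open>1 + O(h)\<close>. The exponent is linear in \<open>h\<close> with a constant independent of \<open>h\<close>, so the bound can be
  differentiated at \<open>h = 0\<close>.
\<close>
lemma zeta_ratio_bound:
  assumes RH: "riemann_hypothesis" and W: "W \<ge> 5"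
  obtains C t0 where "t0 \<ge> 1" "C \<ge> 0"
    "\<And>h s. 0 < h \<Longrightarrow> h < 1 / 2 \<Longrightarrow> 1 / 2 \<le> Re s \<Longrightarrow> Re s \<le> W \<Longrightarrow> Im s \<ge> t0 \<Longrightarrow>
       norm (zeta (s - of_real h)) \<le> norm (zeta (s + of_real h)) * exp (h * (ln (norm s) + C))"
proof -
  obtain t0 where t0: "1 \<le> t0" "t0 \<le> 2" "zeta (Complex (1 / 2) t0) \<noteq> 0" by (rule zeta_nonzero_height)
  obtain C1 where C1: "C1 \<ge> 0" "\<And>h y. 0 \<le> h \<Longrightarrow> h \<le> 1 / 2 \<Longrightarrow> y \<ge> 1 \<Longrightarrow> norm (zeta_chi (Complex (1/2 - h) y)) \<le> exp (h * (ln y + C1))"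
    by (rule norm_zeta_chi_left_of_critical_line) blast
  define L where "L = cbox (Complex 0 t0) (Complex (W + 1) t0)"
  have L: "s \<in> L \<longleftrightarrow> 0 \<le> Re s \<and> Re s \<le> W + 1 \<and> Im s = t0" for s
    by (auto simp: L_def in_cbox_complex_iff)
  have Lim: "Im s = t0" if "s \<in> L" for s using that by (simp add: L)
  have Lnz: "zeta s \<noteq> 0" if "s \<in> L" for s
    using riemann_hypothesis_zero_Re[OF RH, of s] Lim[OF that] t0 by (metis complex.collapse not_one_le_zero)
  have L0: "Complex 0 t0 \<in> L" using W by (simp add: L)
  have L1: "1 \<notin> L" using Lim[of 1] t0 by auto
  have comp: "compact L" "L \<noteq> {}" using L0 by (auto simp: L_def)
  have contz: "continuous_on L (\<lambda>s. norm (zeta s))"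
    by (intro continuous_on_norm holomorphic_on_imp_continuous_on zeta_holomorphic_on L1)
  have "deriv zeta holomorphic_on - {1}" by (intro holomorphic_deriv zeta_holomorphic) auto
  hence "continuous_on L (deriv zeta)"
    using L1 by (intro holomorphic_on_imp_continuous_on) (auto intro: holomorphic_on_subset)
  hence contd: "continuous_on L (\<lambda>s. norm (deriv zeta s))" by (rule continuous_on_norm)
  obtain a where a: "a \<in> L" "\<And>s. s \<in> L \<Longrightarrow> norm (zeta a) \<le> norm (zeta s)"
    using continuous_attains_inf[OF comp contz] by blast
  obtain b where b: "b \<in> L" "\<And>s. s \<in> L \<Longrightarrow> norm (deriv zeta s) \<le> norm (deriv zeta b)"
    using continuous_attains_sup[OF comp contd] by blast
  define m M where "m = norm (zeta a)" and "M = norm (deriv zeta b)"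
  have m: "m > 0" using Lnz[OF a(1)] by (simp add: m_def)
  have M: "M \<ge> 0" by (simp add: M_def)
  define C where "C = C1 + 2 * M / m + 6"
  have C: "C \<ge> 0" "C \<ge> C1" "C \<ge> 2 * M / m" "C \<ge> 6" using C1 m M by (auto simp: C_def)
  have main: "norm (zeta (s - of_real h)) \<le> norm (zeta (s + of_real h)) * exp (h * (ln (norm s) + C))"
    if h: "0 < h" "h < 1/2" and s: "1/2 \<le> Re s" "Re s \<le> W" "Im s \<ge> t0" for h s
  proof -
    let ?ok = "\<lambda>w. norm (zeta (w - of_real h)) \<le> norm (zeta (w + of_real h)) * exp (h * (ln (norm w) + C))"
    have nz: "zeta (w + of_real h) \<noteq> 0" if "1/2 \<le> Re w" "Im w \<noteq> 0" for w
      using riemann_hypothesis_zero_Re[OF RH, of "w + of_real h"] that h by auto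
    define Q where "Q = (\<lambda>w. zeta (w - of_real h) / zeta (w + of_real h) * exp (- of_real h * (Ln (- \<i> * w) + of_real C)))"
    have nQ: "norm (Q w) = norm (zeta (w - of_real h)) / norm (zeta (w + of_real h)) * exp (- h * (ln (norm w) + C))" if "Im w > 0" for w
    proof -
      have "w \<noteq> 0" using that by auto
      thus ?thesis by (simp add: Q_def norm_mult norm_divide norm_exp_eq_Re)
    qed
    have conv: "norm (Q w) \<le> 1 \<longleftrightarrow> ?ok w"
      if "1/2 \<le> Re w" "Im w > 0" for w
      using nz[OF that(1)] that unfolding nQ[OF that(2)] by (simp add: exp_minus divide_simps)
    have lnw: "ln (norm w) \<ge> ln (Im w)" "ln (Im w) \<ge> 0" if "Im w \<ge> 1" for w
      using that abs_Im_le_cmod[of w] by (auto intro!: ln_mono)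
    have step: "?ok w"
      if w: "Im w \<ge> 1" and c: "0 \<le> c" "c \<le> C" and l: "l > 0" "norm (zeta (w + of_real h)) \<ge> l"
        and D: "norm (zeta (w - of_real h) - zeta (w + of_real h)) \<le> h * (c * l)" for w c l
    proof -
      have "norm (zeta (w - of_real h)) \<le> norm (zeta (w + of_real h)) + norm (zeta (w - of_real h) - zeta (w + of_real h))"
        using norm_triangle_ineq[of "zeta (w + of_real h)" "zeta (w - of_real h) - zeta (w + of_real h)"] by simp
      also have "\<dots> \<le> norm (zeta (w + of_real h)) + h * c * norm (zeta (w + of_real h))"
      proof -
        have "h * (c * l) \<le> h * (c * norm (zeta (w + of_real h)))"
          using h c l by (intro mult_left_mono) auto
        thus ?thesis using D by (simp add: mult.assoc)
      qed
      also have "\<dots> = norm (zeta (w + of_real h)) * (1 + h * c)" by (simp add: algebra_simps)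
      also have "\<dots> \<le> norm (zeta (w + of_real h)) * exp (h * c)" by (intro mult_left_mono) auto
      also have "\<dots> \<le> norm (zeta (w + of_real h)) * exp (h * (ln (norm w) + C))"
        using c h lnw[OF w] by (intro mult_left_mono) auto
      finally show ?thesis .
    qed
    have left: "norm (Q w) \<le> 1" if w: "Re w = 1/2" "Im w \<ge> t0" for w
    proof (subst conv)
      have "norm (zeta (w - of_real h)) = norm (zeta_chi (w - of_real h)) * norm (zeta (1 - (w - of_real h)))"
        using zeta_functional_equation[of "w - of_real h"] w t0 by (simp add: norm_mult)
      also have "1 - (w - of_real h) = cnj (w + of_real h)" using w by (simp add: complex_eq_iff)
      also have "norm (zeta (cnj (w + of_real h))) = norm (zeta (w + of_real h))" by (simp only: zeta_cnj complex_mod_cnj)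
      also have "norm (zeta_chi (w - of_real h)) * norm (zeta (w + of_real h))
          \<le> exp (h * (ln (Im w) + C1)) * norm (zeta (w + of_real h))"
      proof -
        have *: "w - of_real h = Complex (1/2 - h) (Im w)" using w by (simp add: complex_eq_iff)
        have "norm (zeta_chi (w - of_real h)) \<le> exp (h * (ln (Im w) + C1))"
          unfolding * by (rule C1(2)) (use h w t0 in auto)
        thus ?thesis by (rule mult_right_mono) simp
      qed
      also have "\<dots> \<le> exp (h * (ln (norm w) + C)) * norm (zeta (w + of_real h))"
        using h w t0 lnw[of w] C by (intro mult_right_mono) auto
      finally show "?ok w"
        by (simp add: mult.commute)
    qed (use w t0 in auto)
    have bottom: "norm (Q w) \<le> 1" if w: "1/2 \<le> Re w" "Re w \<le> W" "Im w = t0" for w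
    proof (subst conv)
      have in_L: "w - of_real h \<in> L" "w + of_real h \<in> L"
        using w h by (auto simp: L)
      have "norm (zeta (w - of_real h) - zeta (w + of_real h)) \<le> M * norm ((w - of_real h) - (w + of_real h))"
      proof (rule field_differentiable_bound[where S = L])
        show "convex L" by (simp add: L_def)
        fix z assume z: "z \<in> L"
        hence "z \<noteq> 1" using L1 by blast
        thus "(zeta has_field_derivative deriv zeta z) (at z within L)"
          by (rule has_field_derivative_at_within[OF zeta_has_field_derivative])
        show "norm (deriv zeta z) \<le> M" unfolding M_def by (rule b(2)[OF z])
      qed (rule in_L)+
      also have "(w - of_real h) - (w + of_real h) = of_real (- (2 * h))" by simp
      also have "M * norm (complex_of_real (- (2 * h))) = h * (2 * M / m * m)"
        using h m by (simp only: norm_of_real) simp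
      finally show "?ok w"
        using w t0 C m M a(2)[OF in_L(2)] by (intro step[of w "2 * M / m" m]) (auto simp: m_def)
    qed (use w t0 in auto)
    have right: "norm (Q w) \<le> 1" if w: "Re w = W" "Im w \<ge> t0" for w
    proof (subst conv)
      define S where "S = {z. Re z \<ge> 4}"
      have "norm (zeta (w - of_real h) - zeta (w + of_real h)) \<le> 3/2 * norm ((w - of_real h) - (w + of_real h))"
      proof (rule field_differentiable_bound[where S = S])
        show "convex S" by (simp add: S_def convex_halfspace_Re_ge)
        show "(zeta has_field_derivative deriv zeta z) (at z within S)" if "z \<in> S" for z
          by (rule has_field_derivative_at_within[OF zeta_has_field_derivative]) (use that in \<open>auto simp: S_def\<close>)
      qed (use w W h norm_deriv_zeta_le in \<open>auto simp: S_def\<close>)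
      also have "(w - of_real h) - (w + of_real h) = of_real (- (2 * h))" by simp
      also have "3/2 * norm (complex_of_real (- (2 * h))) = h * (6 * (1/2))"
        using h by (simp only: norm_of_real)
      finally show "?ok w"
        using w t0 C W h by (intro step[of w 6 "1/2"] norm_zeta_bounds) auto
    qed (use w W t0 in auto)
    obtain K1 where K1: "K1 > 0" "\<And>w. 1/2 - h \<le> Re w \<Longrightarrow> Re w \<le> W \<Longrightarrow> Im w \<ge> 1 \<Longrightarrow> norm (zeta w) \<le> exp (K1 * Im w)"
    proof -
      have "1/2 - h > 0" "W \<ge> 0" using h W by auto
      from zeta_exponential_growth[OF this] that show ?thesis by blast
    qed
    obtain K2 where K2: "K2 > 0" "\<And>w. 1/2 + h \<le> Re w \<Longrightarrow> Re w \<le> W + 1 \<Longrightarrow> Im w \<ge> W + 1 + 4 \<Longrightarrow> norm (zeta w) \<ge> exp (- (K2 * Im w))"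
    proof -
      have "W + 1 \<ge> 0" using W by auto
      from zeta_lower_bound[OF RH h(1) this] that show ?thesis by blast
    qed
    have Qs: "norm (Q s) * exp (\<delta> * ((Re s)\<^sup>2 - (Im s)\<^sup>2 - W\<^sup>2)) \<le> 1" if \<delta>: "\<delta> > 0" for \<delta>
    proof -
      define T where "T = Max {Im s, W + 5, (K1 + K2) / \<delta>}"
      have T: "T \<ge> Im s" "T \<ge> W + 5" "T \<ge> (K1 + K2) / \<delta>" by (simp_all add: T_def)
      \<comment> \<open>The Gaussian factor beats the exponential growth of \<open>Q\<close> on the upper edge \<open>Im w = T\<close>.\<close>
      define P where "P = (\<lambda>w. Q w * exp (of_real \<delta> * (w\<^sup>2 - of_real (W\<^sup>2))))"
      have nP: "norm (P w) = norm (Q w) * exp (\<delta> * ((Re w)\<^sup>2 - (Im w)\<^sup>2 - W\<^sup>2))" for w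
        by (simp add: P_def norm_mult norm_exp_eq_Re Re_power2 del: of_real_power)
      have P1: "norm (P w) \<le> 1" if "norm (Q w) \<le> 1" "1/2 \<le> Re w" "Re w \<le> W" for w
      proof -
        have "(Re w)\<^sup>2 \<le> W\<^sup>2" using that by (intro power_mono) auto
        hence "exp (\<delta> * ((Re w)\<^sup>2 - (Im w)\<^sup>2 - W\<^sup>2)) \<le> 1"
        proof -
          have "(Re w)\<^sup>2 - (Im w)\<^sup>2 - W\<^sup>2 \<le> 0"
            using \<open>(Re w)\<^sup>2 \<le> W\<^sup>2\<close> zero_le_power2[of "Im w"] by linarith
          hence "\<delta> * ((Re w)\<^sup>2 - (Im w)\<^sup>2 - W\<^sup>2) \<le> 0" using \<delta> by (intro mult_nonneg_nonpos) auto
          thus ?thesis by simp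
        qed
        thus ?thesis unfolding nP using that by (intro mult_le_one) auto
      qed
      define B where "B = cbox (Complex (1/2) t0) (Complex W T)"
      have B: "w \<in> B \<longleftrightarrow> 1/2 \<le> Re w \<and> Re w \<le> W \<and> t0 \<le> Im w \<and> Im w \<le> T" for w
        by (auto simp: B_def in_cbox_complex_iff)
      have holP: "P holomorphic_on B"
      proof -
        have "(zeta \<circ> (\<lambda>w. w - of_real h)) holomorphic_on B" "(zeta \<circ> (\<lambda>w. w + of_real h)) holomorphic_on B"
          by (intro holomorphic_on_compose holomorphic_intros; use B t0 in \<open>force simp: complex_eq_iff\<close>)+
        moreover have "zeta (w + of_real h) \<noteq> 0" if "w \<in> B" for w using that t0 by (intro nz) (auto simp: B)
        moreover have "- \<i> * w \<notin> \<real>\<^sub>\<le>\<^sub>0" if "w \<in> B" for w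
          using that t0 by (auto simp: B complex_nonpos_Reals_iff)
        ultimately show ?thesis unfolding P_def Q_def o_def by (intro holomorphic_intros) auto
      qed
      have "norm (P s) \<le> 1"
      proof (rule maximum_modulus_frontier[where S = B and f = P])
        show "P holomorphic_on interior B" by (rule holomorphic_on_subset[OF holP interior_subset])
        show "continuous_on (closure B) P" using holomorphic_on_imp_continuous_on[OF holP] by (simp add: B_def)
        show "bounded B" by (simp add: B_def)
        show "s \<in> B" using s T by (simp add: B)
        fix w assume "w \<in> frontier B"
        hence w: "w \<in> B" "w \<notin> box (Complex (1/2) t0) (Complex W T)"
          by (auto simp: B_def frontier_def)
        then consider "Re w = 1/2" | "Re w = W" | "Im w = t0" | "Im w = T"
          by (auto simp: B in_box_complex_iff)
        thus "norm (P w) \<le> 1"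
        proof cases
          case 4
          have wr: "1/2 \<le> Re w" "Re w \<le> W" using w by (auto simp: B)
          have T0: "T > 0" using T W by simp
          have "norm (Q w) \<le> norm (zeta (w - of_real h)) / norm (zeta (w + of_real h)) * 1"
            unfolding nQ[of w, unfolded 4, OF T0]
          proof (intro mult_left_mono divide_nonneg_nonneg)
            have "Im w \<ge> 1" using 4 T W by simp
            from lnw[OF this] have "ln (norm w) \<ge> 0" by linarith
            thus "exp (- h * (ln (norm w) + C)) \<le> 1" using h C by (simp add: mult_nonneg_nonneg)
          qed auto
          also have "\<dots> \<le> exp (K1 * T) / exp (- (K2 * T)) * 1"
          proof (intro mult_right_mono frac_le)
            show "norm (zeta (w - of_real h)) \<le> exp (K1 * T)"
              using K1(2)[of "w - of_real h"] wr 4 h T W by simp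
            show "exp (- (K2 * T)) \<le> norm (zeta (w + of_real h))"
              using K2(2)[of "w + of_real h"] wr 4 h T W by simp
          qed auto
          also have "\<dots> = exp ((K1 + K2) * T)" by (simp add: exp_add[symmetric] exp_minus divide_inverse algebra_simps)
          finally have q: "norm (Q w) \<le> exp ((K1 + K2) * T)" .
          have "(Re w)\<^sup>2 \<le> W\<^sup>2" using wr by (intro power_mono) auto
          hence e: "exp (\<delta> * ((Re w)\<^sup>2 - (Im w)\<^sup>2 - W\<^sup>2)) \<le> exp (- (\<delta> * T * T))"
            using \<delta> 4 mult_left_mono[of "(Re w)\<^sup>2 - (Im w)\<^sup>2 - W\<^sup>2" "- (T * T)" \<delta>] by (simp add: power2_eq_square algebra_simps)
          have "norm (P w) \<le> exp ((K1 + K2) * T) * exp (- (\<delta> * T * T))"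
            unfolding nP using q e by (intro mult_mono) auto
          also have "\<dots> = exp (((K1 + K2) - \<delta> * T) * T)" by (simp add: exp_add[symmetric] algebra_simps)
          also have "\<dots> \<le> 1"
          proof -
            have "K1 + K2 \<le> \<delta> * T" using T(3) \<delta> by (simp add: field_simps)
            thus ?thesis using T0 by (simp add: mult_nonpos_nonneg)
          qed
          finally show ?thesis .
        qed (use left right bottom w in \<open>auto intro!: P1 simp: B\<close>)
      qed
      thus ?thesis by (simp only: nP)
    qed
    have "((\<lambda>\<delta>. norm (Q s) * exp (\<delta> * ((Re s)\<^sup>2 - (Im s)\<^sup>2 - W\<^sup>2))) \<longlongrightarrow> norm (Q s) * exp (0 * ((Re s)\<^sup>2 - (Im s)\<^sup>2 - W\<^sup>2))) (at_right 0)"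
      by (intro tendsto_intros)
    hence "norm (Q s) * exp (0 * ((Re s)\<^sup>2 - (Im s)\<^sup>2 - W\<^sup>2)) \<le> 1"
      by (rule tendsto_upperbound) (use Qs in \<open>auto intro: eventually_mono[OF eventually_at_right_less]\<close>)
    thus ?thesis using conv[of s] s t0 by simp
  qed
  show ?thesis using that[OF t0(1) C(1) main] by blast
qed

text \<open>
  The completion of the logarithmic derivative of \<open>zeta\<close> that is odd under \<open>s \<mapsto> 1 - s\<close>.
\<close>
definition odd_logderiv :: "complex \<Rightarrow> complex" where
  "odd_logderiv s = deriv zeta s / zeta s + neg_logderiv s / 2"

lemma deriv_zeta_cnj:
  assumes "s \<noteq> 1"
  shows "deriv zeta (cnj s) = cnj (deriv zeta s)"
proof -
  have "(zeta has_field_derivative cnj (deriv zeta s)) (at (cnj s))"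
    using has_field_derivative_cnj_cnj[of zeta "deriv zeta s" "cnj s"] zeta_has_field_derivative[OF assms]
    by (simp add: zeta_cnj o_def)
  thus ?thesis by (rule DERIV_imp_deriv)
qed

lemma deriv_zeta_functional_equation:
  assumes s: "Im s \<noteq> 0"
  shows "deriv zeta s = - (zeta_chi s * (neg_logderiv s * zeta (1 - s) + deriv zeta (1 - s)))"
proof (rule DERIV_imp_deriv)
  have s1: "1 - s \<noteq> 1" using s by auto
  have "((\<lambda>s. zeta (1 - s)) has_field_derivative deriv zeta (1 - s) * (- 1)) (at s)"
    by (rule DERIV_chain2[where f = zeta and g = "\<lambda>s. 1 - s"])
       (auto intro!: derivative_eq_intros zeta_has_field_derivative s1)
  hence "((\<lambda>s. zeta_chi s * zeta (1 - s)) has_field_derivative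
     - (zeta_chi s * (neg_logderiv s * zeta (1 - s) + deriv zeta (1 - s)))) (at s)"
    using has_field_derivative_zeta_chi[OF s] by (auto intro!: derivative_eq_intros simp: algebra_simps)
  thus "(zeta has_field_derivative - (zeta_chi s * (neg_logderiv s * zeta (1 - s) + deriv zeta (1 - s)))) (at s)"
  proof (rule has_field_derivative_transform_within_open[where S = "- {s. Im s = 0}"])
    show "open (- {s. Im s = 0})" by (rule open_nonreal)
    show "zeta_chi w * zeta (1 - w) = zeta w" if "w \<in> - {s. Im s = 0}" for w
      using that by (intro zeta_functional_equation[symmetric]) simp
  qed (use s in auto)
qed

lemma odd_logderiv_reflect:
  assumes s: "Im s \<noteq> 0" "zeta s \<noteq> 0"
  shows "odd_logderiv (1 - s) = - odd_logderiv s"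
proof -
  have z: "zeta s = zeta_chi s * zeta (1 - s)" by (rule zeta_functional_equation[OF s(1)])
  have nz: "zeta_chi s \<noteq> 0" "zeta (1 - s) \<noteq> 0" using s z by auto
  have "deriv zeta s / zeta s = - neg_logderiv s - deriv zeta (1 - s) / zeta (1 - s)"
    unfolding deriv_zeta_functional_equation[OF s(1)] z using nz by (simp add: field_simps)
  thus ?thesis by (simp add: odd_logderiv_def neg_logderiv_reflect[OF s(1)])
qed

lemma odd_logderiv_cnj:
  assumes s: "Im s \<noteq> 0"
  shows "odd_logderiv (cnj s) = cnj (odd_logderiv s)"
proof -
  have "s \<noteq> 1" using s by auto
  thus ?thesis by (simp add: odd_logderiv_def zeta_cnj deriv_zeta_cnj neg_logderiv_cnj[OF s])
qed

lemma Re_odd_logderiv_reflect: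
  assumes s: "Im s \<noteq> 0" "zeta s \<noteq> 0"
  shows "Re (odd_logderiv (1 - cnj s)) = - Re (odd_logderiv s)"
  using odd_logderiv_reflect[of "cnj s"] odd_logderiv_cnj[of s] s by (simp add: zeta_cnj)

text \<open>
  Letting \<open>h \<rightarrow> 0\<close> in \<open>zeta_ratio_bound\<close> yields \<open>Re (\<zeta>'/\<zeta>) \<ge> - (log t) / 2 - O(1)\<close>, and \<open>\<ell>/2\<close>
  compensates the main term.
\<close>
lemma Re_odd_logderiv_lower_bound:
  assumes RH: "riemann_hypothesis" and W: "W \<ge> 5"
  obtains C t0 where "t0 \<ge> 1" "C \<ge> 0"
    "\<And>s. 1 / 2 < Re s \<Longrightarrow> Re s \<le> W \<Longrightarrow> Im s \<ge> t0 \<Longrightarrow> Re (odd_logderiv s) \<ge> - C"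
proof -
  obtain C1 t0 where 1: "t0 \<ge> 1" "C1 \<ge> 0"
    "\<And>h s. 0 < h \<Longrightarrow> h < 1 / 2 \<Longrightarrow> 1 / 2 \<le> Re s \<Longrightarrow> Re s \<le> W \<Longrightarrow> Im s \<ge> t0 \<Longrightarrow>
       norm (zeta (s - of_real h)) \<le> norm (zeta (s + of_real h)) * exp (h * (ln (norm s) + C1))"
    by (rule zeta_ratio_bound[OF RH W]) (rule that; blast)
  obtain C2 where C2: "C2 \<ge> 0" "\<And>s. \<bar>Re s\<bar> \<le> W \<Longrightarrow> Im s \<ge> 1 \<Longrightarrow> norm (neg_logderiv s - of_real (ln (Im s))) \<le> C2"
    using neg_logderiv_asymptotic[of W] by blast
  define C where "C = (ln (W + 1) + C1 + C2) / 2"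
  have "Re (odd_logderiv s) \<ge> - C" if s: "1 / 2 < Re s" "Re s \<le> W" "Im s \<ge> t0" for s
  proof -
    define t where "t = Im s"
    have t: "t \<ge> 1" using s 1 by (simp add: t_def)
    have nz: "zeta s \<noteq> 0" using riemann_hypothesis_zero_Re[OF RH, of s] s 1 by force
    have s1: "s \<noteq> 1" using s 1 by auto
    have "isCont zeta s" using zeta_has_field_derivative[OF s1] by (rule DERIV_isCont)
    then obtain e0 where e0: "e0 > 0" "\<And>w. dist s w < e0 \<Longrightarrow> zeta w \<noteq> 0"
      using continuous_at_avoid[of s zeta 0] nz by blast
    define e where "e = min e0 (1/2)"
    define U where "U = ball s e"
    have e: "e > 0" "e \<le> 1/2" "e \<le> e0" using e0 by (auto simp: e_def)
    have U1: "1 \<notin> U"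
    proof
      assume "1 \<in> U"
      hence "norm (s - 1) < 1" using e by (simp add: U_def dist_norm)
      thus False using abs_Im_le_cmod[of "s - 1"] t by (simp add: t_def)
    qed
    obtain g where g: "g holomorphic_on U" "\<And>w. w \<in> U \<Longrightarrow> exp (g w) = zeta w"
      using holomorphic_logarithm_exists[of U zeta s] zeta_holomorphic_on[OF U1] e e0 by (auto simp: U_def)
    have sU: "s \<in> U" using e by (simp add: U_def)
    have dg: "(g has_field_derivative deriv g s) (at s)"
      by (rule holomorphic_derivI[OF g(1) _ sU]) (simp add: U_def)
    have "((\<lambda>w. exp (g w)) has_field_derivative exp (g s) * deriv g s) (at s)"
      using dg by (auto intro!: derivative_eq_intros)
    moreover have "((\<lambda>w. exp (g w)) has_field_derivative deriv zeta s) (at s)"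
      by (rule has_field_derivative_transform_within_open[where f = zeta and S = U])
         (use zeta_has_field_derivative[OF s1] g sU in \<open>auto simp: U_def\<close>)
    ultimately have "exp (g s) * deriv g s = deriv zeta s" by (rule DERIV_unique)
    hence dlog: "deriv g s = deriv zeta s / zeta s" using g(2)[OF sU] nz by (simp add: field_simps)
    have ng: "ln (norm (zeta w)) = Re (g w)" "zeta w \<noteq> 0" if "w \<in> U" for w
      using g(2)[OF that, symmetric] by (simp_all add: norm_exp_eq_Re)
    \<comment> \<open>The logarithm of the quotient bounded in \<open>zeta_ratio_bound\<close>; its derivative at \<open>0\<close> is \<open>2 \<zeta>'/\<zeta>(s)\<close>.\<close>
    define k where "k = (\<lambda>h. g (s + of_real h) - g (s - of_real h))"
    have dr: "(k has_vector_derivative 2 * deriv g s) (at 0)"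
    proof -
      have "((\<lambda>h. g (s + h) - g (s - h)) has_field_derivative deriv g s * 1 - deriv g s * (- 1)) (at 0)"
        by (intro DERIV_diff DERIV_chain2[where f = g and Db = 1] DERIV_chain2[where f = g and Db = "-1"])
           (use dg in \<open>auto intro!: derivative_eq_intros\<close>)
      hence "(((\<lambda>h. g (s + h) - g (s - h)) \<circ> of_real) has_vector_derivative 1 * (deriv g s * 1 - deriv g s * (- 1))) (at 0)"
        by (intro field_vector_diff_chain_at) (auto intro!: derivative_eq_intros)
      thus ?thesis by (simp add: k_def o_def)
    qed
    hence "((\<lambda>h. Re (k h)) has_real_derivative Re (2 * deriv g s)) (at 0)"
      by (simp add: has_vector_derivative_complex_iff)
    hence "((\<lambda>h. (Re (k (0 + h)) - Re (k 0)) / h) \<longlongrightarrow> Re (2 * deriv g s)) (at 0)"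
      by (simp add: DERIV_def)
    hence lim: "((\<lambda>h. Re (k h) / h) \<longlongrightarrow> Re (2 * deriv g s)) (at_right 0)"
      by (simp add: k_def filterlim_at_split)
    have ev: "\<forall>\<^sub>F h in at_right 0. 0 < h \<and> h < e"
      using e by (auto intro!: eventually_at_rightI[of 0 e])
    have "\<forall>\<^sub>F h in at_right 0. - (ln (norm s) + C1) \<le> Re (k h) / h"
      using ev
    proof eventually_elim
      case (elim h)
      have hU: "s + of_real h \<in> U" "s - of_real h \<in> U" using elim by (auto simp: U_def dist_norm)
      have "norm (zeta (s - of_real h)) \<le> norm (zeta (s + of_real h)) * exp (h * (ln (norm s) + C1))"
        using elim e s by (intro 1(3)) auto
      hence "ln (norm (zeta (s - of_real h))) \<le> ln (norm (zeta (s + of_real h)) * exp (h * (ln (norm s) + C1)))"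
        using ng(2)[OF hU(2)] by (intro ln_mono) auto
      also have "\<dots> = ln (norm (zeta (s + of_real h))) + h * (ln (norm s) + C1)"
        using ng(2)[OF hU(1)] by (subst ln_mult_pos) auto
      finally have "Re (g (s - of_real h)) \<le> Re (g (s + of_real h)) + h * (ln (norm s) + C1)"
        by (simp only: ng(1)[OF hU(1)] ng(1)[OF hU(2)])
      hence "- (ln (norm s) + C1) * h \<le> Re (k h)" by (simp add: k_def algebra_simps)
      thus ?case using elim by (simp only: pos_le_divide_eq)
    qed
    hence "- (ln (norm s) + C1) \<le> Re (2 * deriv g s)"
      by (rule tendsto_lowerbound[OF lim]) simp
    hence "Re (deriv g s) \<ge> - (ln (norm s) + C1) / 2" by simp
    hence A: "Re (deriv zeta s / zeta s) \<ge> - (ln (norm s) + C1) / 2" by (simp only: dlog)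
    have B: "Re (neg_logderiv s) \<ge> ln t - C2"
      using C2(2)[of s] s t abs_Re_le_cmod[of "neg_logderiv s - of_real (ln t)"] by (simp add: t_def)
    have "norm s \<le> \<bar>Re s\<bar> + \<bar>Im s\<bar>" by (rule cmod_le)
    also have "\<dots> \<le> W * 1 + t" using s t by (simp add: t_def)
    also have "\<dots> \<le> W * t + t" using t W by (intro add_mono mult_left_mono) auto
    finally have "ln (norm s) \<le> ln ((W + 1) * t)"
      using s by (intro ln_mono) (auto simp: algebra_simps)
    also have "\<dots> = ln (W + 1) + ln t" using t W by (subst ln_mult_pos) auto
    finally have D: "ln (norm s) \<le> ln (W + 1) + ln t" .
    have "Re (odd_logderiv s) = Re (deriv zeta s / zeta s) + Re (neg_logderiv s) / 2" by (simp add: odd_logderiv_def)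
    thus ?thesis using A B D unfolding C_def by (simp add: field_simps)
  qed
  moreover have "C \<ge> 0" using W 1 C2 by (simp add: C_def)
  ultimately show ?thesis using that 1(1) by blast
qed

section \<open>Local analysis at a fixed height\<close>

lemma neg_logderiv_eq_deriv:
  assumes "Im s \<noteq> 0"
  shows "neg_logderiv s = - deriv zeta_chi s / zeta_chi s"
  using DERIV_imp_deriv[OF has_field_derivative_zeta_chi[OF assms]] zeta_chi_nonzero[OF assms] by simp

lemma neg_logderiv_holomorphic:
  assumes "open A" "\<And>s. s \<in> A \<Longrightarrow> Im s \<noteq> 0"
  shows "neg_logderiv holomorphic_on A"
proof -
  have hol: "zeta_chi holomorphic_on A" by (intro zeta_chi_holomorphic) (use assms in auto)
  hence "(\<lambda>s. - deriv zeta_chi s / zeta_chi s) holomorphic_on A"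
    by (intro holomorphic_intros holomorphic_deriv assms) (use assms zeta_chi_nonzero in auto)
  thus ?thesis by (rule holomorphic_transform) (use assms neg_logderiv_eq_deriv in auto)
qed

lemma odd_logderiv_holomorphic:
  assumes "open A" "\<And>s. s \<in> A \<Longrightarrow> Im s \<noteq> 0" "\<And>s. s \<in> A \<Longrightarrow> zeta s \<noteq> 0"
  shows "odd_logderiv holomorphic_on A"
proof -
  have "1 \<notin> A" using assms(2)[of 1] by auto
  thus ?thesis unfolding odd_logderiv_def
    by (intro holomorphic_intros holomorphic_deriv neg_logderiv_holomorphic assms) (use assms in auto)
qed

text \<open>
  The situation around height \<open>t\<close>: \<open>L\<close> stands for \<open>log t\<close>, the constants \<open>C\<close> and \<open>D\<close> do not depend on
  \<open>t\<close>, and \<open>L\<close> dominates both.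
\<close>
locale zeta_window =
  fixes t L C D :: real
  assumes RH: "riemann_hypothesis"
    and t: "t \<ge> 31"
    and CD: "C \<ge> 0" "D \<ge> 0" and L: "L \<ge> 100 * (1 + C + D)"
    and N_ge: "\<And>s. 1 / 2 < Re s \<Longrightarrow> Re s \<le> 40 \<Longrightarrow> \<bar>Im s - t\<bar> \<le> 30 \<Longrightarrow> Re (odd_logderiv s) \<ge> - C"
    and ell: "\<And>s. \<bar>Re s\<bar> \<le> 40 \<Longrightarrow> \<bar>Im s - t\<bar> \<le> 30 \<Longrightarrow> norm (neg_logderiv s - of_real L) \<le> D"
begin

lemma Im_pos: "\<bar>Im s - t\<bar> \<le> 30 \<Longrightarrow> Im s \<ge> 1"
  using t by linarith

lemma zeta_nonzero: "\<bar>Im s - t\<bar> \<le> 30 \<Longrightarrow> Re s \<noteq> 1 / 2 \<Longrightarrow> zeta s \<noteq> 0"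
  using Im_pos[of s] riemann_hypothesis_zero_Re[OF RH, of s] by force

lemma N_le:
  assumes s: "- 30 \<le> Re s" "Re s < 1 / 2" "\<bar>Im s - t\<bar> \<le> 30"
  shows "Re (odd_logderiv s) \<le> C"
proof -
  have "Re (odd_logderiv (1 - cnj s)) = - Re (odd_logderiv s)"
    using Im_pos[OF s(3)] zeta_nonzero[OF s(3)] s by (intro Re_odd_logderiv_reflect) auto
  moreover have "Re (odd_logderiv (1 - cnj s)) \<ge> - C" by (rule N_ge) (use s in auto)
  ultimately show ?thesis by simp
qed

lemma N_critical:
  assumes "Re s = 1 / 2" "\<bar>Im s - t\<bar> \<le> 30" "zeta s \<noteq> 0"
  shows "Re (odd_logderiv s) = 0"
proof -
  have "1 - cnj s = s" using assms by (simp add: complex_eq_iff)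
  thus ?thesis using Re_odd_logderiv_reflect[of s] Im_pos[OF assms(2)] assms by auto
qed

lemma norm_ell_le: "\<bar>Re s\<bar> \<le> 40 \<Longrightarrow> \<bar>Im s - t\<bar> \<le> 30 \<Longrightarrow> norm (neg_logderiv s) \<le> 2 * L"
  using ell[of s] norm_triangle_ineq2[of "neg_logderiv s" "of_real L"] L CD by simp

lemma Re_ell_ge: "\<bar>Re s\<bar> \<le> 40 \<Longrightarrow> \<bar>Im s - t\<bar> \<le> 30 \<Longrightarrow> Re (neg_logderiv s) \<ge> L - D"
  using ell[of s] abs_Re_le_cmod[of "neg_logderiv s - of_real L"] by simp

text \<open>
  At a zero of \<open>zeta'\<close> at distance \<open>\<sigma>\<close> from the critical line, \<open>N\<close> equals \<open>\<ell>/2\<close>, of real part at least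
  \<open>L/4\<close>. If \<open>\<sigma>\<close> is small, \<open>N\<close> is therefore steep at the centre, and stays so up to the nearest zero of
  \<open>zeta\<close>.
\<close>
lemma N_growth_above_zero:
  assumes d: "0 < d" "d \<le> 8" and \<sigma>: "0 < \<sigma>" "\<sigma> \<le> d / 2"
    and free: "\<And>s. zeta s = 0 \<Longrightarrow> Im s \<noteq> 0 \<Longrightarrow> \<bar>Im s - t\<bar> \<ge> d"
    and N: "Re (odd_logderiv (Complex (1 / 2 + \<sigma>) t)) \<ge> L / 4"
  shows "Re (odd_logderiv (Complex (1 / 2 + d / 2) t)) + C \<ge> d * L / (90 * \<sigma>)"
proof -
  define p where "p = Complex (1/2) t"
  define G where "G = (\<lambda>v. odd_logderiv (p + v) - odd_logderiv p)"
  have near: "\<bar>Im (p + v) - t\<bar> < d \<and> \<bar>Re v\<bar> < d" if "v \<in> ball 0 d" for v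
    using that abs_Re_le_cmod[of v] abs_Im_le_cmod[of v] by (simp add: p_def)
  have nz: "Im (p + v) \<noteq> 0 \<and> zeta (p + v) \<noteq> 0" if "v \<in> ball 0 d" for v
    using near[OF that] free[of "p + v"] d t by force
  have pz: "zeta p \<noteq> 0" using nz[of 0] d by simp
  have Np: "Re (odd_logderiv p) = 0" using pz by (intro N_critical) (simp_all add: p_def)
  have "odd_logderiv holomorphic_on ball p d"
  proof (rule odd_logderiv_holomorphic)
    fix s assume "s \<in> ball p d"
    hence "s - p \<in> ball 0 d" by (simp add: dist_norm norm_minus_commute)
    from nz[OF this] show "Im s \<noteq> 0" "zeta s \<noteq> 0" by simp_all
  qed simp
  hence "(odd_logderiv \<circ> (\<lambda>v. p + v)) holomorphic_on ball 0 d"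
    by (intro holomorphic_on_compose_gen[where t = "ball p d"] holomorphic_intros) (auto simp: dist_norm)
  hence hol: "G holomorphic_on ball 0 d" unfolding G_def o_def by (intro holomorphic_intros)
  have G0: "G 0 = 0" by (simp add: G_def)
  have right: "Re (G v) \<ge> - C" if "v \<in> ball 0 d" "Re v > 0" for v
    using N_ge[of "p + v"] near[OF that(1)] that d Np by (simp add: G_def p_def)
  have left: "Re (G v) \<le> C" if "v \<in> ball 0 d" "Re v < 0" for v
    using N_le[of "p + v"] near[OF that(1)] that d Np by (simp add: G_def p_def)
  have s1: "p + of_real \<sigma> = Complex (1/2 + \<sigma>) t" and s2: "p + of_real (d / 2) = Complex (1/2 + d/2) t"
    by (simp_all add: p_def complex_eq_iff)
  have G1: "Re (G (of_real \<sigma>)) \<ge> L / 4" unfolding G_def s1 using N Np by simp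
  have "Re (G (of_real (d/2))) \<ge> 2 * d / (45 * \<sigma>) * Re (G (of_real \<sigma>)) - C"
    by (rule odd_sign_growth(2)[OF d(1) hol G0 CD(1) right left \<sigma>]) (use G1 L CD in auto)
  moreover have "2 * d / (45 * \<sigma>) * Re (G (of_real \<sigma>)) \<ge> 2 * d / (45 * \<sigma>) * (L / 4)"
    using G1 d \<sigma> by (intro mult_left_mono) auto
  moreover have "2 * d / (45 * \<sigma>) * (L / 4) = d * L / (90 * \<sigma>)" by simp
  moreover have "Re (G (of_real (d/2))) = Re (odd_logderiv (Complex (1 / 2 + d / 2) t))"
    unfolding G_def s2 using Np by simp
  ultimately show ?thesis by linarith
qed

text \<open>
  Three applications of Harnack's inequality: up to distance \<open>2 d\<close> from the critical line, then
  sideways from height \<open>t\<close> to height \<open>\<gamma>\<close>, then back to distance \<open>r / 2\<close>. Only the last step loses a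
  factor that is not constant.
\<close>
lemma N_harnack_chain:
  assumes d: "0 < d" "d \<le> 8" "\<bar>\<gamma> - t\<bar> = d" and r: "0 < r" "r \<le> d"
  shows "Re (odd_logderiv (Complex (1 / 2 + r / 2) \<gamma>)) + C \<ge> r / (168 * d) * (Re (odd_logderiv (Complex (1 / 2 + d / 2) t)) + C)"
proof -
  define P where "P = (\<lambda>s. Re (odd_logderiv s) + C)"
  define p a b q where "p = Complex (1/2 + d/2) t" and "a = Complex (1/2 + 2 * d) t"
    and "b = Complex (1/2 + 2 * d) \<gamma>" and "q = Complex (1/2 + r/2) \<gamma>"
  have ball: "1/2 < Re s \<and> Re s \<le> 40 \<and> \<bar>Im s - t\<bar> \<le> 30"
    if "s \<in> ball (Complex (1/2 + 2 * d) y) (2 * d)" "y = t \<or> y = \<gamma>" for s y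
  proof -
    have "\<bar>Re s - (1/2 + 2 * d)\<bar> < 2 * d" "\<bar>Im s - y\<bar> < 2 * d"
      using that abs_Re_le_cmod[of "s - Complex (1/2 + 2 * d) y"] abs_Im_le_cmod[of "s - Complex (1/2 + 2 * d) y"]
      by (auto simp: dist_norm norm_minus_commute)
    thus ?thesis using d that(2) by linarith
  qed
  have hol: "odd_logderiv holomorphic_on ball (Complex (1/2 + 2 * d) y) (2 * d)" if "y = t \<or> y = \<gamma>" for y
  proof (rule odd_logderiv_holomorphic)
    fix s assume "s \<in> ball (Complex (1/2 + 2 * d) y) (2 * d)"
    from ball[OF this that] show "Im s \<noteq> 0" "zeta s \<noteq> 0" using Im_pos[of s] zeta_nonzero[of s] by auto
  qed simp
  have pos: "Re (odd_logderiv s) \<ge> - C" if "s \<in> ball (Complex (1/2 + 2 * d) y) (2 * d)" "y = t \<or> y = \<gamma>" for s y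
    using ball[OF that] by (intro N_ge) auto
  have pa: "dist a p = 3/2 * d"
  proof -
    have "a - p = of_real (3/2 * d)" by (simp add: a_def p_def complex_eq_iff)
    thus ?thesis using d unfolding dist_norm by (simp only: norm_of_real)
  qed
  have ab: "dist a b = d"
  proof -
    have "a - b = \<i> * of_real (t - \<gamma>)" by (simp add: a_def b_def complex_eq_iff)
    hence "dist a b = \<bar>t - \<gamma>\<bar>" unfolding dist_norm by (simp only: norm_mult norm_of_real) simp
    thus ?thesis using d by linarith
  qed
  have bq: "dist b q = 2 * d - r/2"
  proof -
    have "b - q = of_real (2 * d - r/2)" by (simp add: b_def q_def complex_eq_iff)
    hence "dist b q = \<bar>2 * d - r/2\<bar>" unfolding dist_norm by (simp only: norm_of_real)
    thus ?thesis using d r by simp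
  qed
  have "(2 * d - dist a p) * (Re (odd_logderiv p) + C) \<le> (2 * d + dist a p) * (Re (odd_logderiv a) + C)"
    unfolding a_def by (rule harnack(2)[OF hol pos]) (use pa d in \<open>auto simp: a_def\<close>)
  hence "d / 2 * P p \<le> d / 2 * (7 * P a)" unfolding pa by (simp add: P_def algebra_simps)
  hence 1: "P p \<le> 7 * P a" using d by simp
  have "(2 * d + dist a b) * (Re (odd_logderiv b) + C) \<ge> (2 * d - dist a b) * (Re (odd_logderiv a) + C)"
    unfolding a_def by (rule harnack(1)[OF hol pos]) (use ab d in \<open>auto simp: a_def\<close>)
  hence "d * P a \<le> d * (3 * P b)" unfolding ab by (simp add: P_def algebra_simps)
  hence 2: "P a \<le> 3 * P b" using d by simp
  have "(2 * d + dist b q) * (Re (odd_logderiv q) + C) \<ge> (2 * d - dist b q) * (Re (odd_logderiv b) + C)"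
    unfolding b_def by (rule harnack(1)[OF hol pos]) (use bq d r in \<open>auto simp: b_def\<close>)
  hence 3: "(4 * d - r/2) * P q \<ge> r/2 * P b" unfolding bq by (simp add: P_def algebra_simps)
  have "P q \<ge> 0" using N_ge[of q] d r unfolding P_def q_def by simp
  hence "(4 * d - r/2) * P q \<le> 4 * d * P q" using r by (intro mult_right_mono) auto
  moreover have "r/2 * (P p / 21) \<le> r/2 * P b" using 1 2 r by (intro mult_left_mono) linarith+
  ultimately have "r/2 * (P p / 21) \<le> 4 * d * P q" using 3 by linarith
  hence "r / (168 * d) * P p \<le> P q" using d by (simp add: field_simps)
  thus ?thesis by (simp add: P_def p_def q_def)
qed

end

lemma zeta_logderiv_reflect:
  assumes "Im s \<noteq> 0" "zeta s \<noteq> 0"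
  shows "deriv zeta (1 - s) / zeta (1 - s) = - (odd_logderiv s + neg_logderiv s / 2)"
proof -
  have "deriv zeta (1 - s) / zeta (1 - s) = odd_logderiv (1 - s) - neg_logderiv (1 - s) / 2"
    by (simp add: odd_logderiv_def)
  also have "\<dots> = - odd_logderiv s - neg_logderiv s / 2"
    unfolding odd_logderiv_reflect[OF assms] neg_logderiv_reflect[OF assms(1)] ..
  finally show ?thesis by simp
qed

context zeta_window
begin

text \<open>
  The function \<open>B = - \<zeta>'(s) / (\<chi>(s) \<zeta>'(1 - s))\<close> is holomorphic at the zeros of \<open>\<zeta>\<close> as well. It has
  modulus \<open>1\<close> on the critical line, and \<open>B(s) B(1 - s) = 1\<close>. Where it has no zeros, \<open>- log B\<close> falls under
  \<open>odd_sign_growth\<close> with derivative \<open>\<ell> \<approx> L\<close> at the centre, hence has real part at least of order \<open>r L\<close>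
  at distance \<open>r / 2\<close>. If \<open>Re N \<ge> K L\<close> there, then \<open>B = 1 - \<ell> / (N + \<ell>/2)\<close> gives an upper bound of order
  \<open>1 / K\<close>.
\<close>
lemma N_bounded_above_simple_zero:
  assumes \<gamma>: "\<bar>\<gamma> - t\<bar> \<le> 8" and r: "0 < r" "r \<le> 1"
    and zero: "zeta (Complex (1 / 2) \<gamma>) = 0"
    and free: "\<And>s. s \<in> ball (Complex (1 / 2) \<gamma>) r \<Longrightarrow> deriv zeta s \<noteq> 0"
    and K: "K \<ge> 4" "Re (odd_logderiv (Complex (1 / 2 + r / 2) \<gamma>)) + C \<ge> K * L"
  shows "r * L / 15 \<le> 4 / K + 8 * (C + D) / L"
proof -
  define k where "k = Complex (1/2) \<gamma>"
  define B where "B = (\<lambda>s. 1 + neg_logderiv s * zeta (1 - s) / deriv zeta (1 - s))"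
  define E where "E = C + D / 2"
  define \<eta> where "\<eta> = 8 * (C + D) / L"
  have Lp: "L > 0" "L \<ge> 100" using L CD by auto
  have E: "E \<ge> 0" "E \<le> C + D" "100 * E \<le> L" using L CD by (auto simp: E_def)
  have \<eta>0: "\<eta> \<ge> 0" using Lp CD by (simp add: \<eta>_def)
  have near: "\<bar>Re s - 1/2\<bar> < 1 \<and> \<bar>Im s - t\<bar> \<le> 9" if "s \<in> ball k r" for s
    using that abs_Re_le_cmod[of "s - k"] abs_Im_le_cmod[of "s - k"] \<gamma> r
    by (auto simp: k_def dist_norm norm_minus_commute)
  have im: "Im s \<noteq> 0" if "s \<in> ball k r" for s using near[OF that] Im_pos[of s] by force
  have refl: "1 - cnj s \<in> ball k r" if "s \<in> ball k r" for s
  proof -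
    have "k - (1 - cnj s) = - cnj (k - s)" by (simp add: k_def complex_eq_iff)
    hence "norm (k - (1 - cnj s)) = norm (k - s)" by (simp only: norm_minus_cancel complex_mod_cnj)
    thus ?thesis using that unfolding mem_ball dist_norm by linarith
  qed
  have dnz: "deriv zeta s \<noteq> 0" if "s \<in> ball k r" for s using free that by (simp add: k_def)
  have dnz': "deriv zeta (1 - s) \<noteq> 0" if "s \<in> ball k r" for s
  proof -
    have "1 - cnj s \<noteq> 1" using im[OF that] by auto
    hence "deriv zeta (cnj (1 - cnj s)) = cnj (deriv zeta (1 - cnj s))" by (rule deriv_zeta_cnj)
    thus ?thesis using dnz[OF refl[OF that]] by simp
  qed
  have kb: "k \<in> ball k r" using r by simp
  have Beq: "B s = - deriv zeta s / (zeta_chi s * deriv zeta (1 - s))" if "s \<in> ball k r" for s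
  proof -
    have "1 + l * z / d = - (- (x * (l * z + d))) / (x * d)" if "x \<noteq> 0" "d \<noteq> 0" for x l z d :: complex
      using that by (simp add: field_simps)
    from this[OF zeta_chi_nonzero[OF im[OF that]] dnz'[OF that]] show ?thesis
      unfolding B_def deriv_zeta_functional_equation[OF im[OF that]] .
  qed
  have Bnz: "B s \<noteq> 0" if "s \<in> ball k r" for s
    unfolding Beq[OF that] using dnz[OF that] dnz'[OF that] zeta_chi_nonzero[OF im[OF that]] by simp
  have Bhol: "B holomorphic_on ball k r"
  proof -
    have b0: "0 \<notin> ball k r" using im[of 0] by auto
    have "(zeta \<circ> (\<lambda>s. 1 - s)) holomorphic_on ball k r"
      by (intro holomorphic_on_compose holomorphic_intros) (use b0 in auto)
    moreover have "deriv zeta holomorphic_on - {1}" by (intro holomorphic_deriv zeta_holomorphic) auto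
    hence "(deriv zeta \<circ> (\<lambda>s. 1 - s)) holomorphic_on ball k r"
      by (intro holomorphic_on_compose_gen[where t = "- {1}"] holomorphic_intros) (use b0 in auto)
    moreover have "neg_logderiv holomorphic_on ball k r" by (rule neg_logderiv_holomorphic) (use im in auto)
    ultimately show ?thesis unfolding B_def o_def using dnz' by (intro holomorphic_intros) auto
  qed
  obtain g where g: "g holomorphic_on ball k r" "\<And>s. s \<in> ball k r \<Longrightarrow> exp (g s) = B s"
    using holomorphic_logarithm_exists[of "ball k r" B k] Bhol Bnz kb by auto
  have Reg: "Re (g s) = ln (norm (B s))" if "s \<in> ball k r" for s
    using g(2)[OF that, symmetric] by (simp add: norm_exp_eq_Re)
  have z1: "zeta (1 - k) = 0"
    using zeta_functional_equation[OF im[OF kb]] zeta_chi_nonzero[OF im[OF kb]] zero by (simp add: k_def)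
  have Bk: "B k = 1" by (simp add: B_def z1)
  have dB: "(B has_field_derivative - neg_logderiv k) (at k)"
  proof -
    have k1: "1 - k \<noteq> 1" using im[OF kb] by auto
    have "(neg_logderiv has_field_derivative deriv neg_logderiv k) (at k)"
      by (rule holomorphic_derivI[OF neg_logderiv_holomorphic[of "ball k r"]]) (use im kb in auto)
    moreover have "((\<lambda>s. zeta (1 - s)) has_field_derivative deriv zeta (1 - k) * (- 1)) (at k)"
      by (rule DERIV_chain2[where f = zeta and g = "\<lambda>s. 1 - s"])
         (auto intro!: derivative_eq_intros zeta_has_field_derivative k1)
    moreover have "deriv zeta holomorphic_on - {1}" by (intro holomorphic_deriv zeta_holomorphic) auto
    hence "(deriv zeta has_field_derivative deriv (deriv zeta) (1 - k)) (at (1 - k))"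
      by (rule holomorphic_derivI) (use k1 in auto)
    hence "((\<lambda>s. deriv zeta (1 - s)) has_field_derivative deriv (deriv zeta) (1 - k) * (- 1)) (at k)"
      by (intro DERIV_chain2[where f = "deriv zeta" and g = "\<lambda>s. 1 - s"]) (auto intro!: derivative_eq_intros)
    ultimately show ?thesis unfolding B_def using dnz'[OF kb]
      by (auto intro!: derivative_eq_intros simp: z1)
  qed
  have Bform: "B s = 1 - neg_logderiv s / (odd_logderiv s + neg_logderiv s / 2)" if s: "s \<in> ball k r" "zeta s \<noteq> 0" for s
  proof -
    have "B s = 1 + neg_logderiv s / (deriv zeta (1 - s) / zeta (1 - s))" by (simp add: B_def)
    thus ?thesis unfolding zeta_logderiv_reflect[OF im[OF s(1)] s(2)] divide_minus_right
      by (simp only: diff_conv_add_uminus)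
  qed
  have right: "Re (g s) \<le> \<eta>" if s: "s \<in> ball k r" "Re s > 1/2" for s
  proof -
    note nr = near[OF s(1)] and i = im[OF s(1)]
    have zs: "zeta s \<noteq> 0" using nr s by (intro zeta_nonzero) auto
    have z1s: "zeta (1 - s) \<noteq> 0" using zeta_functional_equation[OF i] zs by auto
    define n where "n = odd_logderiv s"
    define l where "l = neg_logderiv s / 2"
    have dl: "deriv zeta (1 - s) / zeta (1 - s) = - (n + l)"
      unfolding n_def l_def by (rule zeta_logderiv_reflect[OF i zs])
    have Bs: "B s = 1 - 2 * l / (n + l)"
      unfolding Bform[OF s(1) zs] n_def l_def by simp
    have nl: "n + l \<noteq> 0"
    proof
      assume "n + l = 0"
      hence "deriv zeta (1 - s) / zeta (1 - s) = 0" unfolding dl by (simp only: minus_zero)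
      thus False using z1s dnz'[OF s(1)] by simp
    qed
    have l: "norm (l - of_real (L / 2)) \<le> D / 2"
    proof -
      have eq: "l - of_real (L/2) = (neg_logderiv s - of_real L) / 2" by (simp add: l_def diff_divide_distrib)
      have "norm (neg_logderiv s - of_real L) \<le> D" by (rule ell) (use nr in auto)
      thus ?thesis unfolding eq norm_divide by simp
    qed
    \<comment> \<open>Shifting by \<open>C\<close> makes the real part nonnegative, so \<open>m\<close> is at least as close to \<open>L/2\<close> as to \<open>- L/2\<close>.\<close>
    define m where "m = n + of_real C"
    have m: "Re m \<ge> 0"
      using N_ge[of s] s nr by (simp add: m_def n_def)
    define A where "A = norm (m + of_real (L / 2))"
    have A: "A \<ge> L / 2" using complex_Re_le_cmod[of "m + of_real (L/2)"] m by (simp add: A_def)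
    have "(norm (m - of_real (L / 2)))\<^sup>2 \<le> A\<^sup>2"
      unfolding A_def cmod_power2 using m Lp by (simp add: power2_eq_square algebra_simps)
    hence mA: "norm (m - of_real (L / 2)) \<le> A" by (rule power2_le_imp_le) (simp add: A_def)
    have tri: "norm (x - y - w) \<le> norm x + norm y + norm w" for x y w :: complex
      using norm_triangle_ineq4[of "x - y" w] norm_triangle_ineq4[of x y] by linarith
    have eq1: "n - l = (m - of_real (L/2)) - of_real C - (l - of_real (L/2))" by (simp add: m_def)
    have "norm (n - l) \<le> norm (m - of_real (L/2)) + norm (complex_of_real C) + norm (l - of_real (L/2))"
      unfolding eq1 by (rule tri)
    hence up: "norm (n - l) \<le> A + E" using mA l CD by (simp add: E_def)
    have eq2: "m + of_real (L/2) = (n + l) - of_real (- C) - (l - of_real (L/2))" by (simp add: m_def)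
    have "A \<le> norm (n + l) + norm (complex_of_real (- C)) + norm (l - of_real (L/2))"
      unfolding A_def eq2 by (rule tri)
    hence lo: "norm (n + l) \<ge> A - E" using l CD by (simp add: E_def)
    have "B s = (n - l) / (n + l)" unfolding Bs using nl by (simp add: field_simps)
    hence "norm (B s) = norm (n - l) / norm (n + l)" by (simp add: norm_divide)
    also have "\<dots> \<le> (A + E) / (A - E)" using up lo A E Lp by (intro frac_le) auto
    also have "\<dots> = 1 + 2 * E / (A - E)" using A E Lp by (simp add: field_simps)
    also have "\<dots> \<le> 1 + 2 * E / (L / 4)" using A E Lp by (intro add_mono divide_left_mono) auto
    also have "\<dots> \<le> 1 + \<eta>" using E Lp by (simp add: \<eta>_def divide_right_mono)
    finally have "norm (B s) \<le> 1 + \<eta>" .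
    hence "ln (norm (B s)) \<le> ln (1 + \<eta>)" using Bnz[OF s(1)] by (intro ln_mono) auto
    also have "\<dots> \<le> \<eta>" using \<eta>0 by (rule ln_add_one_self_le_self)
    finally show ?thesis using Reg[OF s(1)] by simp
  qed
  have left: "Re (g s) \<ge> - \<eta>" if s: "s \<in> ball k r" "Re s < 1/2" for s
  proof -
    define s' where "s' = 1 - cnj s"
    have s': "s' \<in> ball k r" "Re s' > 1/2" using refl[OF s(1)] s by (auto simp: s'_def)
    have c: "norm (deriv zeta (cnj w)) = norm (deriv zeta w)" if "Im w \<noteq> 0" for w
    proof -
      have "w \<noteq> 1" using that by auto
      thus ?thesis by (simp add: deriv_zeta_cnj)
    qed
    have "norm (B s') = norm (deriv zeta s') / (norm (zeta_chi s') * norm (deriv zeta (1 - s')))"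
      unfolding Beq[OF s'(1)] by (simp add: norm_divide norm_mult)
    also have "s' = cnj (1 - s)" by (simp add: s'_def)
    also have "1 - cnj (1 - s) = cnj s" by simp
    also have "norm (deriv zeta (cnj (1 - s))) = norm (deriv zeta (1 - s))" using im[OF s(1)] by (intro c) simp
    also have "norm (deriv zeta (cnj s)) = norm (deriv zeta s)" using im[OF s(1)] by (rule c)
    also have "norm (zeta_chi (cnj (1 - s))) = norm (zeta_chi (1 - s))" by (simp only: zeta_chi_cnj complex_mod_cnj)
    finally have "norm (B s) * norm (B s') = 1 / (norm (zeta_chi s) * norm (zeta_chi (1 - s)))"
      unfolding Beq[OF s(1)] using dnz[OF s(1)] dnz'[OF s(1)] by (simp add: norm_divide norm_mult s'_def)
    also have "norm (zeta_chi s) * norm (zeta_chi (1 - s)) = 1"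
      using zeta_chi_mult_reflect[OF im[OF s(1)]] by (metis norm_mult norm_one)
    finally have "norm (B s) * norm (B s') = 1" by simp
    hence "ln (norm (B s)) + ln (norm (B s')) = 0"
      using Bnz[OF s(1)] Bnz[OF s'(1)] by (subst ln_mult_pos[symmetric]) auto
    thus ?thesis using right[OF s'] Reg[OF s(1)] Reg[OF s'(1)] by simp
  qed
  define G where "G = (\<lambda>v. g k - g (k + v))"
  have kv: "k + v \<in> ball k r" if "v \<in> ball 0 r" for v using that by (simp add: dist_norm)
  have "(g \<circ> (\<lambda>v. k + v)) holomorphic_on ball 0 r"
    by (intro holomorphic_on_compose_gen[OF _ g(1)] holomorphic_intros) (use kv in auto)
  hence G: "G holomorphic_on ball 0 r" "G 0 = 0"
    unfolding G_def o_def by (auto intro!: holomorphic_intros)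
  have gk: "Re (g k) = 0" using Reg[OF kb] Bk by simp
  have dG: "deriv G 0 = neg_logderiv k"
  proof (rule DERIV_imp_deriv)
    have dg: "(g has_field_derivative deriv g k) (at k)" by (rule holomorphic_derivI[OF g(1) _ kb]) simp
    have "((\<lambda>s. exp (g s)) has_field_derivative exp (g k) * deriv g k) (at k)"
      using dg by (auto intro!: derivative_eq_intros)
    moreover have "((\<lambda>s. exp (g s)) has_field_derivative - neg_logderiv k) (at k)"
      by (rule has_field_derivative_transform_within_open[OF dB, where S = "ball k r"]) (use g kb in auto)
    ultimately have "exp (g k) * deriv g k = - neg_logderiv k" by (rule DERIV_unique)
    hence "deriv g k = - neg_logderiv k" using g(2)[OF kb] Bk by simp
    moreover have "((\<lambda>v. g (k + v)) has_field_derivative deriv g k * 1) (at 0)"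
      by (rule DERIV_chain2[where f = g]) (use dg in \<open>auto intro!: derivative_eq_intros\<close>)
    ultimately show "(G has_field_derivative neg_logderiv k) (at 0)"
      unfolding G_def by (auto intro!: derivative_eq_intros)
  qed
  have "2 * r / 15 * Re (deriv G 0) - \<eta> \<le> Re (G (of_real (r/2)))"
  proof (rule odd_sign_growth(1)[OF r(1) G \<eta>0])
    fix v :: complex assume v: "v \<in> ball 0 r"
    show "- \<eta> \<le> Re (G v)" if "Re v > 0"
      using right[OF kv[OF v]] that gk by (simp add: G_def k_def)
    show "Re (G v) \<le> \<eta>" if "Re v < 0"
      using left[OF kv[OF v]] that gk by (simp add: G_def k_def)
  qed
  moreover have "2 * r / 15 * Re (deriv G 0) \<ge> 2 * r / 15 * (L / 2)"
  proof (rule mult_left_mono)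
    have "Re (neg_logderiv k) \<ge> L - D" by (rule Re_ell_ge) (use \<gamma> in \<open>auto simp: k_def\<close>)
    thus "L / 2 \<le> Re (deriv G 0)" unfolding dG using L CD by (simp add: field_simps)
  qed (use r in simp)
  moreover have "Re (G (of_real (r/2))) \<le> 4 / K"
  proof -
    define q where "q = k + of_real (r/2)"
    have q: "q = Complex (1/2 + r/2) \<gamma>" by (simp add: q_def k_def complex_eq_iff)
    have qb: "q \<in> ball k r" using r unfolding q_def by (intro kv) simp
    have im: "Im q \<noteq> 0" by (rule im[OF qb])
    have zq: "zeta q \<noteq> 0" using near[OF qb] r by (intro zeta_nonzero) (auto simp: q)
    have z1q: "zeta (1 - q) \<noteq> 0" using zeta_functional_equation[OF im] zq by auto
    define n where "n = odd_logderiv q + neg_logderiv q / 2"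
    have "deriv zeta (1 - q) / zeta (1 - q) = - n"
      unfolding n_def by (rule zeta_logderiv_reflect[OF im zq])
    hence Bq: "B q - 1 = - neg_logderiv q / n"
      unfolding Bform[OF qb zq] n_def by simp
    have "Re (neg_logderiv q) \<ge> L - D" by (rule Re_ell_ge) (use near[OF qb] in auto)
    hence "Re n \<ge> K * L" using K(2) L CD unfolding q[symmetric] n_def by simp
    hence n: "norm n \<ge> K * L" using complex_Re_le_cmod[of n] by linarith
    have "norm (neg_logderiv q) \<le> 2 * L" by (rule norm_ell_le) (use near[OF qb] in auto)
    hence "norm (neg_logderiv q) / norm n \<le> 2 * L / (K * L)"
      using n K Lp by (intro frac_le) auto
    hence "norm (B q - 1) \<le> 2 / K" unfolding Bq using Lp by (simp add: norm_divide)
    hence nB: "norm (B q) \<ge> 1 - 2 / K" using norm_triangle_ineq2[of 1 "1 - B q"] by (simp add: norm_minus_commute)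
    have half: "1 - 2 / K \<ge> 1 / 2" using K by (simp add: field_simps)
    have "Re (G (of_real (r/2))) = ln (inverse (norm (B q)))"
      unfolding G_def q_def[symmetric] using Reg[OF qb] gk Bnz[OF qb] by (simp add: ln_inverse)
    also have "\<dots> \<le> inverse (norm (B q)) - 1" using Bnz[OF qb] by (intro ln_le_minus_one) simp
    also have "\<dots> \<le> inverse (1 - 2 / K) - 1" using nB half by (intro diff_right_mono le_imp_inverse_le) auto
    also have "\<dots> = (2 / K) / (1 - 2 / K)" using half K by (simp add: field_simps)
    also have "\<dots> \<le> (2 / K) / (1 / 2)" using half K by (intro divide_left_mono) auto
    finally show ?thesis by simp
  qed
  moreover have "2 * r / 15 * (L / 2) = r * L / 15" by simp
  ultimately have "r * L / 15 \<le> 4 / K + \<eta>" by linarith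
  thus ?thesis by (simp only: \<eta>_def)
qed

end

section \<open>Zeros of the derivative near the critical line\<close>

text \<open>
  If the zeros of \<open>zeta'\<close> keep their ordinates at relative distance \<open>c\<close> from those of \<open>zeta\<close>, they also
  keep away from the critical line. The admissible \<open>\<epsilon>\<close> is of order \<open>c\<^sup>2\<close> for small \<open>c\<close>.
\<close>
lemma zeta_deriv_zeros_repelled:
  assumes RH: "riemann_hypothesis" and c: "c > 0"
    and far: "\<And>\<rho> g. \<rho> \<in> zeta_deriv_nonreal_zeros \<Longrightarrow> Im \<rho> \<ge> T1 \<Longrightarrow> g \<in> Im ` zeta_nontrivial_zeros \<Longrightarrow> \<bar>g - Im \<rho>\<bar> * ln (Im \<rho>) \<ge> c"
    and nearest: "\<And>\<rho>. \<rho> \<in> zeta_deriv_nonreal_zeros \<Longrightarrow> \<exists>g. is_nearest_zeta_ordinate (Im \<rho>) g"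
  shows "\<exists>\<epsilon>>0. \<exists>T. \<forall>\<rho>\<in>zeta_deriv_nonreal_zeros. Im \<rho> \<ge> T \<longrightarrow> \<bar>(Re \<rho> - 1 / 2) * ln (Im \<rho>)\<bar> \<ge> \<epsilon>"
proof -
  have W: "(5::real) \<le> 40" by simp
  obtain C t0 where N: "t0 \<ge> 1" "C \<ge> 0"
    "\<And>s. 1 / 2 < Re s \<Longrightarrow> Re s \<le> 40 \<Longrightarrow> Im s \<ge> t0 \<Longrightarrow> Re (odd_logderiv s) \<ge> - C"
    by (rule Re_odd_logderiv_lower_bound[OF RH W]) (rule that; blast)
  obtain D0 where D0: "D0 \<ge> 0" "\<And>s. \<bar>Re s\<bar> \<le> 40 \<Longrightarrow> Im s \<ge> 1 \<Longrightarrow> norm (neg_logderiv s - of_real (ln (Im s))) \<le> D0"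
    using neg_logderiv_asymptotic[of 40] by blast
  define D where "D = D0 + 1"
  \<comment> \<open>The second entry ensures \<open>K \<ge> 4\<close> and \<open>2 \<sigma> \<le> d\<close> below, the third one that \<open>4 / K\<close> is small against \<open>c\<close>.\<close>
  define \<epsilon> where "\<epsilon> = Min {1, c / 200000, c\<^sup>2 / 10000000}"
  have \<epsilon>: "\<epsilon> > 0" "\<epsilon> \<le> 1" "\<epsilon> \<le> c / 200000" "\<epsilon> \<le> c\<^sup>2 / 10000000"
    using c by (simp_all add: \<epsilon>_def)
  \<comment> \<open>The entries provide, in this order, the standing assumption of the locale, a small error \<open>8 (C + D) / L\<close>, and \<open>r \<le> 1\<close>.\<close>
  define L0 where "L0 = Max {100 * (1 + C + D), 960 * (C + D) / c, c}"
  define T where "T = Max {61, t0 + 30, T1 + 30, exp L0}"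
  have "\<bar>(Re \<rho> - 1 / 2) * ln (Im \<rho>)\<bar> \<ge> \<epsilon>" if \<rho>: "\<rho> \<in> zeta_deriv_nonreal_zeros" "Im \<rho> \<ge> T" for \<rho>
  proof (rule ccontr)
    assume "\<not> \<bar>(Re \<rho> - 1 / 2) * ln (Im \<rho>)\<bar> \<ge> \<epsilon>"
    define t where "t = Im \<rho>"
    define L where "L = ln t"
    define \<sigma> where "\<sigma> = Re \<rho> - 1/2"
    have small: "\<bar>\<sigma> * L\<bar> < \<epsilon>" using \<open>\<not> _\<close> by (simp add: \<sigma>_def L_def t_def)
    have t: "t \<ge> 61" "t \<ge> t0 + 30" "t \<ge> T1 + 30" "t \<ge> exp L0" using \<rho> by (auto simp: T_def t_def)
    have "L0 \<le> L" unfolding L_def using t ln_mono[of "exp L0" t] by simp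
    hence L: "L \<ge> 100 * (1 + C + D)" "L \<ge> 960 * (C + D) / c" "L \<ge> c" by (auto simp: L0_def)
    have D: "D \<ge> 1" using D0 by (simp add: D_def)
    have L1: "L \<ge> 200" using L(1) N(2) D by simp
    interpret window: zeta_window t L C D
    proof
      show "riemann_hypothesis" by (rule RH)
      show "t \<ge> 31" "C \<ge> 0" "D \<ge> 0" "L \<ge> 100 * (1 + C + D)" using t N D L by auto
      show "Re (odd_logderiv s) \<ge> - C" if "1 / 2 < Re s" "Re s \<le> 40" "\<bar>Im s - t\<bar> \<le> 30" for s
        by (rule N(3)) (use that t in auto)
      fix s assume s: "\<bar>Re s\<bar> \<le> 40" "\<bar>Im s - t\<bar> \<le> 30"
      have i: "Im s \<ge> t / 2" "Im s \<le> 2 * t" "Im s \<ge> 1" using s t by linarith+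
      have "ln (Im s) \<le> ln (2 * t)" "ln (t / 2) \<le> ln (Im s)" using i t by (auto intro!: ln_mono)
      hence "\<bar>ln (Im s) - L\<bar> \<le> 1" using t ln_2_less_1 by (simp add: L_def ln_mult ln_div)
      hence "norm (of_real (ln (Im s)) - complex_of_real L) \<le> 1"
        by (simp flip: of_real_diff)
      moreover have "norm (neg_logderiv s - of_real (ln (Im s))) \<le> D0" by (rule D0(2)[OF s(1) i(3)])
      ultimately show "norm (neg_logderiv s - of_real L) \<le> D"
        using norm_triangle_ineq[of "neg_logderiv s - of_real (ln (Im s))" "of_real (ln (Im s)) - of_real L"] by (simp add: D_def)
    qed
    have \<rho>0: "deriv zeta \<rho> = 0" "Im \<rho> \<noteq> 0" using \<rho> by (auto simp: zeta_deriv_nonreal_zeros_def)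
    have ordinate: "Re s = 1/2 \<and> Im s \<in> Im ` zeta_nontrivial_zeros" if "zeta s = 0" "Im s \<noteq> 0" for s
    proof -
      have "Re s = 1/2" by (rule riemann_hypothesis_zero_Re[OF RH that(2,1)])
      thus ?thesis using that by (auto simp: zeta_nontrivial_zeros_def)
    qed
    have sep: "c \<le> \<bar>g - t\<bar> * L" if "g \<in> Im ` zeta_nontrivial_zeros" for g
      using far[OF \<rho>(1) _ that] t by (simp add: t_def L_def)
    have z\<rho>: "zeta \<rho> \<noteq> 0"
    proof
      assume "zeta \<rho> = 0"
      with sep[of "Im \<rho>"] ordinate[of \<rho>] \<rho>0 c show False by (simp add: t_def)
    qed
    have "\<bar>\<sigma>\<bar> * 1 \<le> \<bar>\<sigma>\<bar> * L" using L1 by (intro mult_left_mono) auto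
    also have "\<dots> < \<epsilon>" using small L1 by (simp add: abs_mult)
    finally have \<sigma>1: "\<bar>\<sigma>\<bar> < 1" using \<epsilon> by simp
    have \<rho>eq: "\<rho> = Complex (1/2 + \<sigma>) t" by (simp add: \<sigma>_def t_def complex_eq_iff)
    have N\<rho>: "Re (odd_logderiv \<rho>) \<ge> L / 4"
    proof -
      have "Re (neg_logderiv \<rho>) \<ge> L - D" by (rule window.Re_ell_ge) (use \<sigma>1 in \<open>auto simp: \<rho>eq\<close>)
      thus ?thesis using L(1) N(2) D by (simp add: odd_logderiv_def \<rho>0)
    qed
    have \<sigma>: "\<sigma> > 0"
    proof (rule ccontr)
      assume "\<not> \<sigma> > 0"
      hence "\<sigma> < 0 \<or> \<sigma> = 0" by linarith
      hence "Re (odd_logderiv \<rho>) \<le> C"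
      proof
        assume "\<sigma> < 0"
        thus ?thesis using \<sigma>1 by (intro window.N_le) (auto simp: \<rho>eq)
      next
        assume "\<sigma> = 0"
        hence "Re (odd_logderiv \<rho>) = 0" using z\<rho> by (intro window.N_critical) (auto simp: \<rho>eq)
        thus ?thesis using N by simp
      qed
      thus False using N\<rho> L(1) N(2) D by simp
    qed
    have \<sigma>L: "\<sigma> * L < \<epsilon>" using small by simp
    obtain \<gamma> where \<gamma>: "is_nearest_zeta_ordinate t \<gamma>" using nearest[OF \<rho>(1)] by (auto simp: t_def)
    define d where "d = \<bar>\<gamma> - t\<bar>"
    have dL: "c \<le> d * L" unfolding d_def by (rule sep) (use \<gamma> in \<open>auto simp: is_nearest_zeta_ordinate_def\<close>)
    have d0: "d > 0" using dL c L1 by (metis abs_ge_zero d_def linorder_not_le mult_zero_left order_le_less)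
    have free: "\<bar>Im s - t\<bar> \<ge> d" if "zeta s = 0" "Im s \<noteq> 0" for s
      using ordinate[OF that] \<gamma> by (auto simp: is_nearest_zeta_ordinate_def d_def)
    have "2 * \<sigma> \<le> d"
    proof -
      have "2 * \<sigma> * L \<le> d * L" using \<sigma>L \<epsilon> dL c by linarith
      thus ?thesis using L1 by simp
    qed
    have \<sigma>8: "2 * \<sigma> \<le> 8" using \<sigma>1 by simp
    have growth: "Re (odd_logderiv (Complex (1 / 2 + d' / 2) t)) + C \<ge> d' * L / (90 * \<sigma>)"
      if "0 < d'" "d' \<le> 8" "d' \<le> d" "2 * \<sigma> \<le> d'" for d'
    proof (rule window.N_growth_above_zero)
      show "\<bar>Im s - t\<bar> \<ge> d'" if "zeta s = 0" "Im s \<noteq> 0" for s using free[OF that] \<open>d' \<le> d\<close> by linarith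
      show "Re (odd_logderiv (Complex (1 / 2 + \<sigma>) t)) \<ge> L / 4" using N\<rho> \<rho>eq by simp
    qed (use that \<sigma> in auto)
    have inv\<sigma>: "L / \<epsilon> \<le> 1 / \<sigma>" using \<sigma>L \<sigma> \<epsilon> by (simp add: field_simps)
    \<comment> \<open>Otherwise \<open>N\<close> would be of order \<open>L\<^sup>2\<close> at real part \<open>9/2\<close>, where it is \<open>O(L)\<close>.\<close>
    have d8: "d \<le> 8"
    proof (rule ccontr)
      assume "\<not> d \<le> 8"
      define s where "s = Complex (1 / 2 + 8 / 2) t"
      have "Re (odd_logderiv s) + C \<ge> 8 * L / (90 * \<sigma>)"
        unfolding s_def by (rule growth) (use \<open>\<not> d \<le> 8\<close> \<sigma>8 in auto)
      moreover have "8 * L / (90 * \<sigma>) = 8 * L / 90 * (1 / \<sigma>)" by simp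
      moreover have "8 * L / 90 * (1 / \<sigma>) \<ge> 8 * L / 90 * L"
      proof (rule mult_left_mono)
        have "L * 1 \<le> L * (1 / \<epsilon>)" using \<epsilon> L1 by (intro mult_left_mono) (auto simp: field_simps)
        thus "L \<le> 1 / \<sigma>" using inv\<sigma> by simp
      qed (use L1 in simp)
      moreover have "L * 200 \<le> L * L" using L1 by (intro mult_left_mono) auto
      moreover have "Re (odd_logderiv s) \<le> 3 + L"
      proof -
        have "norm (deriv zeta s / zeta s) \<le> 3" by (rule norm_zeta_logderiv_le) (simp add: s_def)
        moreover have "norm (neg_logderiv s) \<le> 2 * L" by (rule window.norm_ell_le) (auto simp: s_def)
        moreover have "Re (odd_logderiv s) = Re (deriv zeta s / zeta s) + Re (neg_logderiv s) / 2" by (simp add: odd_logderiv_def)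
        ultimately show ?thesis
          using complex_Re_le_cmod[of "deriv zeta s / zeta s"] complex_Re_le_cmod[of "neg_logderiv s"] by linarith
      qed
      ultimately have "8 / 90 * (L * L) \<le> 3 + L + C" by linarith
      moreover have "C \<le> L" using L(1) N(2) D by simp
      ultimately show False using \<open>L * 200 \<le> L * L\<close> L1 by linarith
    qed
    \<comment> \<open>Half of the separation \<open>c / L\<close>, because a zero of \<open>zeta'\<close> in the disc has its own height in place of \<open>t\<close>.\<close>
    define r where "r = c / (2 * L)"
    have r: "r > 0" "r \<le> 1" "r \<le> d" "r * L = c / 2"
      using c L1 L(3) dL by (auto simp: r_def field_simps)
    define K where "K = c / (30240 * \<epsilon>)"
    have K: "K \<ge> 4" using \<epsilon> c by (simp add: K_def field_simps)
    have q: "Re (odd_logderiv (Complex (1 / 2 + r / 2) \<gamma>)) + C \<ge> K * L"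
    proof -
      have "K * L = r * L / (15120 * \<epsilon>) * L" unfolding r(4) K_def by simp
      also have "\<dots> = r * L / 15120 * (L / \<epsilon>)" by simp
      also have "\<dots> \<le> r * L / 15120 * (1 / \<sigma>)" using inv\<sigma> r L1 by (intro mult_left_mono) auto
      also have "\<dots> = r / (168 * d) * (d * L / (90 * \<sigma>))" using d0 by simp
      also have "\<dots> \<le> r / (168 * d) * (Re (odd_logderiv (Complex (1 / 2 + d / 2) t)) + C)"
        by (intro mult_left_mono growth) (use d0 d8 r \<open>2 * \<sigma> \<le> d\<close> in auto)
      also have "\<dots> \<le> Re (odd_logderiv (Complex (1 / 2 + r / 2) \<gamma>)) + C"
        by (rule window.N_harnack_chain) (use d0 d8 r in \<open>auto simp: d_def\<close>)
      finally show ?thesis .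
    qed
    have \<gamma>_ord: "\<gamma> \<in> Im ` zeta_nontrivial_zeros" using \<gamma> by (simp add: is_nearest_zeta_ordinate_def)
    have "r * L / 15 \<le> 4 / K + 8 * (C + D) / L"
    proof (rule window.N_bounded_above_simple_zero[OF _ r(1,2) _ _ K q])
      show "\<bar>\<gamma> - t\<bar> \<le> 8" using d8 by (simp add: d_def)
      obtain z where "z \<in> zeta_nontrivial_zeros" "Im z = \<gamma>" using \<gamma>_ord by auto
      moreover from this have "Re z = 1/2" using RH by (auto simp: riemann_hypothesis_def)
      ultimately have "z = Complex (1/2) \<gamma>" "zeta z = 0" by (auto simp: complex_eq_iff zeta_nontrivial_zeros_def)
      thus "zeta (Complex (1/2) \<gamma>) = 0" by simp
      fix s assume s: "s \<in> ball (Complex (1/2) \<gamma>) r"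
      show "deriv zeta s \<noteq> 0"
      proof
        assume "deriv zeta s = 0"
        have gs: "\<bar>\<gamma> - Im s\<bar> < r"
          using s abs_Im_le_cmod[of "Complex (1/2) \<gamma> - s"] by (simp add: dist_norm)
        have i: "\<bar>Im s - t\<bar> \<le> 9" using gs d8 r unfolding d_def by linarith
        hence i2: "Im s \<ge> T1" "Im s > 1" "Im s \<le> t * t"
        proof -
          show "Im s \<ge> T1" "Im s > 1" using i t by linarith+
          have "t + 9 \<le> t * 2" "t * 2 \<le> t * t" using t by (auto intro!: mult_left_mono)
          thus "Im s \<le> t * t" using i by linarith
        qed
        have "s \<in> zeta_deriv_nonreal_zeros" using \<open>deriv zeta s = 0\<close> i2 by (simp add: zeta_deriv_nonreal_zeros_def)
        hence "c \<le> \<bar>\<gamma> - Im s\<bar> * ln (Im s)" using i2 \<gamma>_ord by (intro far)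
        also have "\<dots> < r * (2 * L)"
        proof (rule mult_less_le_imp_less[OF gs])
          have "ln (Im s) \<le> ln (t * t)" using i2 by (intro ln_mono) auto
          thus "ln (Im s) \<le> 2 * L" using t by (simp add: L_def ln_mult)
        qed (use i2 in auto)
        finally show False using r(4) by simp
      qed
    qed
    moreover have "8 * (C + D) / L \<le> c / 120" using L(2) L1 c by (simp add: field_simps)
    moreover have "4 / K = 120960 * \<epsilon> / c" using c by (simp add: K_def)
    moreover have "120960 * \<epsilon> / c \<le> 120960 * (c\<^sup>2 / 10000000) / c" using \<epsilon> c by (intro divide_right_mono) auto
    moreover have "120960 * (c\<^sup>2 / 10000000) / c = 120960 / 10000000 * c" using c by (simp add: power2_eq_square)
    ultimately show False using r(4) c by linarith
  qed
  with \<epsilon>(1) show ?thesis by blast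
qed

theorem corollary1:
  fixes \<gamma>\<^sub>c :: "complex \<Rightarrow> real"
  assumes "riemann_hypothesis"
    and "\<And>\<rho>. \<rho> \<in> zeta_deriv_nonreal_zeros \<Longrightarrow> is_nearest_zeta_ordinate (Im \<rho>) (\<gamma>\<^sub>c \<rho>)"
    and "liminf_zeta_deriv_zeros (\<lambda>\<rho>. (Re \<rho> - 1 / 2) * ln (Im \<rho>)) = 0"
  shows "liminf_zeta_deriv_zeros (\<lambda>\<rho>. \<bar>\<gamma>\<^sub>c \<rho> - Im \<rho>\<bar> * ln (Im \<rho>)) = 0"
proof (rule antisym)
  define F where "F = inf (filtercomap Im at_top) (principal zeta_deriv_nonreal_zeros)"
  define f h where "f = (\<lambda>\<rho>. (Re \<rho> - 1 / 2) * ln (Im \<rho>))" and "h = (\<lambda>\<rho>. \<bar>\<gamma>\<^sub>c \<rho> - Im \<rho>\<bar> * ln (Im \<rho>))"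
  have ev: "eventually P F \<longleftrightarrow> (\<exists>T. \<forall>\<rho>. Im \<rho> \<ge> T \<longrightarrow> \<rho> \<in> zeta_deriv_nonreal_zeros \<longrightarrow> P \<rho>)" for P
    unfolding F_def eventually_inf_principal eventually_filtercomap_at_top_linorder ..
  have lf: "Liminf F (\<lambda>\<rho>. ereal (f \<rho>)) = 0"
    using assms(3) by (simp add: liminf_zeta_deriv_zeros_def F_def f_def)
  have lh: "liminf_zeta_deriv_zeros h = Liminf F (\<lambda>\<rho>. ereal (h \<rho>))"
    by (simp add: liminf_zeta_deriv_zeros_def F_def)
  have "\<forall>\<^sub>F \<rho> in F. 0 \<le> ereal (h \<rho>)"
    unfolding ev by (intro exI[of _ 1]) (auto simp: h_def intro!: mult_nonneg_nonneg)
  thus "0 \<le> liminf_zeta_deriv_zeros h" unfolding lh by (rule Liminf_bounded)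
  show "liminf_zeta_deriv_zeros h \<le> 0"
  proof (rule ccontr)
    assume "\<not> liminf_zeta_deriv_zeros h \<le> 0"
    hence "0 < Liminf F (\<lambda>\<rho>. ereal (h \<rho>))" unfolding lh by simp
    then obtain c where c: "0 < ereal c" "ereal c < Liminf F (\<lambda>\<rho>. ereal (h \<rho>))" using ereal_dense2 by blast
    have "\<forall>\<^sub>F \<rho> in F. ereal c < ereal (h \<rho>)" using c(2) by (rule less_LiminfD)
    then obtain T1 where T1: "\<And>\<rho>. Im \<rho> \<ge> T1 \<Longrightarrow> \<rho> \<in> zeta_deriv_nonreal_zeros \<Longrightarrow> c < h \<rho>"
      unfolding ev by auto
    have far: "c \<le> \<bar>g - Im \<rho>\<bar> * ln (Im \<rho>)"
      if "\<rho> \<in> zeta_deriv_nonreal_zeros" "max T1 1 \<le> Im \<rho>" "g \<in> Im ` zeta_nontrivial_zeros" for \<rho> g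
    proof -
      have "c \<le> h \<rho>" using T1[of \<rho>] that by simp
      also have "\<dots> \<le> \<bar>g - Im \<rho>\<bar> * ln (Im \<rho>)"
        unfolding h_def using assms(2)[OF that(1)] that
        by (intro mult_right_mono) (auto simp: is_nearest_zeta_ordinate_def)
      finally show ?thesis .
    qed
    have "\<exists>\<epsilon>>0. \<exists>T. \<forall>\<rho>\<in>zeta_deriv_nonreal_zeros. Im \<rho> \<ge> T \<longrightarrow> \<epsilon> \<le> \<bar>f \<rho>\<bar>"
      unfolding f_def
    proof (rule zeta_deriv_zeros_repelled[OF assms(1)])
      show "c > 0" using c(1) by simp
      show "\<exists>g. is_nearest_zeta_ordinate (Im \<rho>) g" if "\<rho> \<in> zeta_deriv_nonreal_zeros" for \<rho>
        using assms(2)[OF that] by blast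
    qed (rule far)
    then obtain \<epsilon> T where \<epsilon>: "\<epsilon> > 0" "\<And>\<rho>. \<rho> \<in> zeta_deriv_nonreal_zeros \<Longrightarrow> Im \<rho> \<ge> T \<Longrightarrow> \<epsilon> \<le> \<bar>f \<rho>\<bar>"
      by blast
    have "ereal (- \<epsilon>) < Liminf F (\<lambda>\<rho>. ereal (f \<rho>))" unfolding lf using \<epsilon> by simp
    hence "\<forall>\<^sub>F \<rho> in F. ereal (- \<epsilon>) < ereal (f \<rho>)" by (rule less_LiminfD)
    then obtain T2 where "\<And>\<rho>. Im \<rho> \<ge> T2 \<Longrightarrow> \<rho> \<in> zeta_deriv_nonreal_zeros \<Longrightarrow> - \<epsilon> < f \<rho>"
      unfolding ev by auto
    hence "\<forall>\<^sub>F \<rho> in F. ereal \<epsilon> \<le> ereal (f \<rho>)"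
      unfolding ev using \<epsilon>(2) by (intro exI[of _ "max T T2"]) (force simp: abs_if split: if_splits)
    hence "ereal \<epsilon> \<le> Liminf F (\<lambda>\<rho>. ereal (f \<rho>))" by (rule Liminf_bounded)
    thus False unfolding lf using \<epsilon>(1) by simp
  qed
qed

end
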